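(* Let $(M,d)$ be a proper geodesic hyperbolic metric space, $o\in M$, and $G=\mathrm{Isom}(M)$. Then there exists a constant $A_M>0$ such that for any group $\Gamma<G$ that acts properly and cocompactly on $M$, there exist constants $\alpha_\Gamma>0$ and $N_\Gamma\in\mathbb{N}$ depending only on $\Gamma$ such that for every non-elementary probability measure $\mu$ of finite support $S$ generating $\Gamma$, for every $t>0$ and $n\in\mathbb{N}$, setting $m_\mu=\min_{g\in S}\mu(g)$, we have $$\mathbb{P}\left(|\kappa(R_n)-n\ell(\mu)|\geq nt\right)\leq 2\exp\left(\frac{-n\,t^2\,m_\mu^{N_\Gamma}}{\alpha_\Gamma\,\kappa_S^2\,(\ln^+(\kappa_S)+A_M)^2}\right).$$
   Context: A metric space $M$ is hyperbolic if it is $\delta$-hyperbolic for some $\delta\ge0$, i.e. $(x|y)_o\geq \min\{(x|z)_o,(z|y)_o\}-\delta$ for all $x,y,z,o\in M$, where $(x|y)_o=\frac12(d(x,o)+d(y,o)-d(x,y))$. An isometry $\gamma$ is loxodromic if $(\gamma^n x)_{n\in\mathbb{Z}}$ is a quasi-geodesic for any $x\in M$; it then fixes exactly two points of the Gromov boundary. Two loxodromic elements are independent if their fixed point pairs are disjoint. A probability measure is non-elementary if the semigroup generated by its support contains two independent loxodromic elements. For $g\in G$, $\kappa(g)=d(go,o)$; $\kappa_S=\sup\{\kappa(g):g\in S\}$; $\ln^+x=\max\{\ln x,0\}$. $(X_i)_{i\ge1}$ are i.i.d. with law $\mu$, $R_n=X_1\cdots X_n$, and $\ell(\mu)$ is the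 drift, i.e. the almost sure limit of $\frac1n\kappa(R_n)$. *)

theory Defs
  imports "HOL-Probability.Probability" "HOL-Algebra.Generated_Groups"
begin

text \<open>The metric space \<open>M\<close> is the whole of a type of class \<^class>\<open>metric_space\<close>.\<close>

section \<open>Hyperbolic metric spaces\<close>

definition proper_space :: "'a::metric_space itself \<Rightarrow> bool" where
  "proper_space _ \<longleftrightarrow> (\<forall>(x::'a) r. compact (cball x r))"

definition geodesic_space :: "'a::metric_space itself \<Rightarrow> bool" where
  "geodesic_space _ \<longleftrightarrow>
     (\<forall>x y::'a. \<exists>c::real \<Rightarrow> 'a. c 0 = x \<and> c (dist x y) = y \<and>
        (\<forall>s\<in>{0..dist x y}. \<forall>t\<in>{0..dist x y}. dist (c s) (c t) = \<bar>s - t\<bar>))"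

definition gromov_product :: "'a::metric_space \<Rightarrow> 'a \<Rightarrow> 'a \<Rightarrow> real" where
  "gromov_product p x y = (dist x p + dist y p - dist x y) / 2"

definition hyperbolic_space :: "'a::metric_space itself \<Rightarrow> bool" where
  "hyperbolic_space _ \<longleftrightarrow>
     (\<exists>\<delta>\<ge>0. \<forall>x y z p::'a.
        gromov_product p x y \<ge> min (gromov_product p x z) (gromov_product p z y) - \<delta>)"

text \<open>
  The Gromov boundary, as the set of classes of sequences converging to infinity.  A sequence
  converges to infinity iff it is related to itself, i.e. \<open>(u\<^sub>i|u\<^sub>j)\<^sub>p\<close> tends to infinity
  as \<open>i, j\<close> tend to infinity independently.  Gromov products for two base points differ by
  a bounded amount, so neither notion depends on \<open>p\<close>.
\<close>

definition gromov_rel :: "'a::metric_space \<Rightarrow> ((nat \<Rightarrow> 'a) \<times> (nat \<Rightarrow> 'a)) set" where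
  "gromov_rel p = {(u, v).
     filterlim (\<lambda>(i, j). gromov_product p (u i) (v j)) at_top (sequentially \<times>\<^sub>F sequentially)}"

definition gromov_boundary :: "'a::metric_space \<Rightarrow> (nat \<Rightarrow> 'a) set set" where
  "gromov_boundary p = {u. (u, u) \<in> gromov_rel p} // gromov_rel p"

section \<open>Isometries\<close>

definition isom_group :: "('a::metric_space \<Rightarrow> 'a) monoid" where
  "isom_group = \<lparr>carrier = {g. bij g \<and> (\<forall>x y. dist (g x) (g y) = dist x y)},
                 mult = (\<circ>), one = id\<rparr>"

lemma group_isom_group: "group (isom_group :: ('a::metric_space \<Rightarrow> 'a) monoid)"
proof (rule groupI)
  fix g :: "'a \<Rightarrow> 'a" assume "g \<in> carrier isom_group"
  then have g: "bij g" "\<And>x y. dist (g x) (g y) = dist x y"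
    by (auto simp: isom_group_def)
  have "dist (inv_into UNIV g x) (inv_into UNIV g y) = dist x y" for x y
    using g(2)[of "inv_into UNIV g x" "inv_into UNIV g y"] g(1)
    by (simp add: bij_is_surj surj_f_inv_f)
  then show "\<exists>h\<in>carrier isom_group. h \<otimes>\<^bsub>isom_group\<^esub> g = \<one>\<^bsub>isom_group\<^esub>"
    using g(1) by (intro bexI[of _ "inv_into UNIV g"])
      (auto simp: isom_group_def bij_imp_bij_inv bij_is_inj)
qed (auto simp: isom_group_def bij_comp comp_assoc)

text \<open>Properness is with respect to the discrete topology on \<open>\<Gamma>\<close>.\<close>

definition acts_properly :: "('a::metric_space \<Rightarrow> 'a) set \<Rightarrow> bool" where
  "acts_properly \<Gamma> \<longleftrightarrow> (\<forall>K. compact K \<longrightarrow> finite {g \<in> \<Gamma>. g ` K \<inter> K \<noteq> {}})"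

definition acts_cocompactly :: "('a::metric_space \<Rightarrow> 'a) set \<Rightarrow> bool" where
  "acts_cocompactly \<Gamma> \<longleftrightarrow> (\<exists>K. compact K \<and> (\<Union>g\<in>\<Gamma>. g ` K) = UNIV)"

definition quasi_geodesic :: "(int \<Rightarrow> 'a::metric_space) \<Rightarrow> bool" where
  "quasi_geodesic c \<longleftrightarrow>
     (\<exists>L\<ge>1. \<exists>C\<ge>0. \<forall>m n::int.
        \<bar>real_of_int (m - n)\<bar> / L - C \<le> dist (c m) (c n) \<and>
        dist (c m) (c n) \<le> L * \<bar>real_of_int (m - n)\<bar> + C)"

definition loxodromic :: "('a::metric_space \<Rightarrow> 'a) \<Rightarrow> bool" where
  "loxodromic g \<longleftrightarrow> g \<in> carrier isom_group \<and>
     (\<forall>x. quasi_geodesic (\<lambda>n::int. (g [^]\<^bsub>isom_group\<^esub> n) x))"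

text \<open>An isometry acts on the boundary by \<open>[(u\<^sub>i)] \<mapsto> [(g u\<^sub>i)]\<close>, and since it is bijective
  the class \<open>[(g u\<^sub>i)]\<close> is the image of the class \<open>[(u\<^sub>i)]\<close>.\<close>

definition boundary_fixed_points :: "'a::metric_space \<Rightarrow> ('a \<Rightarrow> 'a) \<Rightarrow> (nat \<Rightarrow> 'a) set set" where
  "boundary_fixed_points p g = {\<xi> \<in> gromov_boundary p. (\<lambda>u. g \<circ> u) ` \<xi> = \<xi>}"

definition independent_loxodromics ::
  "'a::metric_space \<Rightarrow> ('a \<Rightarrow> 'a) \<Rightarrow> ('a \<Rightarrow> 'a) \<Rightarrow> bool" where
  "independent_loxodromics p g h \<longleftrightarrow> loxodromic g \<and> loxodromic h \<and>
     boundary_fixed_points p g \<inter> boundary_fixed_points p h = {}"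

inductive_set semigroup_generated :: "('a \<Rightarrow> 'a) set \<Rightarrow> ('a \<Rightarrow> 'a) set"
  for S :: "('a \<Rightarrow> 'a) set" where
  base: "g \<in> S \<Longrightarrow> g \<in> semigroup_generated S"
| comp: "g \<in> semigroup_generated S \<Longrightarrow> h \<in> semigroup_generated S \<Longrightarrow> g \<circ> h \<in> semigroup_generated S"

definition non_elementary :: "'a::metric_space \<Rightarrow> ('a \<Rightarrow> 'a) pmf \<Rightarrow> bool" where
  "non_elementary p \<mu> \<longleftrightarrow>
     (\<exists>g\<in>semigroup_generated (set_pmf \<mu>). \<exists>h\<in>semigroup_generated (set_pmf \<mu>).
        independent_loxodromics p g h)"

section \<open>Displacement and random walk\<close>

definition kappa :: "'a::metric_space \<Rightarrow> ('a \<Rightarrow> 'a) \<Rightarrow> real" where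
  "kappa p g = dist (g p) p"

definition kappa_sup :: "'a::metric_space \<Rightarrow> ('a \<Rightarrow> 'a) set \<Rightarrow> real" where
  "kappa_sup p S = (SUP g\<in>S. kappa p g)"

definition ln_plus :: "real \<Rightarrow> real" where
  "ln_plus x = max (ln x) 0"

text \<open>
  The i.i.d. steps \<open>X\<^sub>i\<close>, \<open>i \<ge> 1\<close>, with law \<open>\<mu>\<close> are the coordinates of the product space
  \<open>S\<^sup>{1,2,\<dots>}\<close>, where \<open>S\<close> is the support of \<open>\<mu>\<close>.  Restricting each factor to the countable
  set \<open>S\<close> matters: the \<sigma>-algebra of \<^term>\<open>measure_pmf \<mu>\<close> is the power set of the (possibly
  huge) function type, and products of such \<sigma>-algebras need not make \<open>X\<^sub>1 X\<^sub>2\<close> measurable.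
\<close>

definition step_space :: "'b pmf \<Rightarrow> (nat \<Rightarrow> 'b) measure" where
  "step_space \<mu> = (\<Pi>\<^sub>M i\<in>{1..}. restrict_space (measure_pmf \<mu>) (set_pmf \<mu>))"

lemma prob_space_step_space: "prob_space (step_space \<mu>)"
  unfolding step_space_def
proof (rule prob_space_PiM)
  show "prob_space (restrict_space (measure_pmf \<mu>) (set_pmf \<mu>))"
    by (rule prob_spaceI)
      (simp add: space_restrict_space emeasure_restrict_space measure_pmf.emeasure_eq_measure
        measure_measure_pmf_finite measure_pmf.prob_eq_1 AE_measure_pmf)
qed

primrec walk :: "nat \<Rightarrow> (nat \<Rightarrow> 'a \<Rightarrow> 'a) \<Rightarrow> 'a \<Rightarrow> 'a" where
  "walk 0 X = id"
| "walk (Suc n) X = walk n X \<circ> X (Suc n)"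

definition drift :: "'a::metric_space \<Rightarrow> ('a \<Rightarrow> 'a) pmf \<Rightarrow> real" where
  "drift p \<mu> = (THE l. AE X in step_space \<mu>. (\<lambda>n. kappa p (walk n X) / real n) \<longlonglongrightarrow> l)"

end

theory Submission
  imports Defs
begin

text \<open>
  The deviations of \<open>\<kappa>(R\<^sub>n)\<close> are controlled by the Azuma--Hoeffding method.  Since
  \<open>\<kappa>(gh) = \<kappa>(g) + \<kappa>(h) - 2 (g\<^sup>-\<^sup>1o|ho)\<^sub>o\<close>, both the increments of the martingale
  \<open>E[\<kappa>(R\<^sub>n) | X\<^sub>1, \<dots>, X\<^sub>k]\<close> and the difference between \<open>E \<kappa>(R\<^sub>n)\<close> and \<open>n \<ell>(\<mu>)\<close> are bounded once
  \<open>E (x|R\<^sub>no)\<^sub>o\<close> is bounded uniformly in \<open>x\<close> and \<open>n\<close>.  If \<open>(x|R\<^sub>no)\<^sub>o\<close> is large, the walk must cross every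
  point \<open>y\<close> of an initial segment of the geodesic from \<open>o\<close> to \<open>x\<close>: some step from \<open>g o\<close> to \<open>g s o\<close> at time
  \<open>k\<close> passes within \<open>O(log k)\<close> of \<open>y\<close>.  This leaves only polynomially many choices of \<open>g\<close>, linearly many
  in \<open>\<kappa>\<^sub>S\<close> (whence the logarithm of \<open>\<kappa>\<^sub>S\<close>), while \<open>P(R\<^sub>k = g)\<close> decays exponentially in \<open>k\<close> at a rate
  proportional to \<open>m\<^sub>\<mu>\<close>.

  That rate comes from a uniform spectral gap: every finite generating set \<open>S\<close> of \<open>\<Gamma>\<close> has, among the words of
  length at most \<open>N\<^sub>\<Gamma>\<close>, three elements that play ping-pong on \<open>\<ell>\<^sup>2\<close> functions.  If \<open>S\<close> moves some point little,
  it is conjugate to one of finitely many sets.  Otherwise a word of length at most two is hyperbolic with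
  translation length comparable to the displacement of \<open>S\<close>, and either a conjugate by a generator
  yields the triple, or by pigeonhole a bounded power of it generates a normal subgroup, which is
  impossible in the presence of independent loxodromic elements.
\<close>

section \<open>Gromov products\<close>

text \<open>The measure \<mu> need not be symmetric, so decay is not read off a spectrum; it is
  driven by a lower bound on how far some generator displaces an arbitrary finitely supported
  function. Three ping-pong elements are taken because the estimate for one bounds the squared norm
  by the mass on an attracting and on a repelling set. Summed over three, disjointness leaves 3 on
  the left against 2 on the right, up to displacement; two elements would give nothing. The
  dependence on \<mu> is confined to two numbers: a bound K on the displacement of the generators at
  \<open>p\<close>, and a decay rate \<tau> proportional to the least weight. The power of \<tau>
  that is lost depends only on \<delta> and the growth of orbits, because crossings are counted
  within a radius logarithmic in time; twice this power is \<open>N\<close>. Errors of size \<delta>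
  become multiples of K through a positive lower bound on nonzero displacements in \<Gamma>; as
  \<alpha> may depend on \<Gamma>, the constant added to the logarithm can then be 1 for every
  space. Expectations are iterated finite sums; the product space enters only to identify the event
  and the drift.\<close>

abbreviation gp :: "'a::metric_space \<Rightarrow> 'a \<Rightarrow> 'a \<Rightarrow> real" where "gp \<equiv> gromov_product"

lemma gp_commute: "gp p x y = gp p y x"
  by (simp add: gromov_product_def dist_commute)

lemma gp_nonneg: "0 \<le> gp p x y"
  using dist_triangle[of x y p] by (simp add: gromov_product_def dist_commute)

lemma gp_le_dist: "gp p x y \<le> dist x p"
  using dist_triangle[of y p x] by (simp add: gromov_product_def dist_commute)

lemma gp_le_dist': "gp p x y \<le> dist y p"
  using gp_le_dist[of p y x] by (simp add: gp_commute)

lemma gp_base [simp]: "gp p p x = 0" "gp p x p = 0"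
  by (simp_all add: gromov_product_def dist_commute)

lemma gp_swap: "gp p x y = dist x p - gp x p y"
  by (simp add: gromov_product_def dist_commute field_simps)

lemma gp_ge: "dist x p - dist x y \<le> gp p x y"
  using dist_triangle[of x p y] by (simp add: gromov_product_def dist_commute field_simps)

lemma gp_lipschitz: "gp p x y \<le> gp p x' y + dist x x'"
  using dist_triangle[of x p x'] dist_triangle[of x' y x]
  by (simp add: gromov_product_def dist_commute field_simps)

lemma gp_lipschitz': "gp p x y \<le> gp p x y' + dist y y'"
  using gp_lipschitz[of p y x y'] by (simp add: gp_commute)

lemma gp_base_lipschitz: "gp p x y \<le> gp q x y + dist p q"
  using dist_triangle[of x p q] dist_triangle[of y p q]
  by (simp add: gromov_product_def dist_commute field_simps)

lemma dist_gp: "dist x y = dist x p + dist y p - 2 * gp p x y"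
  by (simp add: gromov_product_def field_simps)

section \<open>Isometries\<close>

abbreviation finv :: "('a \<Rightarrow> 'b) \<Rightarrow> 'b \<Rightarrow> 'a" where "finv \<equiv> inv_into UNIV"

abbreviation isom :: "('a::metric_space \<Rightarrow> 'a) \<Rightarrow> bool" where
  "isom g \<equiv> g \<in> carrier isom_group"

lemma isom_iff: "isom g \<longleftrightarrow> bij g \<and> (\<forall>x y. dist (g x) (g y) = dist x y)"
  by (simp add: isom_group_def)

lemma isom_dist: "isom g \<Longrightarrow> dist (g x) (g y) = dist x y"
  by (simp add: isom_iff)

lemma isom_bij: "isom g \<Longrightarrow> bij g"
  by (simp add: isom_iff)

lemma isom_id [simp]: "isom id"
  by (simp add: isom_iff)

lemma isom_comp [intro]: "isom g \<Longrightarrow> isom h \<Longrightarrow> isom (g \<circ> h)"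
  by (simp add: isom_iff bij_comp)

lemma isom_inv_apply [simp]: "isom g \<Longrightarrow> finv g (g x) = x" "isom g \<Longrightarrow> g (finv g x) = x"
  by (simp_all add: isom_iff bij_is_inj bij_is_surj surj_f_inv_f)

lemma isom_inv [intro]: "isom g \<Longrightarrow> isom (finv g)"
  unfolding isom_iff
proof (intro conjI allI; elim conjE)
  fix x y assume "bij g" "\<forall>x y. dist (g x) (g y) = dist x y"
  then show "dist (finv g x) (finv g y) = dist x y"
    using bij_is_surj surj_f_inv_f by metis
qed (rule bij_imp_bij_inv)

lemma isom_inv_comp [simp]: "isom g \<Longrightarrow> finv g \<circ> g = id" "isom g \<Longrightarrow> g \<circ> finv g = id"
  by (simp_all add: fun_eq_iff)

lemma isom_inv_inv: "isom g \<Longrightarrow> finv (finv g) = g"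
  by (simp add: isom_bij inv_inv_eq)

lemma isom_inv_of_comp: "isom g \<Longrightarrow> isom h \<Longrightarrow> finv (g \<circ> h) = finv h \<circ> finv g"
  by (simp add: isom_bij o_inv_distrib)

lemma isom_funpow [intro]: "isom g \<Longrightarrow> isom (g ^^ n)"
  by (induction n) (auto simp: isom_comp)

lemma isom_group_mult: "g \<otimes>\<^bsub>isom_group\<^esub> h = g \<circ> h"
  and isom_group_one: "\<one>\<^bsub>isom_group\<^esub> = id"
  by (simp_all add: isom_group_def)

lemma isom_group_inv: "isom g \<Longrightarrow> inv\<^bsub>isom_group\<^esub> g = finv g"
  by (intro group.inv_equality[OF group_isom_group])
     (auto simp: isom_group_mult isom_group_one)

lemma isom_gp: "isom g \<Longrightarrow> gp (g p) (g x) (g y) = gp p x y"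
  by (simp add: gromov_product_def isom_dist)

lemma isom_dist_inv: "isom g \<Longrightarrow> dist (finv g x) y = dist x (g y)"
  using isom_dist[of g "finv g x" y] by simp

lemma isom_dist_inv_base: "isom g \<Longrightarrow> dist (finv g x) x = dist (g x) x"
  using isom_dist_inv[of g x x] by (simp add: dist_commute)

lemma isom_gp_inv: "isom g \<Longrightarrow> gp (finv g p) x y = gp p (g x) (g y)"
  using isom_gp[of g "finv g p" x y] by simp

lemma dist_comp_gp:
  "isom g \<Longrightarrow> dist (g (h p)) p = dist (g p) p + dist (h p) p - 2 * gp p (finv g p) (h p)"
  using dist_gp[of "finv g p" "h p" p] isom_dist_inv_base[of g p] isom_dist_inv[of g p "h p"]
  by (simp add: dist_commute)

lemma isom_inv_funpow: "isom g \<Longrightarrow> finv (g ^^ n) = finv g ^^ n"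
  by (simp add: inv_fn isom_bij)

lemma isom_funpow_cancel [simp]:
  "isom g \<Longrightarrow> (finv g ^^ n) ((g ^^ n) x) = x" "isom g \<Longrightarrow> (g ^^ n) ((finv g ^^ n) x) = x"
  using isom_inv_apply[OF isom_funpow[of g n], of x] by (simp_all add: isom_inv_funpow)

lemma dist_inv_funpow: "isom g \<Longrightarrow> dist ((finv g ^^ n) q) q = dist ((g ^^ n) q) q"
  using isom_dist_inv_base[OF isom_funpow[of g n], of q] by (simp add: isom_inv_funpow)

lemma dist_funpow_le: "isom g \<Longrightarrow> dist ((g ^^ n) q) q \<le> real n * dist (g q) q"
proof (induction n)
  case (Suc n)
  have "dist ((g ^^ Suc n) q) q \<le> dist (g ((g ^^ n) q)) (g q) + dist (g q) q"
    by (simp add: dist_triangle)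
  also have "dist (g ((g ^^ n) q)) (g q) = dist ((g ^^ n) q) q"
    using Suc.prems by (simp add: isom_dist)
  finally show ?case using Suc by (simp add: algebra_simps)
qed simp

section \<open>Hyperbolic spaces and quasi-axes\<close>

text \<open>Enlarging \<delta> to at least 1 lets it absorb unit errors, such as the 1 lost when a
  joint displacement is only nearly minimal. The point \<open>p\<close> is the base point
  \<open>o\<close>; hyperbolicity is available at every \<open>q\<close>, since the argument keeps
  moving the base point.\<close>

locale hyperbolic_metric =
  fixes \<delta> :: real and p :: "'a::metric_space"
  assumes delta_ge: "1 \<le> \<delta>"
    and hyp: "\<And>q x z y :: 'a. gp q x y \<ge> min (gp q x z) (gp q z y) - \<delta>"
begin

lemma four_points:
  fixes x y z w :: 'a
  shows "dist x y + dist z w \<le> max (dist x z + dist y w) (dist x w + dist y z) + 2 * \<delta>"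
  using hyp[of w x z y] by (simp add: gromov_product_def dist_commute min_def max_def field_simps split: if_splits)

lemma hyp2:
  fixes x y z w q :: 'a
  shows "gp q x y \<ge> min (gp q x z) (min (gp q z w) (gp q w y)) - 2 * \<delta>"
  using hyp[of q x z y] hyp[of q z w y] delta_ge by linarith

text \<open>A small product of \<open>u\<close> and \<open>v\<close> at a point puts it near a
  geodesic between them, and its distance from \<open>u\<close> then fixes its position.\<close>

lemma dist_le_of_between:
  fixes x y u v :: 'a
  assumes "gp x u v \<le> e" "gp y u v \<le> e" "\<bar>dist u x - dist u y\<bar> \<le> a"
  shows "dist x y \<le> a + 2 * e + 2 * \<delta>"
proof -
  have "dist v x = dist u v + 2 * gp x u v - dist u x" "dist v y = dist u v + 2 * gp y u v - dist u y"
    by (simp_all add: gromov_product_def field_simps)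
  then show ?thesis using four_points[of x y u v] assms by (auto simp: dist_commute abs_le_iff max_def split: if_splits)
qed

text \<open>At every point of the orbit of \<open>q\<close> past and future point in different
  directions, up to C, since powers of \<open>g\<close> bring that point back to \<open>q\<close>.
  The orbit may still be bounded (the identity qualifies if \<open>0 \<le> C\<close>); growth is a
  separate hypothesis.\<close>

definition quasi_axis :: "real \<Rightarrow> 'a \<Rightarrow> ('a \<Rightarrow> 'a) \<Rightarrow> bool" where
  "quasi_axis C q g \<longleftrightarrow> isom g \<and> (\<forall>i j. gp q ((g ^^ i) q) ((finv g ^^ j) q) \<le> C)"

lemma quasi_axis_isom: "quasi_axis C q g \<Longrightarrow> isom g"
  by (simp add: quasi_axis_def)

lemma quasi_axis_inv: "quasi_axis C q g \<Longrightarrow> quasi_axis C q (finv g)"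
  unfolding quasi_axis_def by (metis isom_inv isom_inv_inv gp_commute)

lemma quasi_axis_funpow: "quasi_axis C q g \<Longrightarrow> quasi_axis C q (g ^^ n)"
  unfolding quasi_axis_def by (simp add: isom_funpow isom_inv_funpow funpow_mult)

lemma quasi_axis_add:
  assumes "quasi_axis C q g"
  shows "dist ((g ^^ i) q) q + dist ((g ^^ j) q) q - 2 * C \<le> dist ((g ^^ (i + j)) q) q"
proof -
  have g: "isom g" and "gp q ((g ^^ j) q) ((finv g ^^ i) q) \<le> C"
    using assms by (simp_all add: quasi_axis_def)
  then show ?thesis
    using dist_comp_gp[OF isom_funpow[OF g, of i], of "g ^^ j" q] gp_commute[of q "(finv g ^^ i) q"]
    by (simp add: isom_inv_funpow funpow_add)
qed

lemma quasi_axis_gp_ge: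
  assumes "quasi_axis C q g" "i \<le> j"
  shows "dist ((g ^^ i) q) q - C \<le> gp q ((g ^^ i) q) ((g ^^ j) q)"
proof -
  have g: "isom g" using assms by (simp add: quasi_axis_def)
  have "gp ((g ^^ i) q) q ((g ^^ j) q) = gp q ((finv g ^^ i) q) ((g ^^ (j - i)) q)"
    using isom_gp[OF isom_funpow[OF g], of i q "(finv g ^^ i) q" "(g ^^ (j - i)) q"] g assms(2)
    by (simp flip: funpow_add[THEN fun_cong, unfolded o_apply])
  also have "\<dots> \<le> C" using assms(1) unfolding quasi_axis_def by (metis gp_commute)
  finally show ?thesis using gp_swap[of q "(g ^^ i) q" "(g ^^ j) q"] by linarith
qed

text \<open>The two bounds feed each other: translating the first by \<open>g\<close> gives the
  second for the next power, and the second with hyperbolicity gives back the first, because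
  \<open>g q\<close> and \<open>finv g q\<close> part after \<open>R\<close>.\<close>

lemma gp_inv_funpow_le:
  fixes q :: 'a
  assumes g: "isom g" and R: "gp q (g q) (finv g q) \<le> R" and big: "2 * R + 3 * \<delta> < dist (g q) q"
  shows "gp q (finv g q) ((g ^^ Suc n) q) \<le> R + \<delta>
    \<and> dist (g q) q - R - \<delta> \<le> gp q (g q) ((g ^^ Suc n) q)"
proof (induction n)
  case 0
  have "0 \<le> R" using gp_nonneg R order_trans by blast
  moreover have "gp q (g q) (g q) = dist (g q) q" by (simp add: gromov_product_def)
  ultimately show ?case using R delta_ge by (simp add: gp_commute)
next
  case (Suc n)
  have "gp (g q) q ((g ^^ Suc (Suc n)) q) = gp q (finv g q) ((g ^^ Suc n) q)"
    using isom_gp[OF g, of q "finv g q" "(g ^^ Suc n) q"] g by simp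
  then have *: "dist (g q) q - R - \<delta> \<le> gp q (g q) ((g ^^ Suc (Suc n)) q)"
    using Suc gp_swap[of q "g q" "(g ^^ Suc (Suc n)) q"] by linarith
  have "min (gp q (finv g q) ((g ^^ Suc (Suc n)) q)) (gp q ((g ^^ Suc (Suc n)) q) (g q)) - \<delta>
     \<le> gp q (finv g q) (g q)" by (rule hyp)
  then show ?case
    using * R big gp_commute[of q "g q" "(g ^^ Suc (Suc n)) q"] gp_commute[of q "g q" "finv g q"]
      delta_ge by (intro conjI) linarith+
qed

text \<open>Local to global: all positive powers leave \<open>q\<close> in the direction of
  \<open>g q\<close>, and no negative power follows it beyond \<open>R + \<delta>\<close>. The
  threshold \<open>2 * R + 3 * \<delta>\<close> makes the common part of \<open>g q\<close> with the
  positive powers exceed \<open>R + 2 * \<delta>\<close>.\<close>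

lemma quasi_axisI:
  fixes q :: 'a
  assumes g: "isom g" and R: "gp q (g q) (finv g q) \<le> R" and big: "2 * R + 3 * \<delta> < dist (g q) q"
  shows "quasi_axis (R + 2 * \<delta>) q g"
  unfolding quasi_axis_def
proof (intro conjI allI)
  fix i j
  have R0: "0 \<le> R" using gp_nonneg R order_trans by blast
  show "gp q ((g ^^ i) q) ((finv g ^^ j) q) \<le> R + 2 * \<delta>"
  proof (cases "i = 0 \<or> j = 0")
    case True
    then show ?thesis using R0 delta_ge by auto
  next
    case False
    then obtain i' j' where ij: "i = Suc i'" "j = Suc j'" by (metis not0_implies_Suc)
    have i: "dist (g q) q - R - \<delta> \<le> gp q (g q) ((g ^^ i) q)"
      using gp_inv_funpow_le[OF g R big, of i'] ij by simp
    have j: "gp q (g q) ((finv g ^^ j) q) \<le> R + \<delta>"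
      using gp_inv_funpow_le[of "finv g" q R j'] g R big ij
      by (simp add: isom_inv isom_inv_inv isom_dist_inv_base gp_commute)
    show ?thesis using hyp[of q "g q" "(g ^^ i) q" "(finv g ^^ j) q"] i j big by linarith
  qed
qed (rule g)

text \<open>Each further factor \<open>g\<close> adds its displacement minus twice the backtracking,
  which stays at most \<open>R + \<delta>\<close> at every stage.\<close>

lemma funpow_dist_ge:
  fixes q :: 'a
  assumes g: "isom g" and R: "gp q (g q) (finv g q) \<le> R" and big: "2 * R + 3 * \<delta> < dist (g q) q"
  shows "real n * (dist (g q) q - 2 * R - 2 * \<delta>) \<le> dist ((g ^^ n) q) q"
proof (induction n)
  case (Suc n)
  have "gp q (finv g q) ((g ^^ n) q) \<le> R + \<delta>"
  proof (cases n)
    case 0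
    have "0 \<le> R" using gp_nonneg R order_trans by blast
    then show ?thesis using 0 delta_ge by simp
  next
    case (Suc k) then show ?thesis using gp_inv_funpow_le[OF g R big, of k] by simp
  qed
  then show ?case using dist_comp_gp[OF g, of "g ^^ n" q] Suc by (simp add: algebra_simps)
qed simp

text \<open>Since \<open>f\<close> and \<open>g\<close> have the same displacements, \<open>s f\<^sup>j q\<close> keeps a constant offset from \<open>g\<^sup>j q\<close> along
  the common direction, up to a bounded error.\<close>
lemma fellow_travel:
  assumes g: "quasi_axis C q g" and f: "quasi_axis C q f" and s: "isom s"
    and same: "\<And>n. dist ((f ^^ n) q) q = dist ((g ^^ n) q) q"
    and L: "dist (s q) q \<le> L"
    and W: "dist ((g ^^ k) q) q + 2 * C + L \<le> gp q ((g ^^ m) q) (s ((f ^^ m) q))"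
    and far: "2 * C + 3 * \<delta> + L < dist ((g ^^ j) q) q"
    and jk: "j \<le> k" "k \<le> m"
    and far': "2 * C + 3 * \<delta> + L < dist ((g ^^ k) q) q"
  shows "dist ((finv g ^^ j) (s ((f ^^ j) q))) ((finv g ^^ k) (s ((f ^^ k) q))) \<le> 8 * C + 12 * \<delta>"
proof -
  define K where "K n = dist ((g ^^ n) q) q" for n
  define B where "B n = s ((f ^^ n) q)" for n
  define \<beta> where "\<beta> n = dist (B n) q" for n
  have gi: "isom g" and fi: "isom f" using f g by (auto simp: quasi_axis_def)
  have C0: "0 \<le> C" using g gp_nonneg order_trans unfolding quasi_axis_def by blast
  have \<beta>_le: "\<beta> n \<le> K n + L" and \<beta>_ge: "K n - L \<le> \<beta> n" for n
  proof -
    have "dist (B n) (s q) = K n" unfolding B_def K_def using s same by (simp add: isom_dist)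
    then show "\<beta> n \<le> K n + L" "K n - L \<le> \<beta> n"
      using dist_triangle[of "B n" q "s q"] dist_triangle[of "B n" "s q" q] L
      unfolding \<beta>_def by (auto simp: dist_commute)
  qed
  \<comment> \<open>Seen from the distant point \<open>B a\<close>, the points \<open>q\<close> and
    \<open>s q\<close> lie in the same direction, being at most \<open>L\<close> apart; so the path
    does not turn back towards \<open>q\<close> after time \<open>a\<close>.\<close>
  have turn: "gp (B a) q (B b) \<le> C + \<delta>" if "2 * C + 3 * \<delta> + L < K a" "a \<le> b" for a b
  proof -
    have "gp (B a) (s q) (B b) = gp ((f ^^ a) q) q ((f ^^ b) q)"
      unfolding B_def using s by (simp add: isom_gp)
    also have "\<dots> = dist ((f ^^ a) q) q - gp q ((f ^^ a) q) ((f ^^ b) q)"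
      using gp_swap[of q "(f ^^ a) q" "(f ^^ b) q"] by simp
    also have "\<dots> \<le> C" using quasi_axis_gp_ge[OF f that(2)] by linarith
    finally have "gp (B a) (s q) (B b) \<le> C" .
    moreover have "K a - L \<le> gp (B a) (s q) q"
    proof -
      have "dist (s q) (B a) = K a" unfolding B_def K_def using s same by (simp add: isom_dist dist_commute)
      then show ?thesis using gp_ge[of "s q" "B a" q] L by (simp add: dist_commute)
    qed
    ultimately show ?thesis using hyp[of "B a" "s q" q "B b"] that delta_ge C0 by linarith
  qed
  \<comment> \<open>By the hypothesis at time \<open>m\<close> the two paths run together past
    distance \<open>K k + 2 * C + L\<close>, so every \<open>B a\<close> that is not farther than
    this points to \<open>(g ^^ m) q\<close>.\<close>
  have toward: "\<beta> a - C - 2 * \<delta> \<le> gp q ((g ^^ m) q) (B a)"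
    if "2 * C + 3 * \<delta> + L < K a" "a \<le> m" "\<beta> a \<le> K k + 2 * C + L" for a
  proof -
    have "\<beta> a - C - \<delta> \<le> gp q (B a) (B m)"
      using turn[OF that(1,2)] gp_swap[of q "B a" "B m"] by (simp add: \<beta>_def)
    then show ?thesis using hyp[of q "(g ^^ m) q" "B m" "B a"] W that(3) delta_ge C0
      unfolding B_def[symmetric] K_def[symmetric] by (smt (verit) gp_commute)
  qed
  define i where "i = k - j"
  have k: "k = j + i" using jk by (simp add: i_def)
  have Ka: "K (a + b) \<le> K a + K b" "K a + K b - 2 * C \<le> K (a + b)" for a b
  proof -
    have "dist ((g ^^ a) ((g ^^ b) q)) q \<le> dist ((g ^^ a) ((g ^^ b) q)) ((g ^^ a) q) + dist ((g ^^ a) q) q"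
      by (rule dist_triangle)
    then show "K (a + b) \<le> K a + K b"
      unfolding K_def using gi by (simp add: funpow_add isom_dist isom_funpow)
    show "K a + K b - 2 * C \<le> K (a + b)" using quasi_axis_add[OF g] by (simp add: K_def)
  qed
  have \<beta>k: "\<beta> k = \<beta> j + K i - 2 * gp (B j) q (B k)"
  proof -
    have "dist (B j) (B k) = K i"
      unfolding B_def K_def k using s fi same[of i]
      by (simp add: isom_dist funpow_add isom_funpow dist_commute)
    then show ?thesis using dist_gp[of q "B k" "B j"] by (simp add: \<beta>_def dist_commute)
  qed
  have jfar: "2 * C + 3 * \<delta> + L < K j" and kfar: "2 * C + 3 * \<delta> + L < K k"
    using far far' by (simp_all add: K_def)
  have \<beta>kb: "\<beta> j + K i - 2 * C - 2 * \<delta> \<le> \<beta> k" "\<beta> k \<le> \<beta> j + K i"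
    using \<beta>k turn[OF jfar jk(1)] gp_nonneg[of "B j" q "B k"] by auto
  have "K j \<le> K k + 2 * C"
    using Ka(2)[of j i] zero_le_dist[of "(g ^^ i) q" q] unfolding k K_def by linarith
  have Wk: "K k + 2 * C + L \<le> K m"
    using W gp_le_dist[of q "(g ^^ m) q" "s ((f ^^ m) q)"] by (simp add: K_def)
  have tk: "\<beta> k - C - 2 * \<delta> \<le> gp q ((g ^^ m) q) (B k)"
    using toward[OF kfar jk(2)] \<beta>_le[of k] C0 by simp
  have tj: "\<beta> j - C - 2 * \<delta> \<le> gp q ((g ^^ m) q) (B j)"
    using toward[OF jfar] jk \<beta>_le[of j] \<open>K j \<le> K k + 2 * C\<close> by simp
  define D where "D = dist ((g ^^ i) (B j)) q"
  have w: "gp q ((finv g ^^ i) q) (B j) \<le> C + \<delta>"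
  proof -
    have "gp q ((finv g ^^ i) q) ((g ^^ m) q) \<le> C"
      using g unfolding quasi_axis_def by (metis gp_commute)
    moreover have "C + \<delta> < gp q (B j) ((g ^^ m) q)"
      using tj \<beta>_ge[of j] jfar gp_commute[of q "B j"] by simp
    ultimately show ?thesis
      using hyp[of q "(finv g ^^ i) q" "B j" "(g ^^ m) q"] by linarith
  qed
  have D: "D = K i + \<beta> j - 2 * gp q ((finv g ^^ i) q) (B j)"
    using dist_comp_gp[OF isom_funpow[OF gi, of i], of "\<lambda>_. B j" q]
    by (simp add: D_def K_def \<beta>_def isom_inv_funpow[OF gi])
  have Db: "K i + \<beta> j - 2 * C - 2 * \<delta> \<le> D" "D \<le> K i + \<beta> j"
    using D w gp_nonneg[of q "(finv g ^^ i) q" "B j"] by auto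
  have shift: "D - 2 * C - 2 * \<delta> \<le> gp q ((g ^^ i) (B j)) ((g ^^ (i + m)) q)"
  proof -
    have "2 * gp q ((g ^^ i) (B j)) ((g ^^ (i + m)) q) = D + K (i + m) - dist (B j) ((g ^^ m) q)"
      using gi by (simp add: gromov_product_def D_def K_def funpow_add isom_dist isom_funpow)
    moreover have "2 * gp q ((g ^^ m) q) (B j) = K m + \<beta> j - dist (B j) ((g ^^ m) q)"
      by (simp add: gromov_product_def K_def \<beta>_def dist_commute)
    ultimately show ?thesis using Ka(2)[of i m] tj Db by linarith
  qed
  have "K m - C \<le> gp q ((g ^^ (i + m)) q) ((g ^^ m) q)"
    using quasi_axis_gp_ge[OF g, of m "i + m"] gp_commute[of q "(g ^^ m) q"] by (simp add: K_def)
  \<comment> \<open>Both points lie in the direction of the axis, at distances from \<open>q\<close>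
    that agree up to \<open>2 * C + 2 * \<delta>\<close>; the chain through two powers of
    \<open>g\<close> bounds their product from below.\<close>
  then have "dist ((g ^^ i) (B j)) (B k) \<le> 8 * C + 12 * \<delta>"
    using hyp2[of q "(g ^^ i) (B j)" "(g ^^ (i + m)) q" "(g ^^ m) q" "B k"]
      dist_gp[of "(g ^^ i) (B j)" "B k" q] shift tk Db \<beta>kb Wk \<beta>_le[of k] C0 delta_ge
    unfolding D_def[symmetric] \<beta>_def[symmetric] by linarith
  moreover have "(g ^^ k) ((finv g ^^ j) x) = (g ^^ i) x" for x
    using gi unfolding k by (simp add: add.commute[of j] funpow_add)
  ultimately show ?thesis
    using isom_dist[OF isom_funpow[OF gi, of k], of "(finv g ^^ j) (B j)" "(finv g ^^ k) (B k)"] gi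
    by (simp add: B_def)
qed

end

lemma geodesic_point:
  fixes x y :: "'a::metric_space"
  assumes "geodesic_space TYPE('a)" "0 \<le> r" "r \<le> dist x y"
  obtains z where "dist x z = r" "dist z y = dist x y - r"
proof -
  from assms(1)[unfolded geodesic_space_def, rule_format, of x y]
  obtain c where c: "c 0 = x" "c (dist x y) = y"
    "\<forall>s\<in>{0..dist x y}. \<forall>t\<in>{0..dist x y}. dist (c s) (c t) = \<bar>s - t\<bar>" by blast
  have "dist (c 0) (c r) = \<bar>0 - r\<bar>" "dist (c r) (c (dist x y)) = \<bar>r - dist x y\<bar>"
    using c(3) assms(2,3) by auto
  then show ?thesis using that[of "c r"] assms(2,3) c(1,2) by simp
qed

section \<open>Word balls in the group of isometries\<close>

primrec word_ball :: "('a \<Rightarrow> 'a) set \<Rightarrow> nat \<Rightarrow> ('a \<Rightarrow> 'a) set" where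
  "word_ball S 0 = {id}"
| "word_ball S (Suc n) = word_ball S n \<union> (\<Union>s\<in>S \<union> finv ` S. (\<circ>) s ` word_ball S n)"

declare word_ball.simps(2) [simp del]

lemma word_ball_Suc_iff:
  "g \<in> word_ball S (Suc n) \<longleftrightarrow>
     g \<in> word_ball S n \<or> (\<exists>s\<in>S \<union> finv ` S. \<exists>h\<in>word_ball S n. g = s \<circ> h)"
  unfolding word_ball.simps Un_iff UN_iff image_iff ..

lemma word_ball_SucI:
  assumes "s \<in> S \<union> finv ` S" "g \<in> word_ball S n"
  shows "s \<circ> g \<in> word_ball S (Suc n)"
  unfolding word_ball_Suc_iff by (intro disjI2 bexI[OF _ assms(1)] bexI[OF _ assms(2)] refl)

lemma word_ball_SucE:
  assumes "g \<in> word_ball S (Suc n)"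
  obtains "g \<in> word_ball S n" | s g' where "s \<in> S \<union> finv ` S" "g' \<in> word_ball S n" "g = s \<circ> g'"
  using assms unfolding word_ball_Suc_iff by meson

lemma word_ball_Suc_mono: "g \<in> word_ball S n \<Longrightarrow> g \<in> word_ball S (Suc n)"
  unfolding word_ball_Suc_iff by (rule disjI1)

lemma word_ball_mono:
  assumes "m \<le> n"
  shows "word_ball S m \<subseteq> word_ball S n"
proof (rule lift_Suc_mono_le[of "word_ball S", OF _ assms])
  show "word_ball S k \<subseteq> word_ball S (Suc k)" for k
    by (rule subsetI) (rule word_ball_Suc_mono)
qed

lemma word_ball_comp: "g \<in> word_ball S m \<Longrightarrow> h \<in> word_ball S n \<Longrightarrow> g \<circ> h \<in> word_ball S (m + n)"
proof (induction m arbitrary: g)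
  case 0
  then show ?case by simp
next
  case (Suc m)
  from Suc.prems(1) show ?case
  proof (cases rule: word_ball_SucE)
    case 1
    show ?thesis unfolding add_Suc by (rule word_ball_Suc_mono[OF Suc.IH[OF 1 Suc.prems(2)]])
  next
    case (2 s g')
    then show ?thesis
      using word_ball_SucI[OF 2(1) Suc.IH[OF 2(2) Suc.prems(2)]] unfolding 2(3) comp_assoc add_Suc by blast
  qed
qed

lemma word_ball_1:
  assumes "s \<in> S"
  shows "s \<in> word_ball S 1" "finv s \<in> word_ball S 1"
proof -
  have "id \<in> word_ball S 0" by simp
  from word_ball_SucI[OF _ this, of s] word_ball_SucI[OF _ this, of "finv s"]
  show "s \<in> word_ball S 1" "finv s \<in> word_ball S 1"
    unfolding One_nat_def comp_id using assms by blast+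
qed

lemma word_ball_funpow: "g \<in> word_ball S m \<Longrightarrow> g ^^ n \<in> word_ball S (n * m)"
proof (induction n)
  case (Suc n)
  then show ?case unfolding funpow.simps mult_Suc by (intro word_ball_comp) auto
qed simp

lemma word_ball_subgroup:
  assumes "subgroup \<Gamma> isom_group" "S \<subseteq> \<Gamma>"
  shows "g \<in> word_ball S n \<Longrightarrow> g \<in> \<Gamma>"
proof (induction n arbitrary: g)
  case 0
  then show ?case using subgroup.one_closed[OF assms(1)] unfolding isom_group_one word_ball.simps by blast
next
  case (Suc n)
  have "finv s \<in> \<Gamma>" if "s \<in> S" for s
  proof -
    have "s \<in> \<Gamma>" "isom s" using that assms subgroup.subset[OF assms(1)] by blast+
    then show ?thesis using subgroup.m_inv_closed[OF assms(1)] isom_group_inv by fastforce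
  qed
  then have "s \<in> \<Gamma>" if "s \<in> S \<union> finv ` S" for s
    using that assms by blast
  from Suc.prems this subgroup.m_closed[OF assms(1), unfolded isom_group_mult] Suc.IH
  show ?case by (cases rule: word_ball_SucE) blast+
qed

lemma subgroup_isom_group: "subgroup (carrier isom_group) isom_group"
  by (intro group.subgroup_self group_isom_group)

lemmas word_ball_isom = word_ball_subgroup[OF subgroup_isom_group]

lemma word_ball_inv: "S \<subseteq> carrier isom_group \<Longrightarrow> g \<in> word_ball S n \<Longrightarrow> finv g \<in> word_ball S n"
proof (induction n arbitrary: g)
  case 0
  then show ?case by (simp add: id_def[symmetric])
next
  case (Suc n)
  from Suc.prems(2) show ?case
  proof (cases rule: word_ball_SucE)
    case 1
    then show ?thesis using Suc word_ball_Suc_mono by blast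
  next
    case (2 s g')
    have "isom g'" using 2 word_ball_isom Suc.prems by blast
    moreover have s: "isom s" using 2 Suc.prems by (auto simp: isom_inv subset_iff)
    ultimately have "finv g = finv g' \<circ> finv s" using 2(3) by (simp add: isom_inv_of_comp)
    moreover have "finv s \<in> word_ball S 1"
      using 2(1)
    proof
      assume "s \<in> finv ` S"
      then obtain t where "t \<in> S" "s = finv t" by blast
      moreover from this have "isom t" using Suc.prems(1) by blast
      ultimately show ?thesis using word_ball_1(1) by (simp only: isom_inv_inv)
    qed (rule word_ball_1)
    ultimately show ?thesis
      using word_ball_comp[OF Suc.IH[OF Suc.prems(1) 2(2)], of "finv s" 1] by (simp only: Suc_eq_plus1)
  qed
qed

lemma generate_word_ball:
  assumes "S \<subseteq> carrier isom_group" "g \<in> generate isom_group S"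
  shows "\<exists>n. g \<in> word_ball S n"
  using assms(2)
proof (induction rule: generate.induct)
  case one
  have "id \<in> word_ball S 0" by simp
  then show ?case unfolding isom_group_one by blast
next
  case (incl h)
  then show ?case using word_ball_1 by blast
next
  case (inv h)
  then have "isom h" using assms(1) by blast
  then have "inv\<^bsub>isom_group\<^esub> h \<in> word_ball S 1"
    unfolding isom_group_inv[OF \<open>isom h\<close>] using inv word_ball_1(2) by blast
  then show ?case by blast
next
  case (eng h1 h2)
  then show ?case unfolding isom_group_mult using word_ball_comp by blast
qed

section \<open>Hyperbolic elements among short words\<close>

context hyperbolic_metric
begin

text \<open>Otherwise moving \<open>q\<close> by
  \<open>4\<delta>\<close> towards \<open>t q\<close> would decrease the joint displacement.\<close>
lemma ex_opposite_elements:
  fixes q :: 'a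
  assumes geo: "geodesic_space TYPE('a)"
    and S: "\<And>s. s \<in> S \<Longrightarrow> isom s" "\<And>s. s \<in> S \<Longrightarrow> finv s \<in> S"
    and t: "t \<in> S" "dist (t q) q = L" and max: "\<And>s. s \<in> S \<Longrightarrow> dist (s q) q \<le> L"
    and min: "\<And>x. \<exists>s\<in>S. L - 1 \<le> dist (s x) x" and L: "100 * \<delta> \<le> L"
  shows "\<exists>s\<in>S. L - 9 * \<delta> \<le> dist (s q) q \<and> gp q (s q) (t q) \<le> 4 * \<delta>"
proof (rule ccontr)
  assume "\<not> ?thesis"
  then have contra: "4 * \<delta> < gp q (s q) (t q)" if "s \<in> S" "L - 9 * \<delta> \<le> dist (s q) q" for s
    using that not_less by blast
  obtain y where y: "dist q y = 4 * \<delta>" "dist y (t q) = L - 4 * \<delta>"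
    using geodesic_point[OF geo, of "4 * \<delta>" q "t q"] t L delta_ge by (auto simp: dist_commute)
  have ty: "gp q (t q) y = 4 * \<delta>"
    using y t by (simp add: gromov_product_def dist_commute)
  obtain s where s: "s \<in> S" "L - 1 \<le> dist (s y) y" using min by blast
  have si: "isom s" using s S by blast
  \<comment> \<open>The product with \<open>t q\<close> exceeds \<open>4 * \<delta>\<close>, so that
    with \<open>y\<close> is at least \<open>3 * \<delta>\<close>; going to \<open>y\<close> costs
    \<open>4 * \<delta>\<close> and saves twice \<open>3 * \<delta>\<close>.\<close>
  have near: "dist y (s' q) \<le> dist (s' q) q - 2 * \<delta>" if "s' \<in> S" "L - 9 * \<delta> \<le> dist (s' q) q" for s'
    using hyp[of q "s' q" "t q" y] contra[OF that] ty dist_gp[of y "s' q" q] y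
      gp_commute[of q "s' q" y] by (simp add: dist_commute)
  show False
  proof (cases "L - 9 * \<delta> \<le> dist (s q) q")
    case True
    have "dist (finv s q) q = dist (s q) q" using si isom_dist_inv_base by blast
    then have 1: "dist (s y) q \<le> dist (s q) q - 2 * \<delta>"
      using near[of "finv s"] True s S isom_dist_inv[OF si, of q y] by (simp add: dist_commute)
    have 2: "dist y (s q) \<le> dist (s q) q - 2 * \<delta>" using near True s by blast
    have 3: "dist (s y) (s q) = 4 * \<delta>" using si y by (simp add: isom_dist dist_commute)
    have "dist y (s y) + dist q (s q) \<le> max (dist y q + dist (s y) (s q)) (dist y (s q) + dist (s y) q) + 2 * \<delta>"
      by (rule four_points)
    then have "dist y (s y) + dist (s q) q \<le> max (8 * \<delta>) (2 * dist (s q) q - 4 * \<delta>) + 2 * \<delta>"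
      using 1 2 3 y by (simp add: dist_commute max_def split: if_splits)
    then show False using True max[OF s(1)] s(2) L delta_ge
      by (simp add: dist_commute max_def split: if_splits)
  next
    \<comment> \<open>Moving \<open>q\<close> by \<open>4 * \<delta>\<close> changes a displacement
      by at most \<open>8 * \<delta>\<close>; the ninth \<delta> beats the defect 1 of the
      near-minimum.\<close>
    case False
    have "dist (s y) y \<le> dist (s y) (s q) + dist (s q) q + dist q y"
      using dist_triangle[of "s y" y "s q"] dist_triangle[of "s q" y q] by simp
    then show False using False s(2) y si delta_ge by (simp add: isom_dist dist_commute)
  qed
qed

text \<open>If both \<open>s\<close> and \<open>t\<close> backtrack, each points in the direction of
  its own inverse. Since \<open>s q\<close> and \<open>t q\<close> diverge, so do
  \<open>finv s q\<close> and \<open>t q\<close>, and likewise \<open>s q\<close> and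
  \<open>finv t q\<close>; hence \<open>s \<circ> t\<close> neither cancels nor backtracks.\<close>

lemma ex_hyperbolic_element:
  fixes q :: 'a
  assumes geo: "geodesic_space TYPE('a)"
    and S: "\<And>s. s \<in> S \<Longrightarrow> isom s" "\<And>s. s \<in> S \<Longrightarrow> finv s \<in> S"
    and t: "t \<in> S" "dist (t q) q = L" and max: "\<And>s. s \<in> S \<Longrightarrow> dist (s q) q \<le> L"
    and min: "\<And>x. \<exists>s\<in>S. L - 1 \<le> dist (s x) x" and L: "100 * \<delta> \<le> L"
  obtains g where "g \<in> word_ball S 2" "isom g" "L - 9 * \<delta> \<le> dist (g q) q"
    "gp q (g q) (finv g q) \<le> 7 * \<delta>" "dist (g q) q \<le> 2 * L"
proof -
  obtain s where s: "s \<in> S" "L - 9 * \<delta> \<le> dist (s q) q" "gp q (s q) (t q) \<le> 4 * \<delta>"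
    using ex_opposite_elements[of S t q L] assms by blast
  have si: "isom s" "isom t" using s t S by auto
  have L0: "0 \<le> L" using L delta_ge by linarith
  have w: "r \<in> word_ball S 2" if "r \<in> S" for r
    using word_ball_1(1)[OF that] word_ball_mono[of 1 2] by auto
  consider "gp q (s q) (finv s q) \<le> 7 * \<delta>" | "gp q (t q) (finv t q) \<le> 7 * \<delta>"
    | "7 * \<delta> < gp q (s q) (finv s q)" "7 * \<delta> < gp q (t q) (finv t q)" by linarith
  then show ?thesis
  proof cases
    case 1
    have "dist (s q) q \<le> 2 * L" using max[OF s(1)] L0 by linarith
    then show ?thesis using that[OF w[OF s(1)] si(1) s(2) 1] by blast
  next
    case 2
    have "dist (t q) q \<le> 2 * L" "L - 9 * \<delta> \<le> dist (t q) q" using t(2) L0 delta_ge by linarith+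
    then show ?thesis using that[OF w[OF t(1)] si(2) _ 2] by blast
  next
    case 3
    define g where "g = s \<circ> t"
    have gi: "isom g" using si by (simp add: g_def isom_comp)
    have st: "gp q (finv s q) (t q) \<le> 5 * \<delta>"
      using hyp[of q "s q" "finv s q" "t q"] 3 s(3) delta_ge by linarith
    have st': "gp q (s q) (finv t q) \<le> 5 * \<delta>"
      using hyp[of q "s q" "finv t q" "t q"] 3 s(3) delta_ge
        gp_commute[of q "t q" "finv t q"] by linarith
    have kg: "dist (g q) q = dist (s q) q + L - 2 * gp q (finv s q) (t q)"
      using dist_comp_gp[OF si(1), of t q] t by (simp add: g_def)
    have gs: "dist (s q) q - 5 * \<delta> \<le> gp q (g q) (s q)"
    proof -
      have "gp (s q) q (g q) = gp q (finv s q) (t q)"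
        using isom_gp[OF si(1), of q "finv s q" "t q"] si by (simp add: g_def)
      then show ?thesis using st gp_swap[of q "s q" "g q"] gp_commute[of q "s q" "g q"] by linarith
    qed
    have gt: "L - 5 * \<delta> \<le> gp q (finv t q) (finv g q)"
    proof -
      have "finv g q = finv t (finv s q)" using si by (simp add: g_def isom_inv_of_comp)
      then have "gp (finv t q) q (finv g q) = gp q (t q) (finv s q)"
        using isom_gp[OF isom_inv[OF si(2)], of q "t q" "finv s q"] si by simp
      then show ?thesis
        using st gp_swap[of q "finv t q" "finv g q"] gp_commute[of q "t q" "finv s q"]
          isom_dist_inv_base[OF si(2), of q] t(2) by linarith
    qed
    have small: "gp q (g q) (finv g q) \<le> 7 * \<delta>"
    proof -
      have "7 * \<delta> < gp q (s q) (g q)"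
        using gs s(2) L delta_ge gp_commute[of q "s q" "g q"] by linarith
      moreover have "7 * \<delta> < gp q (finv g q) (finv t q)"
        using gt L delta_ge gp_commute[of q "finv t q" "finv g q"] by linarith
      moreover have "min (gp q (s q) (g q)) (min (gp q (g q) (finv g q)) (gp q (finv g q) (finv t q))) \<le> 7 * \<delta>"
        using hyp2[of q "s q" "g q" "finv g q" "finv t q"] st' by simp
      ultimately show ?thesis by (simp add: min_le_iff_disj)
    qed
    have "g \<in> word_ball S (1 + 1)"
      unfolding g_def by (rule word_ball_comp[OF word_ball_1(1)[OF s(1)] word_ball_1(1)[OF t(1)]])
    moreover have "dist (g q) q \<le> 2 * L"
      using kg max[OF s(1)] gp_nonneg[of q "finv s q" "t q"] by linarith
    moreover have "L - 9 * \<delta> \<le> dist (g q) q" using kg st s(2) L delta_ge by linarith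
    ultimately show ?thesis using that[of g] gi small unfolding one_add_one by blast
  qed
qed

text \<open>A ping-pong condition: with margin \<delta>, no point has product at least half the
  displacement with both \<open>g q\<close> and \<open>h q\<close>, and the same holds for the
  inverses. Larger margins \<open>R\<close> survive a change of base point.\<close>

definition separated :: "real \<Rightarrow> 'a \<Rightarrow> ('a \<Rightarrow> 'a) \<Rightarrow> ('a \<Rightarrow> 'a) \<Rightarrow> bool" where
  "separated R q g h \<longleftrightarrow>
     gp q (g q) (h q) + R < min (dist (g q) q) (dist (h q) q) / 2 \<and>
     gp q (finv g q) (finv h q) + R < min (dist (g q) q) (dist (h q) q) / 2"

definition separated_triple ::
  "real \<Rightarrow> 'a \<Rightarrow> ('a \<Rightarrow> 'a) \<Rightarrow> ('a \<Rightarrow> 'a) \<Rightarrow> ('a \<Rightarrow> 'a) \<Rightarrow> bool" where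
  "separated_triple R q g\<^sub>1 g\<^sub>2 g\<^sub>3 \<longleftrightarrow> separated R q g\<^sub>1 g\<^sub>2 \<and> separated R q g\<^sub>1 g\<^sub>3 \<and> separated R q g\<^sub>2 g\<^sub>3"

end

lemma word_ball_symmetric:
  assumes "S \<subseteq> carrier isom_group"
  shows "word_ball (S \<union> finv ` S) n = word_ball S n"
proof (induction n)
  case (Suc n)
  have "finv ` (S \<union> finv ` S) \<subseteq> S \<union> finv ` S"
    using assms by (auto simp: isom_inv_inv subset_iff)
  then have "(S \<union> finv ` S) \<union> finv ` (S \<union> finv ` S) = S \<union> finv ` S" by blast
  then show ?case unfolding word_ball.simps Suc by simp
qed simp

lemma ex_near_minimum:
  fixes F :: "'b \<Rightarrow> real"
  assumes "\<And>x. 0 \<le> F x"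
  shows "\<exists>q. \<forall>x. F q \<le> F x + 1"
proof -
  have "\<exists>y\<in>range F. y < Inf (range F) + 1"
    by (rule cInf_lessD) auto
  then obtain q where "F q < Inf (range F) + 1" by blast
  moreover have "Inf (range F) \<le> F x" for x
    using assms by (intro cInf_lower bdd_belowI[of _ 0]) auto
  ultimately show ?thesis by (intro exI[of _ q]) (smt (verit))
qed

section \<open>Proper cocompact actions\<close>

locale cocompact_action = hyperbolic_metric \<delta> p for \<delta> :: real and p :: "'a::metric_space" +
  fixes \<Gamma> :: "('a \<Rightarrow> 'a) set" and D :: real
  assumes subgroup: "subgroup \<Gamma> isom_group"
    and geodesic: "geodesic_space TYPE('a)"
    and finite_displacement: "\<And>r. finite {g \<in> \<Gamma>. dist (g p) p \<le> r}"
    and cobounded: "\<And>x. \<exists>g\<in>\<Gamma>. dist x (g p) \<le> D"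
begin

lemma \<Gamma>_isom: "g \<in> \<Gamma> \<Longrightarrow> isom g"
  using subgroup.subset[OF subgroup] by blast

lemma \<Gamma>_id: "id \<in> \<Gamma>"
  using subgroup.one_closed[OF subgroup] unfolding isom_group_one .

lemma \<Gamma>_comp: "g \<in> \<Gamma> \<Longrightarrow> h \<in> \<Gamma> \<Longrightarrow> g \<circ> h \<in> \<Gamma>"
  using subgroup.m_closed[OF subgroup] unfolding isom_group_mult .

lemma \<Gamma>_inv: "g \<in> \<Gamma> \<Longrightarrow> finv g \<in> \<Gamma>"
  using subgroup.m_inv_closed[OF subgroup] \<Gamma>_isom isom_group_inv by fastforce

lemma \<Gamma>_funpow: "g \<in> \<Gamma> \<Longrightarrow> g ^^ n \<in> \<Gamma>"
  by (induction n) (simp_all only: funpow.simps \<Gamma>_id \<Gamma>_comp)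

definition vol :: "real \<Rightarrow> nat" where
  "vol r = card {g \<in> \<Gamma>. dist (g p) p \<le> r}"

text \<open>Conjugating by an element that carries \<open>p\<close> within D of \<open>x\<close>
  costs \<open>2 * D\<close>, so cocompactness makes the count independent of the point.\<close>

lemma card_displaced:
  "finite {g \<in> \<Gamma>. dist (g x) x \<le> r}" "card {g \<in> \<Gamma>. dist (g x) x \<le> r} \<le> vol (r + 2 * D)"
proof -
  obtain h where h: "h \<in> \<Gamma>" "dist x (h p) \<le> D" using cobounded by blast
  have hi: "isom h" using h \<Gamma>_isom by blast
  define \<phi> where "\<phi> g = finv h \<circ> g \<circ> h" for g
  have inj: "inj_on \<phi> A" for A
  proof (rule inj_onI)
    fix a b assume "\<phi> a = \<phi> b"
    then have "finv h (a (h (finv h y))) = finv h (b (h (finv h y)))" for y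
      unfolding \<phi>_def by (metis comp_apply)
    then show "a = b" using hi by (metis ext isom_inv_apply(2))
  qed
  have sub: "\<phi> ` {g \<in> \<Gamma>. dist (g x) x \<le> r} \<subseteq> {g \<in> \<Gamma>. dist (g p) p \<le> r + 2 * D}"
  proof clarify
    fix g assume g: "g \<in> \<Gamma>" "dist (g x) x \<le> r"
    have "dist (\<phi> g p) p = dist (g (h p)) (h p)" using hi by (simp add: \<phi>_def isom_dist_inv)
    also have "\<dots> \<le> dist (g (h p)) (g x) + dist (g x) x + dist x (h p)"
      using dist_triangle[of "g (h p)" "h p" "g x"] dist_triangle[of "g x" "h p" x] by linarith
    also have "dist (g (h p)) (g x) = dist x (h p)"
      using \<Gamma>_isom[OF g(1)] by (simp add: isom_dist dist_commute)
    finally have "dist (\<phi> g p) p \<le> r + 2 * D" using g h by linarith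
    moreover have "\<phi> g \<in> \<Gamma>" unfolding \<phi>_def using g h by (intro \<Gamma>_comp \<Gamma>_inv)
    ultimately show "\<phi> g \<in> \<Gamma> \<and> dist (\<phi> g p) p \<le> r + 2 * D" by blast
  qed
  show "finite {g \<in> \<Gamma>. dist (g x) x \<le> r}"
    by (rule finite_imageD[OF finite_subset[OF sub finite_displacement] inj])
  show "card {g \<in> \<Gamma>. dist (g x) x \<le> r} \<le> vol (r + 2 * D)"
    unfolding vol_def by (rule card_inj_on_le[OF inj sub finite_displacement])
qed

text \<open>By fellow travelling, the maps \<open>w j = g^-j s f^j\<close> send \<open>q\<close> to
  within \<open>84 * \<delta>\<close> of one point (\<open>8 * 9 + 12\<close>), while there are more
  indices j than group elements that displace \<open>q\<close> so little. Hence two of them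
  coincide, and \<open>w a = w b\<close> says that \<open>s\<close> intertwines the powers of
  \<open>g\<close> and \<open>f\<close> with exponent \<open>b - a\<close>.\<close>

lemma ex_power_intertwines:
  fixes q :: 'a
  defines "B \<equiv> vol (84 * \<delta> + 2 * D)"
  assumes g: "g \<in> \<Gamma>" "quasi_axis (9 * \<delta>) q g" and f: "f = g \<or> f = finv g" and s: "s \<in> \<Gamma>"
    and sL: "dist (s q) q \<le> L" and growth: "\<And>n. real n * (L / 2) \<le> dist ((g ^^ n) q) q"
    and L: "100 * \<delta> \<le> L" and m: "4 + B \<le> m"
    and W: "dist ((g ^^ (4 + B)) q) q + 18 * \<delta> + L \<le> gp q ((g ^^ m) q) (s ((f ^^ m) q))"
  shows "\<exists>i. 1 \<le> i \<and> i \<le> B \<and> g ^^ i \<circ> s = s \<circ> f ^^ i"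
proof -
  have gi: "isom g" "isom s" using g s \<Gamma>_isom by auto
  have f\<Gamma>: "f \<in> \<Gamma>" using f g \<Gamma>_inv by blast
  then have fi: "isom f" using \<Gamma>_isom by blast
  have fa: "quasi_axis (9 * \<delta>) q f" using f g quasi_axis_inv by blast
  have same: "dist ((f ^^ n) q) q = dist ((g ^^ n) q) q" for n
    using f dist_inv_funpow[OF gi(1)] by blast
  \<comment> \<open>From the fourth power on, growth gives at least \<open>2 * L\<close>, which
    exceeds \<open>21 * \<delta> + L\<close>; this is why the indices start at 4.\<close>
  have far: "2 * (9 * \<delta>) + 3 * \<delta> + L < dist ((g ^^ j) q) q" if "4 \<le> j" for j
  proof -
    have "4 * (L / 2) \<le> real j * (L / 2)" using that L delta_ge by (intro mult_right_mono) auto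
    then show ?thesis using growth[of j] L delta_ge by linarith
  qed
  define w where "w j = finv g ^^ j \<circ> s \<circ> f ^^ j" for j
  have w\<Gamma>: "w j \<in> \<Gamma>" for j
    unfolding w_def using g s f\<Gamma> by (intro \<Gamma>_comp \<Gamma>_funpow \<Gamma>_inv)
  let ?k = "4 + B"
  have near: "dist (w j q) (w ?k q) \<le> 84 * \<delta>" if "j \<in> {4..?k}" for j
    using fellow_travel[OF g(2) fa gi(2) same sL, of ?k m j] W far[of j] far[of ?k] that m
    by (simp add: w_def)
  define x where "x j = finv (w ?k) \<circ> w j" for j
  have "x ` {4..?k} \<subseteq> {h \<in> \<Gamma>. dist (h q) q \<le> 84 * \<delta>}"
  proof (rule image_subsetI)
    fix j assume j: "j \<in> {4..?k}"
    have "dist (x j q) q = dist (w j q) (w ?k q)"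
      unfolding x_def using isom_dist_inv[OF \<Gamma>_isom[OF w\<Gamma>]] by simp
    moreover have "x j \<in> \<Gamma>" unfolding x_def using w\<Gamma> by (intro \<Gamma>_comp \<Gamma>_inv)
    ultimately show "x j \<in> {h \<in> \<Gamma>. dist (h q) q \<le> 84 * \<delta>}" using near[OF j] by simp
  qed
  then have "card (x ` {4..?k}) \<le> card {h \<in> \<Gamma>. dist (h q) q \<le> 84 * \<delta>}"
    by (intro card_mono card_displaced)
  also have "\<dots> \<le> B" unfolding B_def by (rule card_displaced)
  also have "B < card {4..?k}" by simp
  finally have "\<not> inj_on x {4..?k}" using pigeonhole by blast
  then obtain a b where ab: "a \<in> {4..?k}" "b \<in> {4..?k}" "x a = x b" "a < b"
    unfolding inj_on_def by (metis linorder_neqE_nat)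
  have "w ?k (x j y) = w j y" for j y
    unfolding x_def using isom_inv_apply(2)[OF \<Gamma>_isom[OF w\<Gamma>]] by simp
  then have wab: "w a y = w b y" for y using ab(3) by metis
  have "(g ^^ (b - a)) (s y) = s ((f ^^ (b - a)) y)" for y
  proof -
    obtain i where i: "b = a + i" using ab(4) less_imp_add_positive by blast
    have fy: "(f ^^ a) ((finv f ^^ a) y) = y" using fi by simp
    have "(finv g ^^ a) (s y) = (finv g ^^ a) ((finv g ^^ i) (s ((f ^^ i) y)))"
      using wab[of "(finv f ^^ a) y"] fy
      by (simp add: w_def i funpow_add[of a i "finv g"] add.commute[of a i] funpow_add[of i a f])
         (simp add: funpow_add[symmetric, THEN fun_cong, unfolded o_apply] add.commute)
    then have "s y = (finv g ^^ i) (s ((f ^^ i) y))"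
      using gi(1) by (metis isom_funpow_cancel(2))
    then show ?thesis using gi(1) i by (metis add_diff_cancel_left' isom_funpow_cancel(2))
  qed
  then have "g ^^ (b - a) \<circ> s = s \<circ> f ^^ (b - a)" by (simp add: fun_eq_iff)
  moreover have "1 \<le> b - a" "b - a \<le> B" using ab by auto
  ultimately show ?thesis by blast
qed

end

lemma funpow_intertwine: "g \<circ> s = s \<circ> f \<Longrightarrow> g ^^ n \<circ> s = s \<circ> f ^^ n"
proof (induction n)
  case (Suc n)
  have "g ^^ Suc n \<circ> s = g \<circ> (g ^^ n \<circ> s)" by (simp add: comp_assoc)
  also have "\<dots> = g \<circ> (s \<circ> f ^^ n)" by (simp only: Suc)
  also have "\<dots> = s \<circ> f ^^ Suc n"
    by (simp only: Suc.prems comp_assoc[symmetric] funpow.simps)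
  finally show ?case .
qed simp

section \<open>Normalised quasi-axes and triples for large displacement\<close>

context hyperbolic_metric
begin

text \<open>Apply the four-point inequality to \<open>q\<close>, \<open>x\<close> and their images
  under \<open>u ^^ n\<close>: equal displacement forces the products of \<open>x\<close> with the
  two ends to add up to at least \<open>dist x q - \<delta>\<close>, and one of them is at most
  \<open>C + \<delta>\<close>.\<close>

lemma near_quasi_axis:
  fixes x q :: 'a
  assumes u: "quasi_axis C q u" and x: "dist ((u ^^ n) x) x = dist ((u ^^ n) q) q"
    and far: "dist x q \<le> dist ((u ^^ n) q) q"
  shows "dist x q - C - 2 * \<delta> \<le> gp q x ((u ^^ n) q) \<or> dist x q - C - 2 * \<delta> \<le> gp q x ((finv u ^^ n) q)"
proof -
  have aux: "dist x q - C - 2 * \<delta> \<le> gp q x ((finv v ^^ n) q)"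
    if v: "isom v" and vx: "dist ((v ^^ n) x) x = dist ((v ^^ n) q) q"
      and vq: "dist x q \<le> dist ((v ^^ n) q) q" and small: "gp q x ((v ^^ n) q) \<le> C + \<delta>" for v
  proof -
    have vn: "isom (v ^^ n)" using v by (rule isom_funpow)
    have "dist x ((v ^^ n) q) + dist q ((v ^^ n) x)
       \<le> max (dist x q + dist ((v ^^ n) q) ((v ^^ n) x)) (dist x ((v ^^ n) x) + dist ((v ^^ n) q) q) + 2 * \<delta>"
      by (rule four_points)
    also have "dist ((v ^^ n) q) ((v ^^ n) x) = dist x q" using vn by (simp add: isom_dist dist_commute)
    finally have "dist x ((v ^^ n) q) + dist q ((v ^^ n) x) \<le> 2 * dist ((v ^^ n) q) q + 2 * \<delta>"
      using vx vq by (simp add: dist_commute)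
    moreover have "dist q ((v ^^ n) x) = dist x ((finv v ^^ n) q)"
      using isom_dist_inv[OF vn, of q x] by (simp add: isom_inv_funpow[OF v] dist_commute)
    ultimately show ?thesis
      using small dist_gp[of x "(v ^^ n) q" q] dist_gp[of x "(finv v ^^ n) q" q] dist_inv_funpow[OF v, of n q]
      by linarith
  qed
  have ui: "isom u" using u by (rule quasi_axis_isom)
  have "gp q ((u ^^ n) q) ((finv u ^^ n) q) \<le> C" using u by (simp add: quasi_axis_def)
  then consider "gp q x ((u ^^ n) q) \<le> C + \<delta>" | "gp q x ((finv u ^^ n) q) \<le> C + \<delta>"
    using hyp[of q "(u ^^ n) q" x "(finv u ^^ n) q"] gp_commute[of q x "(u ^^ n) q"] by linarith
  then show ?thesis
  proof cases
    case 1
    then show ?thesis using aux[OF ui x far] by blast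
  next
    case 2
    have ux: "dist ((finv u ^^ n) x) x = dist ((finv u ^^ n) q) q"
      unfolding dist_inv_funpow[OF ui] by (rule x)
    have uq: "dist x q \<le> dist ((finv u ^^ n) q) q"
      unfolding dist_inv_funpow[OF ui] by (rule far)
    show ?thesis using aux[OF isom_inv[OF ui] ux uq 2] isom_inv_inv[OF ui] by simp
  qed
qed

lemma separated_gp_le:
  fixes q q' :: 'a
  assumes "separated R q' g h" "dist q q' \<le> E" "2 * R > 10 * E + 2 * C + 6 * \<delta>" "0 \<le> C"
    "isom g" "isom h"
  shows "gp q (g q) (h q) < min (dist (g q) q) (dist (h q) q) - C - 3 * \<delta>"
proof -
  have gq: "dist (g q) (g q') = dist q q'" "dist (h q) (h q') = dist q q'"
    using assms by (simp_all add: isom_dist)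
  have "gp q (g q) (h q) \<le> gp q' (g q') (h q') + 3 * E"
    using gp_base_lipschitz[of q "g q" "h q" q'] gp_lipschitz[of q' "g q" "h q" "g q'"]
      gp_lipschitz'[of q' "g q'" "h q" "h q'"] gq assms(2) by linarith
  moreover have "dist (g q') q' \<le> dist (g q) q + 2 * E" "dist (h q') q' \<le> dist (h q) q + 2 * E"
    using dist_triangle[of "g q'" q' "g q"] dist_triangle[of "g q" q' q]
      dist_triangle[of "h q'" q' "h q"] dist_triangle[of "h q" q' q] gq assms(2)
    by (simp_all add: dist_commute)
  moreover have "0 \<le> gp q' (g q') (h q')" by (rule gp_nonneg)
  moreover have "0 \<le> E" using assms(2) zero_le_dist[of q q'] by linarith
  ultimately show ?thesis
    using assms(1,3,4) delta_ge unfolding separated_def by linarith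
qed

end

context cocompact_action
begin

text \<open>If \<open>g\<close> conjugates \<open>u\<close> to itself or its inverse, then
  \<open>u ^^ n\<close> displaces \<open>g q\<close> as much as \<open>q\<close>, so
  \<open>g q\<close> lies towards one of the two ends of the axis. Two of any three elements choose
  the same end, against separation.\<close>

lemma no_normal_quasi_axis:
  fixes q :: 'a
  assumes u: "quasi_axis C q u"
    and normal: "\<And>g. g \<in> \<Gamma> \<Longrightarrow> g \<circ> u = u \<circ> g \<or> g \<circ> u = finv u \<circ> g"
    and unbounded: "\<And>T. \<exists>n. T \<le> dist ((u ^^ n) q) q"
    and triples: "\<And>R. \<exists>a\<in>\<Gamma>. \<exists>b\<in>\<Gamma>. \<exists>c\<in>\<Gamma>. separated_triple R p a b c"
  shows False
proof -
  have ui: "isom u" using u by (rule quasi_axis_isom)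
  have C0: "0 \<le> C" using u gp_nonneg order_trans unfolding quasi_axis_def by blast
  obtain a b c where abc: "a \<in> \<Gamma>" "b \<in> \<Gamma>" "c \<in> \<Gamma>"
    and sep: "separated_triple (5 * dist q p + C + 3 * \<delta> + 1) p a b c" using triples by blast
  obtain n where n: "dist (a q) q + dist (b q) q + dist (c q) q \<le> dist ((u ^^ n) q) q"
    using unbounded by blast
  have "dist (a q) q \<le> dist ((u ^^ n) q) q" "dist (b q) q \<le> dist ((u ^^ n) q) q"
    "dist (c q) q \<le> dist ((u ^^ n) q) q"
    using n zero_le_dist[of "a q" q] zero_le_dist[of "b q" q] zero_le_dist[of "c q" q] by linarith+
  then have dom: "dist (g q) q \<le> dist ((u ^^ n) q) q" if "g \<in> {a, b, c}" for g using that by blast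
  have side: "dist (g q) q - C - 2 * \<delta> \<le> gp q (g q) ((u ^^ n) q)
      \<or> dist (g q) q - C - 2 * \<delta> \<le> gp q (g q) ((finv u ^^ n) q)"
    if "g \<in> {a, b, c}" for g
  proof -
    have g: "g \<in> \<Gamma>" using that abc by blast
    then have gi: "isom g" by (rule \<Gamma>_isom)
    have "finv u ^^ n \<circ> g = g \<circ> u ^^ n \<or> u ^^ n \<circ> g = g \<circ> u ^^ n"
      using normal[OF g] funpow_intertwine by metis
    then have "dist ((u ^^ n) (g q)) (g q) = dist ((u ^^ n) q) q"
    proof
      assume *: "finv u ^^ n \<circ> g = g \<circ> u ^^ n"
      have "dist ((u ^^ n) (g q)) (g q) = dist ((finv u ^^ n) (g q)) (g q)"
        by (rule dist_inv_funpow[OF ui, symmetric])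
      also have "(finv u ^^ n) (g q) = g ((u ^^ n) q)" using * by (metis comp_apply)
      finally show ?thesis using gi by (simp add: isom_dist)
    next
      assume "u ^^ n \<circ> g = g \<circ> u ^^ n"
      then have "(u ^^ n) (g q) = g ((u ^^ n) q)" by (metis comp_apply)
      then show ?thesis using gi by (simp add: isom_dist)
    qed
    then show ?thesis by (rule near_quasi_axis[OF u _ dom[OF that]])
  qed
  have apart: False if gh: "g \<in> \<Gamma>" "h \<in> \<Gamma>" "separated (5 * dist q p + C + 3 * \<delta> + 1) p g h"
    and gz: "dist (g q) q - C - 2 * \<delta> \<le> gp q (g q) z" and hz: "dist (h q) q - C - 2 * \<delta> \<le> gp q (h q) z"
    for g h z
  proof -
    have "gp q (g q) (h q) < min (dist (g q) q) (dist (h q) q) - C - 3 * \<delta>"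
      using separated_gp_le[OF gh(3) order_refl, where C = C] C0 gh \<Gamma>_isom by simp
    then show False using gz hz hyp[of q "g q" z "h q"] gp_commute[of q "h q" z] by linarith
  qed
  have "separated (5 * dist q p + C + 3 * \<delta> + 1) p a b" "separated (5 * dist q p + C + 3 * \<delta> + 1) p a c"
    "separated (5 * dist q p + C + 3 * \<delta> + 1) p b c"
    using sep by (simp_all add: separated_triple_def)
  note apart[OF abc(1,2) this(1)] apart[OF abc(1,3) this(2)] apart[OF abc(2,3) this(3)]
  then show False using side[of a] side[of b] side[of c] by blast
qed

lemma normal_word_ball:
  assumes u: "isom u" and S: "\<And>s. s \<in> S \<union> finv ` S \<Longrightarrow> s \<circ> u = u \<circ> s \<or> s \<circ> u = finv u \<circ> s"
  shows "g \<in> word_ball S n \<Longrightarrow> g \<circ> u = u \<circ> g \<or> g \<circ> u = finv u \<circ> g"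
proof (induction n arbitrary: g)
  case (Suc n)
  from Suc.prems show ?case
  proof (cases rule: word_ball_SucE)
    case (2 s h)
    have inv: "s \<circ> finv u = v' \<circ> s" if "s \<circ> u = v \<circ> s" "v \<circ> v' = id" "v' \<circ> v = id" for v v'
    proof -
      have "s \<circ> finv u = v' \<circ> (v \<circ> s) \<circ> finv u" by (simp only: comp_assoc[symmetric] that id_comp)
      also have "\<dots> = v' \<circ> s \<circ> (u \<circ> finv u)" by (simp only: comp_assoc that(1)[symmetric])
      finally show ?thesis by (simp only: isom_inv_comp[OF u] comp_id)
    qed
    have s: "s \<circ> u = u \<circ> s \<and> s \<circ> finv u = finv u \<circ> s \<or> s \<circ> u = finv u \<circ> s \<and> s \<circ> finv u = u \<circ> s"
      using S[OF 2(1)] inv[of u "finv u"] inv[of "finv u" u] isom_inv_comp[OF u] by blast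
    from Suc.IH[OF 2(2)] obtain v where v: "v = u \<or> v = finv u" "h \<circ> u = v \<circ> h" by blast
    from s v(1) obtain w where w: "w = u \<or> w = finv u" "s \<circ> v = w \<circ> s" by blast
    have "g \<circ> u = (s \<circ> v) \<circ> h" unfolding 2(3) by (simp only: comp_assoc v(2))
    also have "\<dots> = w \<circ> g" unfolding w(2) 2(3) by (simp only: comp_assoc)
    finally show ?thesis using w(1) by blast
  qed (rule Suc.IH)
qed simp

text \<open>The bound \<open>short\<close> says that \<open>s\<close> moves the axis off itself
  within distance W, whichever ends are compared, so conjugation by \<open>s\<close> yields two
  directions away from both ends. \<open>far\<close> is the inequality required by
  \<open>separated\<close>, with \<open>2 * L\<close> of the displacement lost to
  conjugation.\<close>

lemma separated_triple_of_axis: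
  fixes q :: 'a
  assumes g: "quasi_axis (9 * \<delta>) q g" and s: "isom s" and sL: "dist (s q) q \<le> L" and L: "100 * \<delta> \<le> L"
    and far: "2 * (W + L) + 2 * \<delta> + 2 * L < dist ((g ^^ m) q) q" and W: "9 * \<delta> \<le> W"
    and short: "\<And>a b. a \<in> {g, finv g} \<Longrightarrow> b \<in> {g, finv g} \<Longrightarrow> gp q ((a ^^ m) q) (s ((b ^^ m) q)) < W"
  shows "separated_triple \<delta> q (g ^^ m) (finv g ^^ m) (s \<circ> g ^^ m \<circ> finv s)"
proof -
  define K where "K = dist ((g ^^ m) q) q"
  have gi: "isom g" using g by (rule quasi_axis_isom)
  have inv_pow: "finv (g ^^ m) = finv g ^^ m" "finv (finv g ^^ m) = g ^^ m"
    using gi isom_inv_funpow[of g m] isom_inv_funpow[of "finv g" m] by (auto simp: isom_inv_inv)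
  have gm: "isom (g ^^ m)" "isom (finv g ^^ m)" using gi by auto
  have inv_conj: "finv (s \<circ> g ^^ m \<circ> finv s) = s \<circ> finv g ^^ m \<circ> finv s"
    using gm s by (simp only: isom_inv_of_comp isom_comp isom_inv isom_inv_inv inv_pow comp_assoc)
  have Kinv: "dist ((finv g ^^ m) q) q = K" using dist_inv_funpow[OF gi] by (simp add: K_def)
  have sinv: "dist (finv s q) q \<le> L" using sL isom_dist_inv_base[OF s] by simp
  have conj: "K - 2 * L \<le> dist (s ((b ^^ m) (finv s q))) q"
      "gp q ((a ^^ m) q) (s ((b ^^ m) (finv s q))) \<le> W + L"
    if ab: "a \<in> {g, finv g}" "b \<in> {g, finv g}" for a b
  proof -
    have bi: "isom (b ^^ m)" using ab gm by blast
    have bK: "dist ((b ^^ m) q) q = K" using ab Kinv by (auto simp: K_def)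
    have 1: "dist (s ((b ^^ m) (finv s q))) (s ((b ^^ m) q)) \<le> L"
      using sinv s bi by (simp add: isom_dist)
    have 2: "dist (s ((b ^^ m) q)) (s q) = K" using s bK by (simp add: isom_dist)
    show "K - 2 * L \<le> dist (s ((b ^^ m) (finv s q))) q"
      using dist_triangle[of "s ((b ^^ m) q)" "s q" q]
        dist_triangle[of "s ((b ^^ m) q)" q "s ((b ^^ m) (finv s q))"] 1 2 sL
      by (simp add: dist_commute)
    show "gp q ((a ^^ m) q) (s ((b ^^ m) (finv s q))) \<le> W + L"
      using gp_lipschitz'[of q "(a ^^ m) q" "s ((b ^^ m) (finv s q))" "s ((b ^^ m) q)"] 1 short[OF ab]
      by linarith
  qed
  have gg: "gp q ((g ^^ m) q) ((finv g ^^ m) q) \<le> 9 * \<delta>"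
    using g by (simp add: quasi_axis_def)
  have far': "2 * (W + L) + 2 * \<delta> < K - 2 * L" using far by (simp add: K_def)
  have L0: "0 \<le> L" using L delta_ge by linarith
  have "separated \<delta> q (g ^^ m) (finv g ^^ m)"
    unfolding separated_def inv_pow Kinv K_def[symmetric]
    using gg gp_commute[of q "(g ^^ m) q" "(finv g ^^ m) q"] far' W L0 delta_ge by simp
  moreover have "separated \<delta> q (g ^^ m) (s \<circ> g ^^ m \<circ> finv s)"
    unfolding separated_def inv_pow inv_conj comp_apply K_def[symmetric]
    using conj(1)[of g g] conj(2)[of g g] conj(2)[of "finv g" "finv g"] far' L0 by auto
  moreover have "separated \<delta> q (finv g ^^ m) (s \<circ> g ^^ m \<circ> finv s)"
    unfolding separated_def inv_pow inv_conj comp_apply Kinv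
    using conj(1)[of g g] conj(2)[of "finv g" g] conj(2)[of g "finv g"] far' L0 by auto
  ultimately show ?thesis by (simp add: separated_triple_def)
qed

text \<open>The word length is uniform because B depends only on \<Gamma>, \<delta> and D. It covers
  \<open>s g^m s^-1\<close> with \<open>g\<close> of length 2 and
  \<open>m = 56 + 8 * B\<close>.\<close>

lemma ex_triple_of_large_displacement:
  defines "B \<equiv> vol (84 * \<delta> + 2 * D)"
  assumes S: "finite S" "S \<noteq> {}" "S \<subseteq> \<Gamma>"
    and gen: "\<And>g. g \<in> \<Gamma> \<Longrightarrow> \<exists>n. g \<in> word_ball S n"
    and triples: "\<And>R. \<exists>a\<in>\<Gamma>. \<exists>b\<in>\<Gamma>. \<exists>c\<in>\<Gamma>. separated_triple R p a b c"
    and large: "\<And>x. \<exists>s\<in>S. 100 * \<delta> < dist (s x) x"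
  shows "\<exists>q. \<exists>a\<in>word_ball S (4 * (30 + 4 * B)). \<exists>b\<in>word_ball S (4 * (30 + 4 * B)).
    \<exists>c\<in>word_ball S (4 * (30 + 4 * B)). separated_triple \<delta> q a b c"
proof -
  define S' where "S' = S \<union> finv ` S"
  have S'\<Gamma>: "S' \<subseteq> \<Gamma>" using S \<Gamma>_inv by (auto simp: S'_def)
  have S'i: "isom s" if "s \<in> S'" for s using that S'\<Gamma> \<Gamma>_isom by blast
  have S'inv: "finv s \<in> S'" if "s \<in> S'" for s
    using that S(3) \<Gamma>_isom by (auto simp: S'_def isom_inv_inv subset_iff)
  have wb: "word_ball S' n = word_ball S n" for n
    unfolding S'_def using S(3) \<Gamma>_isom by (intro word_ball_symmetric) blast
  have fin: "finite S'" "S' \<noteq> {}" using S by (auto simp: S'_def)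
  define F where "F x = Max ((\<lambda>s. dist (s x) x) ` S')" for x :: 'a
  have F_ge: "dist (s x) x \<le> F x" if "s \<in> S'" for s x
    unfolding F_def using fin that by (intro Max_ge) auto
  have F_att: "\<exists>s\<in>S'. dist (s x) x = F x" for x
    using Max_in[of "(\<lambda>s. dist (s x) x) ` S'"] fin unfolding F_def by (auto simp: image_iff)
  have "0 \<le> F x" for x using F_att[of x] zero_le_dist by metis
  \<comment> \<open>A near-minimum suffices, so the infimum of the joint displacement need not be
    attained.\<close>
  then obtain q where q: "\<And>x. F q \<le> F x + 1" using ex_near_minimum by blast
  define L where "L = F q"
  obtain t where t: "t \<in> S'" "dist (t q) q = L" using F_att unfolding L_def by blast
  have sL: "dist (s q) q \<le> L" if "s \<in> S'" for s using F_ge[OF that] by (simp add: L_def)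
  have min: "\<exists>s\<in>S'. L - 1 \<le> dist (s x) x" for x
  proof -
    obtain s where "s \<in> S'" "dist (s x) x = F x" using F_att by blast
    then show ?thesis using q[of x] by (intro bexI[of _ s]) (auto simp: L_def)
  qed
  have L: "100 * \<delta> \<le> L"
  proof -
    obtain s where "s \<in> S" "100 * \<delta> < dist (s q) q" using large by blast
    then show ?thesis using F_ge[of s q] by (simp add: L_def S'_def)
  qed
  then have L0: "0 \<le> L" "18 * \<delta> \<le> L" using delta_ge by linarith+
  obtain g where g: "g \<in> word_ball S' 2" "isom g" "L - 9 * \<delta> \<le> dist (g q) q"
    "gp q (g q) (finv g q) \<le> 7 * \<delta>" "dist (g q) q \<le> 2 * L"
    using ex_hyperbolic_element[of S' t q L] geodesic S'i S'inv t sL min L by blast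
  have g\<Gamma>: "g \<in> \<Gamma>" using word_ball_subgroup[OF subgroup S'\<Gamma> g(1)] .
  have big: "2 * (7 * \<delta>) + 3 * \<delta> < dist (g q) q" using g(3) L delta_ge by linarith
  have axis: "quasi_axis (9 * \<delta>) q g" using quasi_axisI[OF g(2,4) big] by simp
  have growth: "real n * (L / 2) \<le> dist ((g ^^ n) q) q" for n
  proof -
    have "real n * (L / 2) \<le> real n * (dist (g q) q - 2 * (7 * \<delta>) - 2 * \<delta>)"
      using g(3) L delta_ge by (intro mult_left_mono) auto
    then show ?thesis using funpow_dist_ge[OF g(2,4) big, of n] by linarith
  qed
  have growth': "real n * (L / 2) \<le> dist ((a ^^ n) q) q" if "a \<in> {g, finv g}" for a n
    using growth dist_inv_funpow[OF g(2)] that by auto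
  \<comment> \<open>Growth gives \<open>g ^^ m\<close> displacement at least
    \<open>(28 + 4 * B) * L\<close>, that is twice the bound \<open>W_le\<close> plus
    \<open>8 * L\<close>, which covers the remaining terms of \<open>far\<close>.\<close>
  define m where "m = 56 + 8 * B"
  define W where "W = dist ((g ^^ (4 + B)) q) q + 18 * \<delta> + L"
  have W_le: "W \<le> (10 + 2 * real B) * L"
  proof -
    have "dist ((g ^^ (4 + B)) q) q \<le> real (4 + B) * (2 * L)"
      using dist_funpow_le[OF g(2), of "4 + B" q] g(5) by (smt (verit) mult_left_mono of_nat_0_le_iff)
    then show ?thesis unfolding W_def using L0 by (simp add: algebra_simps)
  qed
  \<comment> \<open>The exponents found for the individual generators are at most B, so each divides
    \<open>fact B\<close>: one power of \<open>g\<close> serves all generators.\<close>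
  define u where "u = g ^^ fact B"
  have ui: "isom u" unfolding u_def using g(2) by blast
  have uinv: "finv u = finv g ^^ fact B" unfolding u_def by (rule isom_inv_funpow[OF g(2)])
  have inter: "s \<circ> u = u \<circ> s \<or> s \<circ> u = finv u \<circ> s"
    if s: "s \<in> S'" and a: "a \<in> {g, finv g}" and b: "b \<in> {g, finv g}"
      and long: "W \<le> gp q ((a ^^ m) q) (s ((b ^^ m) q))" for s a b
  proof -
    have a\<Gamma>: "a \<in> \<Gamma>" "quasi_axis (9 * \<delta>) q a"
      using a g\<Gamma> \<Gamma>_inv axis quasi_axis_inv by auto
    have ba: "b = a \<or> b = finv a" using a b isom_inv_inv[OF g(2)] by auto
    have Wa: "dist ((a ^^ (4 + B)) q) q + 18 * \<delta> + L \<le> gp q ((a ^^ m) q) (s ((b ^^ m) q))"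
      using long a dist_inv_funpow[OF g(2), of "4 + B" q] by (auto simp: W_def)
    have "4 + B \<le> m" by (simp add: m_def)
    then obtain i where i: "1 \<le> i" "i \<le> B" "a ^^ i \<circ> s = s \<circ> b ^^ i"
      using ex_power_intertwines[where g = a and f = b and s = s and q = q and L = L and m = m,
          OF a\<Gamma> ba _ sL[OF s] growth'[OF a] L] s S'\<Gamma> Wa
      unfolding B_def by blast
    obtain k where k: "fact B = i * k" using dvd_fact[OF i(1,2)] by (metis dvdE of_nat_id)
    have "a ^^ fact B \<circ> s = s \<circ> b ^^ fact B"
      using funpow_intertwine[OF i(3), of k] unfolding k funpow_mult by (simp only: mult.commute)
    then have *: "v \<circ> s = s \<circ> w" if "v = a ^^ fact B" "w = b ^^ fact B" for v w using that by blast
    \<comment> \<open>Equal signs make \<open>s\<close> commute with \<open>u\<close>, opposite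
      signs make it invert \<open>u\<close>.\<close>
    consider "a = g" "b = g" | "a = g" "b = finv g" | "a = finv g" "b = g" | "a = finv g" "b = finv g"
      using a b by blast
    then show ?thesis
    proof cases
      case 1
      have "u \<circ> s = s \<circ> u" by (rule *) (simp_all only: 1 u_def)
      then show ?thesis by (intro disjI1) (rule sym)
    next
      case 2
      have us: "u \<circ> s = s \<circ> finv u" by (rule *) (simp_all only: 2 uinv u_def[symmetric])
      have "finv u \<circ> s = finv u \<circ> s \<circ> (finv u \<circ> u)" using ui by (simp only: isom_inv_comp comp_id)
      also have "\<dots> = finv u \<circ> (s \<circ> finv u) \<circ> u" by (simp only: comp_assoc)
      also have "\<dots> = (finv u \<circ> u) \<circ> s \<circ> u" by (simp only: comp_assoc us[symmetric])
      also have "\<dots> = s \<circ> u" using ui by (simp only: isom_inv_comp id_comp)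
      finally show ?thesis by (intro disjI2) (rule sym)
    next
      case 3
      have "finv u \<circ> s = s \<circ> u" by (rule *) (simp_all only: 3 uinv u_def[symmetric])
      then show ?thesis by (intro disjI2) (rule sym)
    next
      case 4
      have us: "finv u \<circ> s = s \<circ> finv u" by (rule *) (simp_all only: 4 uinv)
      have "u \<circ> s = u \<circ> s \<circ> (finv u \<circ> u)" using ui by (simp only: isom_inv_comp comp_id)
      also have "\<dots> = u \<circ> (s \<circ> finv u) \<circ> u" by (simp only: comp_assoc)
      also have "\<dots> = (u \<circ> finv u) \<circ> s \<circ> u" by (simp only: comp_assoc us[symmetric])
      also have "\<dots> = s \<circ> u" using ui by (simp only: isom_inv_comp id_comp)
      finally show ?thesis by (intro disjI1) (rule sym)
    qed
  qed
  have "\<exists>s\<in>S'. \<forall>a\<in>{g, finv g}. \<forall>b\<in>{g, finv g}. gp q ((a ^^ m) q) (s ((b ^^ m) q)) < W"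
  proof (rule ccontr)
    assume "\<not> ?thesis"
    then have commute: "s \<circ> u = u \<circ> s \<or> s \<circ> u = finv u \<circ> s" if "s \<in> S'" for s
      using that inter[OF that] not_less by metis
    have unb: "\<exists>n. T \<le> dist ((u ^^ n) q) q" for T
    proof -
      obtain n where n: "T \<le> real n * (L / 2)"
        using real_arch_simple[of "T / (L / 2)"] L delta_ge by (auto simp: field_simps)
      have "n \<le> fact B * n" by (simp add: fact_ge_1)
      then have "real n * (L / 2) \<le> real (fact B * n) * (L / 2)"
        using L0 by (intro mult_right_mono) (auto simp del: of_nat_mult)
      then show ?thesis using n growth[of "fact B * n"] unfolding u_def funpow_mult
        by (intro exI[of _ n]) (simp add: mult.commute)
    qed
    have normal: "h \<circ> u = u \<circ> h \<or> h \<circ> u = finv u \<circ> h" if "h \<in> \<Gamma>" for h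
    proof -
      obtain n where "h \<in> word_ball S n" using gen[OF \<open>h \<in> \<Gamma>\<close>] by blast
      then show ?thesis using normal_word_ball[OF ui, of S] commute unfolding S'_def by blast
    qed
    show False
      by (rule no_normal_quasi_axis[OF quasi_axis_funpow[OF axis, of "fact B", folded u_def] normal unb triples])
  qed
  then obtain s where s: "s \<in> S'"
    and short: "\<And>a b. a \<in> {g, finv g} \<Longrightarrow> b \<in> {g, finv g} \<Longrightarrow> gp q ((a ^^ m) q) (s ((b ^^ m) q)) < W" by blast
  have far: "2 * (W + L) + 2 * \<delta> + 2 * L < dist ((g ^^ m) q) q"
  proof -
    have "real m * (L / 2) = 2 * ((10 + 2 * real B) * L) + 8 * L"
      by (simp add: m_def field_simps)
    then show ?thesis using growth[of m] W_le L delta_ge by (simp add: algebra_simps)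
  qed
  have W9: "9 * \<delta> \<le> W" unfolding W_def using L0 delta_ge zero_le_dist[of "(g ^^ (4 + B)) q" q] by linarith
  have triple: "separated_triple \<delta> q (g ^^ m) (finv g ^^ m) (s \<circ> g ^^ m \<circ> finv s)"
    by (rule separated_triple_of_axis[OF axis S'i[OF s] sL[OF s] L far W9 short])
  have S'_iso: "S' \<subseteq> carrier isom_group" using S'i by blast
  have w1: "g ^^ m \<in> word_ball S' (m * 2)" by (rule word_ball_funpow[OF g(1)])
  have w2: "finv g ^^ m \<in> word_ball S' (m * 2)"
    by (rule word_ball_funpow[OF word_ball_inv[OF S'_iso g(1)]])
  have w3: "s \<circ> g ^^ m \<circ> finv s \<in> word_ball S' (1 + m * 2 + 1)"
    by (intro word_ball_comp w1 word_ball_1 s)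
  have "1 + m * 2 + 1 \<le> 4 * (30 + 4 * B)" "m * 2 \<le> 4 * (30 + 4 * B)" by (simp_all add: m_def)
  then have "g ^^ m \<in> word_ball S (4 * (30 + 4 * B))" "finv g ^^ m \<in> word_ball S (4 * (30 + 4 * B))"
    "s \<circ> g ^^ m \<circ> finv s \<in> word_ball S (4 * (30 + 4 * B))"
    using w1 w2 w3 word_ball_mono unfolding wb by blast+
  then show ?thesis using triple by blast
qed

end

section \<open>Separated triples from independent loxodromics\<close>

lemma gromov_rel_iff:
  "(u, v) \<in> gromov_rel p \<longleftrightarrow> (\<forall>Z. \<exists>N. \<forall>i\<ge>N. \<forall>j\<ge>N. Z \<le> gp p (u i) (v j))"
  unfolding gromov_rel_def by (simp add: filterlim_at_top eventually_prod_sequentially case_prod_beta)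
     (intro iff_allI ex_cong1 iffI allI impI; simp)

lemma gromov_relD: "(u, v) \<in> gromov_rel p \<Longrightarrow> \<exists>N. \<forall>i\<ge>N. \<forall>j\<ge>N. Z \<le> gp p (u i) (v j)"
  unfolding gromov_rel_iff by (rule spec)

lemma gromov_relI:
  assumes "\<And>Z. \<exists>N. \<forall>i\<ge>N. \<forall>j\<ge>N. Z \<le> gp p (u i) (v j)"
  shows "(u, v) \<in> gromov_rel p"
  using assms unfolding gromov_rel_iff by (rule allI)

lemma gromov_rel_sym:
  assumes "(u, v) \<in> gromov_rel p"
  shows "(v, u) \<in> gromov_rel p"
proof (rule gromov_relI)
  fix Z
  obtain N where "\<forall>i\<ge>N. \<forall>j\<ge>N. Z \<le> gp p (u i) (v j)"
    using gromov_relD[OF assms] by (rule exE)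
  then show "\<exists>N. \<forall>i\<ge>N. \<forall>j\<ge>N. Z \<le> gp p (v i) (u j)"
    using gp_commute[of p] by (intro exI[of _ N]) simp
qed

lemma isom_group_pow: "a [^]\<^bsub>isom_group\<^esub> int n = a ^^ n"
proof -
  have "a [^]\<^bsub>isom_group\<^esub> n = a ^^ n"
    by (induction n) (simp_all only: nat_pow_0 nat_pow_Suc isom_group_one isom_group_mult
        funpow.simps(1) funpow_Suc_right)
  then show ?thesis by (simp only: int_pow_int)
qed

lemma loxodromic_isom: "loxodromic a \<Longrightarrow> isom a"
  by (simp add: loxodromic_def)

lemma loxodromic_growth:
  assumes "loxodromic a"
  obtains L C where "L \<ge> 1" "C \<ge> 0" "\<And>n. real n / L - C \<le> dist ((a ^^ n) q) q"
proof -
  have "quasi_geodesic (\<lambda>n::int. (a [^]\<^bsub>isom_group\<^esub> n) q)"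
    using assms by (simp add: loxodromic_def)
  then obtain L C where LC: "L \<ge> 1" "C \<ge> 0" and
    *: "\<And>m n::int. \<bar>real_of_int (m - n)\<bar> / L - C \<le> dist ((a [^]\<^bsub>isom_group\<^esub> m) q) ((a [^]\<^bsub>isom_group\<^esub> n) q)"
    unfolding quasi_geodesic_def by blast
  have "real n / L - C \<le> dist ((a ^^ n) q) q" for n
    using *[of "int n" "int 0"] unfolding isom_group_pow by simp
  then show ?thesis using that LC by blast
qed

section \<open>Boundary points of quasi-axes\<close>

context hyperbolic_metric
begin

lemma gromov_rel_trans:
  fixes u v w :: "nat \<Rightarrow> 'a"
  assumes "(u, v) \<in> gromov_rel q" "(v, w) \<in> gromov_rel q"
  shows "(u, w) \<in> gromov_rel q"
proof (rule gromov_relI)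
  fix Z
  obtain N where N: "\<forall>i\<ge>N. \<forall>j\<ge>N. Z + \<delta> \<le> gp q (u i) (v j)"
    using gromov_relD[OF assms(1)] by (rule exE)
  obtain N' where N': "\<forall>i\<ge>N'. \<forall>j\<ge>N'. Z + \<delta> \<le> gp q (v i) (w j)"
    using gromov_relD[OF assms(2)] by (rule exE)
  have "Z \<le> gp q (u i) (w j)" if "i \<ge> max N N'" "j \<ge> max N N'" for i j
    using N[rule_format, of i "max N N'"] N'[rule_format, of "max N N'" j] that hyp[of q "u i" "v (max N N')" "w j"] by simp
  then show "\<exists>N. \<forall>i\<ge>N. \<forall>j\<ge>N. Z \<le> gp q (u i) (w j)" by (intro exI[of _ "max N N'"]) simp
qed

lemma gromov_class_eq:
  fixes u v :: "nat \<Rightarrow> 'a"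
  assumes "(u, v) \<in> gromov_rel q"
  shows "gromov_rel q `` {u} = gromov_rel q `` {v}"
proof (intro equalityI subsetI; unfold Image_singleton_iff)
  show "(v, w) \<in> gromov_rel q" if "(u, w) \<in> gromov_rel q" for w
    by (rule gromov_rel_trans[OF gromov_rel_sym[OF assms] that])
  show "(u, w) \<in> gromov_rel q" if "(v, w) \<in> gromov_rel q" for w
    by (rule gromov_rel_trans[OF assms that])
qed

lemma gromov_rel_bounded_shift:
  fixes u v u' v' :: "nat \<Rightarrow> 'a"
  assumes "(u, v) \<in> gromov_rel q" "\<And>i j. gp q (u i) (v j) \<le> gp q (u' i) (v' j) + E"
  shows "(u', v') \<in> gromov_rel q"
proof (rule gromov_relI)
  fix Z
  obtain N where N: "\<forall>i\<ge>N. \<forall>j\<ge>N. Z + E \<le> gp q (u i) (v j)"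
    using gromov_relD[OF assms(1)] by (rule exE)
  have "Z \<le> gp q (u' i) (v' j)" if "N \<le> i" "N \<le> j" for i j
    using N[rule_format, OF that] assms(2)[of i j] by linarith
  then show "\<exists>N. \<forall>i\<ge>N. \<forall>j\<ge>N. Z \<le> gp q (u' i) (v' j)" by (intro exI[of _ N]) simp
qed

lemma gromov_rel_isom:
  fixes u v :: "nat \<Rightarrow> 'a"
  assumes "(u, v) \<in> gromov_rel q" "isom a" "\<And>i. dist ((a \<circ> u) i) (u i) \<le> E"
  shows "(u, a \<circ> v) \<in> gromov_rel q"
proof (rule gromov_rel_bounded_shift[OF assms(1)])
  fix i j
  have "gp q (u i) (v j) \<le> gp q (a (u i)) (a (v j)) + dist (a q) q"
    using isom_gp[OF assms(2), of q "u i" "v j"] gp_base_lipschitz[of "a q" "a (u i)" "a (v j)" q] by simp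
  then show "gp q (u i) (v j) \<le> gp q (u i) ((a \<circ> v) j) + (E + dist (a q) q)"
    using gp_lipschitz[of q "a (u i)" "a (v j)" "u i"] assms(3)[of i] by simp
qed

text \<open>Otherwise \<open>\<kappa>(a\<^bsup>2m\<^esup>) \<le> \<kappa>(a\<^bsup>m\<^esup>) + 3\<delta>\<close> for every power of two \<open>m\<close>, which makes \<open>\<kappa>(a\<^bsup>m\<^esup>)\<close> grow only
  logarithmically.\<close>
lemma loxodromic_power_axis:
  assumes a: "loxodromic a"
  obtains k C where "quasi_axis C q (a ^^ k)" "\<And>n. real n \<le> dist (((a ^^ k) ^^ n) q) q"
proof -
  have ai: "isom a" using a by (rule loxodromic_isom)
  obtain L C where LC: "L \<ge> 1" "C \<ge> 0" and grow: "\<And>n. real n / L - C \<le> dist ((a ^^ n) q) q"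
    using loxodromic_growth[OF a] by blast
  define \<kappa> where "\<kappa> n = dist ((a ^^ n) q) q" for n
  define G where "G n = gp q ((a ^^ n) q) (finv (a ^^ n) q)" for n
  have double: "\<kappa> (2 * n) = 2 * \<kappa> n - 2 * G n" for n
  proof -
    have 2: "(a ^^ (2 * n)) q = (a ^^ n) ((a ^^ n) q)" by (simp only: mult_2 funpow_add o_apply)
    show ?thesis
      using dist_comp_gp[OF isom_funpow[OF ai, of n], of "a ^^ n" q]
        gp_commute[of q "(a ^^ n) q" "finv (a ^^ n) q"] unfolding \<kappa>_def G_def 2 by linarith
  qed
  have "\<exists>j. 2 * G (2 ^ j) + 3 * \<delta> < \<kappa> (2 ^ j)"
  proof (rule ccontr)
    assume "\<not> ?thesis"
    then have G_ge: "\<kappa> (2 ^ j) \<le> 2 * G (2 ^ j) + 3 * \<delta>" for j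
      unfolding not_ex not_less by (rule spec)
    have step: "\<kappa> (2 ^ Suc j) \<le> \<kappa> (2 ^ j) + 3 * \<delta>" for j
      using double[of "2 ^ j"] G_ge[of j] unfolding power_Suc by linarith
    have le: "\<kappa> (2 ^ j) \<le> \<kappa> 1 + 3 * \<delta> * real j" for j
    proof (induction j)
      case (Suc j)
      then show ?case using step[of j] by (simp add: algebra_simps)
    qed simp
    define T where "T = L * (C + \<kappa> 1 + 6 * \<delta>)"
    have \<kappa>1: "0 \<le> \<kappa> 1" by (simp add: \<kappa>_def)
    obtain i where i: "T \<le> real i" using real_arch_simple by blast
    have "real (Suc i) \<le> real (2 ^ i)" using less_exp[of i] by (intro of_nat_mono Suc_leI)
    then have "real i + 1 \<le> 2 ^ i" by simp
    \<comment> \<open>The exponent \<open>2 * i\<close> turns the crude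
      \<open>i + 1 \<le> 2 ^ i\<close> into a quadratic lower bound, against an upper bound linear
      in \<open>i\<close>.\<close>
    then have "(real i + 1) * (real i + 1) \<le> 2 ^ i * 2 ^ i" by (intro mult_mono) auto
    also have "\<dots> = (2::real) ^ (2 * i)" by (simp add: mult_2 power_add)
    also have "\<dots> \<le> L * (C + \<kappa> 1 + 3 * \<delta> * real (2 * i))"
    proof -
      have "2 ^ (2 * i) / L \<le> C + \<kappa> 1 + 3 * \<delta> * real (2 * i)"
        using grow[of "2 ^ (2 * i)"] le[of "2 * i"] unfolding \<kappa>_def[symmetric] by simp
      then show ?thesis using LC by (simp only: pos_divide_le_eq mult.commute)
    qed
    also have "\<dots> \<le> T * (real i + 1)"
    proof -
      have "0 \<le> (C + \<kappa> 1) * real i + 6 * \<delta>" using LC \<kappa>1 delta_ge by simp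
      then have "C + \<kappa> 1 + 3 * \<delta> * real (2 * i) \<le> (C + \<kappa> 1 + 6 * \<delta>) * (real i + 1)"
        by (simp add: algebra_simps)
      then show ?thesis using LC unfolding T_def mult.assoc by (intro mult_left_mono) auto
    qed
    also have "\<dots> \<le> real i * (real i + 1)" using i by (intro mult_right_mono) auto
    finally show False by (simp add: algebra_simps)
  qed
  then obtain j where j: "2 * G (2 ^ j) + 3 * \<delta> < \<kappa> (2 ^ j)" by blast
  define k where "k = (2::nat) ^ j"
  have ki: "isom (a ^^ k)" using ai by blast
  have big: "2 * G k + 3 * \<delta> < dist ((a ^^ k) q) q" using j by (simp add: k_def \<kappa>_def)
  have Gk: "gp q ((a ^^ k) q) (finv (a ^^ k) q) \<le> G k" by (simp add: G_def)
  show ?thesis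
  proof (rule that[OF quasi_axisI[OF ki Gk big]])
    fix n
    have "real n * 1 \<le> real n * (dist ((a ^^ k) q) q - 2 * G k - 2 * \<delta>)"
      using big delta_ge by (intro mult_left_mono) auto
    then show "real n \<le> dist (((a ^^ k) ^^ n) q) q"
      using funpow_dist_ge[OF ki Gk big, of n] by linarith
  qed
qed

lemma quasi_axis_converges:
  assumes u: "quasi_axis C q u" and grow: "\<And>n. real n \<le> dist ((u ^^ n) q) q"
  shows "(\<lambda>i. (u ^^ i) q, \<lambda>i. (u ^^ i) q) \<in> gromov_rel q"
  unfolding gromov_rel_iff
proof
  fix Z
  obtain N where N: "Z + C \<le> real N" using real_arch_simple by blast
  have *: "Z \<le> gp q ((u ^^ i) q) ((u ^^ j) q)" if "N \<le> i" "i \<le> j" for i j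
    using quasi_axis_gp_ge[OF u that(2)] grow[of i] N that(1) by linarith
  have "Z \<le> gp q ((u ^^ i) q) ((u ^^ j) q)" if "N \<le> i" "N \<le> j" for i j
    using *[of i j] *[of j i] that gp_commute[of q "(u ^^ i) q" "(u ^^ j) q"] by (cases "i \<le> j") auto
  then show "\<exists>N. \<forall>i\<ge>N. \<forall>j\<ge>N. Z \<le> gp q ((u ^^ i) q) ((u ^^ j) q)" by blast
qed

text \<open>Commuting with \<open>u\<close>, the isometry \<open>a\<close> moves every point of the
  orbit by the same distance \<open>dist (a q) q\<close>, which keeps its class. The inverse of
  \<open>a\<close> supplies the other inclusion, since the action is on classes as sets.\<close>

lemma quasi_axis_fixed_point:
  assumes u: "quasi_axis C q u" and grow: "\<And>n. real n \<le> dist ((u ^^ n) q) q"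
    and a: "isom a" and comm: "a \<circ> u = u \<circ> a"
  shows "gromov_rel q `` {\<lambda>i. (u ^^ i) q} \<in> boundary_fixed_points q a"
proof -
  define A where "A = (\<lambda>i. (u ^^ i) q)"
  have AA: "(A, A) \<in> gromov_rel q" unfolding A_def by (rule quasi_axis_converges[OF u grow])
  have aA: "dist ((a \<circ> A) i) (A i) \<le> dist (a q) q" for i
  proof -
    have "a ((u ^^ i) q) = (u ^^ i) (a q)"
      using funpow_intertwine[OF comm[symmetric], of i] by (metis comp_apply)
    then show ?thesis unfolding A_def using isom_dist[OF isom_funpow[OF quasi_axis_isom[OF u], of i]] by simp
  qed
  have iA: "dist ((finv a \<circ> A) i) (A i) \<le> dist (a q) q" for i
    using aA[of i] isom_dist_inv[OF a, of "A i" "A i"] by (simp add: dist_commute)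
  have "(\<lambda>v. a \<circ> v) ` (gromov_rel q `` {A}) = gromov_rel q `` {A}"
  proof (intro equalityI subsetI)
    fix w assume "w \<in> (\<lambda>v. a \<circ> v) ` (gromov_rel q `` {A})"
    then obtain v where "(A, v) \<in> gromov_rel q" "w = a \<circ> v" by blast
    then show "w \<in> gromov_rel q `` {A}" using gromov_rel_isom[OF _ a aA] by blast
  next
    fix w assume "w \<in> gromov_rel q `` {A}"
    then have "(A, finv a \<circ> w) \<in> gromov_rel q" using gromov_rel_isom[OF _ isom_inv[OF a] iA] by blast
    moreover have "w = a \<circ> (finv a \<circ> w)" using a by (simp only: comp_assoc[symmetric] isom_inv_comp id_comp)
    ultimately show "w \<in> (\<lambda>v. a \<circ> v) ` (gromov_rel q `` {A})" by blast
  qed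
  moreover have "gromov_rel q `` {A} \<in> gromov_boundary q"
    unfolding gromov_boundary_def using AA by (intro quotientI) simp
  ultimately show ?thesis unfolding boundary_fixed_points_def A_def[symmetric] by blast
qed

text \<open>One large product between the orbits persists for all later indices, because each orbit
  keeps its direction; unbounded products would therefore make the orbits equivalent.\<close>

lemma quasi_axes_gp_bounded:
  assumes u: "quasi_axis C q u" "\<And>n. real n \<le> dist ((u ^^ n) q) q"
    and v: "quasi_axis C' q v" "\<And>n. real n \<le> dist ((v ^^ n) q) q"
    and ne: "gromov_rel q `` {\<lambda>i. (u ^^ i) q} \<noteq> gromov_rel q `` {\<lambda>i. (v ^^ i) q}"
  shows "\<exists>E. \<forall>i j. gp q ((u ^^ i) q) ((v ^^ j) q) \<le> E"
proof (rule ccontr)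
  assume "\<not> ?thesis"
  then have unb: "\<exists>i j. E < gp q ((u ^^ i) q) ((v ^^ j) q)" for E by (meson not_le)
  have "0 \<le> C" "0 \<le> C'"
    using u(1) v(1) gp_nonneg order_trans unfolding quasi_axis_def by blast+
  have "(\<lambda>i. (u ^^ i) q, \<lambda>i. (v ^^ i) q) \<in> gromov_rel q"
    unfolding gromov_rel_iff
  proof
    fix Z
    obtain i j where ij: "Z + C + C' + 2 * \<delta> < gp q ((u ^^ i) q) ((v ^^ j) q)" using unb by blast
    have "Z \<le> gp q ((u ^^ i') q) ((v ^^ j') q)" if "i' \<ge> max i j" "j' \<ge> max i j" for i' j'
    proof -
      have "Z + 2 * \<delta> \<le> gp q ((u ^^ i') q) ((u ^^ i) q)"
        using quasi_axis_gp_ge[OF u(1), of i i'] that ij gp_le_dist[of q "(u ^^ i) q" "(v ^^ j) q"]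
          gp_commute[of q "(u ^^ i') q" "(u ^^ i) q"] \<open>0 \<le> C'\<close> by simp
      moreover have "Z + 2 * \<delta> \<le> gp q ((v ^^ j) q) ((v ^^ j') q)"
        using quasi_axis_gp_ge[OF v(1), of j j'] that ij gp_le_dist'[of q "(u ^^ i) q" "(v ^^ j) q"]
          \<open>0 \<le> C\<close> by simp
      moreover have "Z + 2 * \<delta> \<le> gp q ((u ^^ i) q) ((v ^^ j) q)"
        using ij \<open>0 \<le> C\<close> \<open>0 \<le> C'\<close> by simp
      ultimately show ?thesis
        using hyp2[of q "(u ^^ i') q" "(u ^^ i) q" "(v ^^ j) q" "(v ^^ j') q"] by linarith
    qed
    then show "\<exists>N. \<forall>i\<ge>N. \<forall>j\<ge>N. Z \<le> gp q ((u ^^ i) q) ((v ^^ j) q)" by blast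
  qed
  then show False using gromov_class_eq ne by blast
qed

end

context cocompact_action
begin

text \<open>The triple consists of high powers of \<open>u'\<close>, \<open>finv u'\<close> and
  \<open>v'\<close>. Disjoint fixed points bound the products for all four combinations of ends, as
  \<open>separated\<close> also compares inverses, while the displacements grow beyond these
  bounds.\<close>

lemma independent_loxodromics_triples:
  assumes ab: "a \<in> \<Gamma>" "b \<in> \<Gamma>" "independent_loxodromics p a b"
  shows "\<exists>f\<in>\<Gamma>. \<exists>g\<in>\<Gamma>. \<exists>h\<in>\<Gamma>. separated_triple R p f g h"
proof -
  have lox: "loxodromic a" "loxodromic b" and disj: "boundary_fixed_points p a \<inter> boundary_fixed_points p b = {}"
    using ab(3) by (auto simp: independent_loxodromics_def)
  have abi: "isom a" "isom b" using lox loxodromic_isom by auto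
  obtain k C where u: "quasi_axis C p (a ^^ k)" "\<And>n. real n \<le> dist (((a ^^ k) ^^ n) p) p"
    using loxodromic_power_axis[OF lox(1)] by blast
  obtain l C' where v: "quasi_axis C' p (b ^^ l)" "\<And>n. real n \<le> dist (((b ^^ l) ^^ n) p) p"
    using loxodromic_power_axis[OF lox(2)] by blast
  define u' v' where "u' = a ^^ k" and "v' = b ^^ l"
  have uvi: "isom u'" "isom v'" using abi by (auto simp: u'_def v'_def)
  have signs: "quasi_axis K p x" "\<And>n. real n \<le> dist ((x ^^ n) p) p"
      "gromov_rel p `` {\<lambda>i. (x ^^ i) p} \<in> boundary_fixed_points p c"
    if "quasi_axis K p w" "\<And>n. real n \<le> dist ((w ^^ n) p) p" "isom c" "w = c ^^ m" "x \<in> {w, finv w}" for K w x c m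
  proof -
    have wi: "isom w" using that by (intro quasi_axis_isom)
    show 1: "quasi_axis K p x" using that quasi_axis_inv by blast
    show 2: "real n \<le> dist ((x ^^ n) p) p" for n using that dist_inv_funpow[OF wi] by auto
    have cw: "c \<circ> w = w \<circ> c" unfolding that(4) by (simp only: funpow.simps(2)[symmetric] funpow_Suc_right[symmetric])
    have "c \<circ> finv w = finv w \<circ> c"
    proof -
      have "c \<circ> finv w = finv w \<circ> (w \<circ> c) \<circ> finv w"
        by (simp only: comp_assoc[symmetric] isom_inv_comp[OF wi] id_comp)
      also have "\<dots> = finv w \<circ> c \<circ> (w \<circ> finv w)" by (simp only: cw[symmetric] comp_assoc)
      finally show ?thesis by (simp only: isom_inv_comp[OF wi] comp_id)
    qed
    then have "c \<circ> x = x \<circ> c" using cw that(5) by blast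
    then show "gromov_rel p `` {\<lambda>i. (x ^^ i) p} \<in> boundary_fixed_points p c"
      by (rule quasi_axis_fixed_point[OF 1 2 that(3)])
  qed
  note us = signs[OF u abi(1) refl, folded u'_def] and vs = signs[OF v abi(2) refl, folded v'_def]
  have "\<exists>E. \<forall>i j. gp p ((x ^^ i) p) ((y ^^ j) p) \<le> E" if xy: "x \<in> {u', finv u'}" "y \<in> {v', finv v'}" for x y
    using us(3)[OF xy(1)] vs(3)[OF xy(2)] disj
    by (intro quasi_axes_gp_bounded[OF us(1,2)[OF xy(1)] vs(1,2)[OF xy(2)]]) auto
  then obtain E where E: "\<And>x y i j. x \<in> {u', finv u'} \<Longrightarrow> y \<in> {v', finv v'} \<Longrightarrow> gp p ((x ^^ i) p) ((y ^^ j) p) \<le> E x y"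
    by metis
  define X where "X = {C, E u' v', E (finv u') v', E u' (finv v'), E (finv u') (finv v')}"
  have X: "x \<le> Max X" if "x \<in> X" for x
    using that unfolding X_def by (intro Max_ge) auto
  obtain n where n: "2 * (Max X + R) < real n"
    using reals_Archimedean2 by blast
  have uu: "gp p ((u' ^^ n) p) ((finv u' ^^ n) p) \<le> C"
    using us(1)[of u'] by (simp add: quasi_axis_def)
  have inv: "finv (u' ^^ n) = finv u' ^^ n" "finv (v' ^^ n) = finv v' ^^ n" "finv (finv u' ^^ n) = u' ^^ n"
    using isom_inv_funpow[OF uvi(1), of n] isom_inv_funpow[OF uvi(2), of n]
      isom_inv_funpow[OF isom_inv[OF uvi(1)], of n] isom_inv_inv[OF uvi(1)] by simp_all
  have big: "real n \<le> dist ((u' ^^ n) p) p" "real n \<le> dist ((v' ^^ n) p) p" "real n \<le> dist ((finv u' ^^ n) p) p"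
    using us(2)[of u'] us(2)[of "finv u'"] vs(2)[of v'] by auto
  have sep: "separated R p x y"
    if "gp p (x p) (y p) \<le> z" "gp p (finv x p) (finv y p) \<le> z'" "z \<in> X" "z' \<in> X"
      "real n \<le> dist (x p) p" "real n \<le> dist (y p) p" for x y z z'
  proof -
    have "real n / 2 \<le> min (dist (x p) p) (dist (y p) p) / 2" using that by simp
    moreover have "w + R < real n / 2" if "w \<le> Max X" for w
      using that n by (simp add: field_simps)
    ultimately have "w + R < min (dist (x p) p) (dist (y p) p) / 2" if "w \<le> Max X" for w
      using that less_le_trans by blast
    then show ?thesis
      unfolding separated_def using order_trans[OF that(1) X[OF that(3)]] order_trans[OF that(2) X[OF that(4)]]
      by blast
  qed
  have "separated R p (u' ^^ n) (v' ^^ n)"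
    by (rule sep[of _ _ "E u' v'" "E (finv u') (finv v')"]) (unfold inv, (rule E big | simp add: X_def)+)
  moreover have "separated R p (u' ^^ n) (finv u' ^^ n)"
    by (rule sep[of _ _ C C]) (unfold inv, (rule uu uu[unfolded gp_commute[of p "(u' ^^ n) p"]] big | simp add: X_def)+)
  moreover have "separated R p (finv u' ^^ n) (v' ^^ n)"
    by (rule sep[of _ _ "E (finv u') v'" "E u' (finv v')"]) (unfold inv, (rule E big | simp add: X_def)+)
  ultimately have "separated_triple R p (u' ^^ n) (finv u' ^^ n) (v' ^^ n)"
    by (simp add: separated_triple_def)
  moreover have "u' ^^ n \<in> \<Gamma>" "v' ^^ n \<in> \<Gamma>" "finv u' ^^ n \<in> \<Gamma>"
    unfolding u'_def v'_def by (intro \<Gamma>_funpow \<Gamma>_inv ab)+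
  ultimately show ?thesis by blast
qed

end

section \<open>Conjugation invariance and the uniform separated triple\<close>

context hyperbolic_metric
begin

lemma separated_conj:
  assumes "separated R q g g'" and iso: "isom h" "isom g" "isom g'"
  shows "separated R (h q) (h \<circ> g \<circ> finv h) (h \<circ> g' \<circ> finv h)"
proof -
  have inv: "finv (h \<circ> f \<circ> finv h) = h \<circ> finv f \<circ> finv h" if "isom f" for f
    using that iso(1) by (simp only: isom_inv_of_comp isom_comp isom_inv isom_inv_inv comp_assoc)
  show ?thesis
    using assms(1) isom_dist[OF iso(1)] isom_gp[OF iso(1)] isom_inv_apply(1)[OF iso(1)]
    unfolding separated_def inv[OF iso(2)] inv[OF iso(3)] comp_apply by (simp only:)
qed

lemma separated_triple_conj:
  assumes "separated_triple R q a b c" "isom h" "isom a" "isom b" "isom c"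
  shows "separated_triple R (h q) (h \<circ> a \<circ> finv h) (h \<circ> b \<circ> finv h) (h \<circ> c \<circ> finv h)"
  using assms unfolding separated_triple_def by (intro conjI separated_conj) (elim conjE; assumption)+

end

lemma word_ball_conj:
  assumes h: "isom h" and S: "S \<subseteq> carrier isom_group"
  shows "g \<in> word_ball S n \<Longrightarrow> h \<circ> g \<circ> finv h \<in> word_ball ((\<lambda>s. h \<circ> s \<circ> finv h) ` S) n"
proof (induction n arbitrary: g)
  case 0
  then have "g = id" by simp
  then have "h \<circ> g \<circ> finv h = id" using h by (simp only: comp_id isom_inv_comp)
  then show ?case unfolding word_ball.simps singleton_iff .
next
  case (Suc n)
  let ?c = "\<lambda>s. h \<circ> s \<circ> finv h"
  from Suc.prems show ?case
  proof (cases rule: word_ball_SucE)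
    case 1
    then show ?thesis by (intro word_ball_Suc_mono Suc.IH)
  next
    case (2 s g')
    have "?c s \<in> ?c ` S \<union> finv ` ?c ` S"
      using 2(1)
    proof
      assume "s \<in> S"
      then have "?c s \<in> ?c ` S" by (rule image_eqI[where x = s, OF refl])
      then show ?thesis by (rule UnI1)
    next
      assume "s \<in> finv ` S"
      then obtain t where t: "t \<in> S" "s = finv t" by (rule imageE)
      then have "isom t" using S by blast
      then have cs: "?c s = finv (?c t)"
        unfolding t(2) using h by (simp only: isom_inv_of_comp isom_comp isom_inv isom_inv_inv comp_assoc)
      have "?c t \<in> ?c ` S" by (rule image_eqI[where x = t, OF refl t(1)])
      then have "finv (?c t) \<in> finv ` ?c ` S" by (rule image_eqI[where x = "?c t", OF refl])
      then show ?thesis unfolding cs by (rule UnI2)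
    qed
    then have mem: "?c s \<circ> ?c g' \<in> word_ball (?c ` S) (Suc n)"
      by (rule word_ball_SucI[OF _ Suc.IH[OF 2(2)]])
    have eq: "?c s \<circ> ?c g' = ?c g"
    proof -
      have "?c s \<circ> ?c g' = h \<circ> s \<circ> (finv h \<circ> h) \<circ> g' \<circ> finv h" by (simp only: comp_assoc)
      also have "\<dots> = ?c g" using h unfolding 2(3) by (simp only: isom_inv_comp comp_id comp_assoc)
      finally show ?thesis .
    qed
    show ?thesis using mem unfolding eq .
  qed
qed

lemma conj_conj: "isom h \<Longrightarrow> finv h \<circ> (h \<circ> g \<circ> finv h) \<circ> h = g"
proof -
  assume h: "isom h"
  have "finv h \<circ> (h \<circ> g \<circ> finv h) \<circ> h = (finv h \<circ> h) \<circ> g \<circ> (finv h \<circ> h)" by (simp only: comp_assoc)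
  then show ?thesis using h by (simp only: isom_inv_comp comp_id id_comp)
qed

context cocompact_action
begin

definition generates :: "('a \<Rightarrow> 'a) set \<Rightarrow> bool" where
  "generates S \<longleftrightarrow> finite S \<and> S \<noteq> {} \<and> S \<subseteq> \<Gamma> \<and> (\<forall>g\<in>\<Gamma>. \<exists>n. g \<in> word_ball S n)"

lemma generates_conj:
  assumes "generates S" "h \<in> \<Gamma>"
  shows "generates ((\<lambda>s. h \<circ> s \<circ> finv h) ` S)"
proof -
  have hi: "isom h" and Si: "S \<subseteq> carrier isom_group"
    using assms \<Gamma>_isom by (auto simp: generates_def)
  have "\<exists>n. g \<in> word_ball ((\<lambda>s. h \<circ> s \<circ> finv h) ` S) n" if g: "g \<in> \<Gamma>" for g
  proof -
    have "finv h \<circ> g \<circ> h \<in> \<Gamma>" using assms(2) g by (intro \<Gamma>_comp \<Gamma>_inv)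
    then obtain n where "finv h \<circ> g \<circ> h \<in> word_ball S n" using assms(1) unfolding generates_def by blast
    then have "h \<circ> (finv h \<circ> g \<circ> h) \<circ> finv h \<in> word_ball ((\<lambda>s. h \<circ> s \<circ> finv h) ` S) n"
      by (rule word_ball_conj[OF hi Si])
    moreover have "h \<circ> (finv h \<circ> g \<circ> h) \<circ> finv h = g"
      using conj_conj[OF isom_inv[OF hi], of g] unfolding isom_inv_inv[OF hi] .
    ultimately have "g \<in> word_ball ((\<lambda>s. h \<circ> s \<circ> finv h) ` S) n" by metis
    then show ?thesis by (rule exI)
  qed
  moreover have "(\<lambda>s. h \<circ> s \<circ> finv h) ` S \<subseteq> \<Gamma>"
    using assms unfolding generates_def by (intro image_subsetI \<Gamma>_comp \<Gamma>_inv) auto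
  ultimately show ?thesis using assms(1) unfolding generates_def by simp
qed

text \<open>A generating set of small joint displacement is conjugate to one of finitely many.\<close>
theorem uniform_separated_triple:
  assumes triples: "\<And>R. \<exists>a\<in>\<Gamma>. \<exists>b\<in>\<Gamma>. \<exists>c\<in>\<Gamma>. separated_triple R p a b c"
  obtains N where "\<And>S. generates S \<Longrightarrow>
    \<exists>q. \<exists>a\<in>word_ball S N. \<exists>b\<in>word_ball S N. \<exists>c\<in>word_ball S N. separated_triple \<delta> q a b c"
proof -
  obtain a b c where abc: "a \<in> \<Gamma>" "b \<in> \<Gamma>" "c \<in> \<Gamma>" "separated_triple \<delta> p a b c"
    using triples by blast
  have abci: "isom a" "isom b" "isom c" using abc \<Gamma>_isom by auto
  define F where "F = {g \<in> \<Gamma>. dist (g p) p \<le> 100 * \<delta> + 2 * D}"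
  have finF: "finite F" unfolding F_def by (rule finite_displacement)
  have "\<exists>n. a \<in> word_ball S n \<and> b \<in> word_ball S n \<and> c \<in> word_ball S n" if S: "generates S" for S
  proof -
    obtain k l m where "a \<in> word_ball S k" "b \<in> word_ball S l" "c \<in> word_ball S m"
      using S abc unfolding generates_def by blast
    then have "a \<in> word_ball S (k + l + m)" "b \<in> word_ball S (k + l + m)" "c \<in> word_ball S (k + l + m)"
      using word_ball_mono[of k "k + l + m" S] word_ball_mono[of l "k + l + m" S]
        word_ball_mono[of m "k + l + m" S] by auto
    then show ?thesis by blast
  qed
  then obtain \<nu> where \<nu>: "\<And>S. generates S \<Longrightarrow> a \<in> word_ball S (\<nu> S) \<and> b \<in> word_ball S (\<nu> S) \<and> c \<in> word_ball S (\<nu> S)"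
    by metis
  \<comment> \<open>A sum over all subsets of \<open>F\<close> dominates the length for each
    generating one; on subsets that do not generate, \<nu> is an arbitrary natural number.\<close>
  define N\<^sub>1 N\<^sub>2 where "N\<^sub>1 = 4 * (30 + 4 * vol (84 * \<delta> + 2 * D))" and "N\<^sub>2 = (\<Sum>S\<in>Pow F. \<nu> S)"
  show ?thesis
  proof (rule that[of "N\<^sub>1 + N\<^sub>2"])
    fix S assume S: "generates S"
    then have S': "finite S" "S \<noteq> {}" "S \<subseteq> \<Gamma>" "\<And>g. g \<in> \<Gamma> \<Longrightarrow> \<exists>n. g \<in> word_ball S n"
      by (auto simp: generates_def)
    have up: "word_ball S N\<^sub>1 \<subseteq> word_ball S (N\<^sub>1 + N\<^sub>2)" "word_ball S N\<^sub>2 \<subseteq> word_ball S (N\<^sub>1 + N\<^sub>2)"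
      by (intro word_ball_mono; simp)+
    show "\<exists>q. \<exists>a\<in>word_ball S (N\<^sub>1 + N\<^sub>2). \<exists>b\<in>word_ball S (N\<^sub>1 + N\<^sub>2). \<exists>c\<in>word_ball S (N\<^sub>1 + N\<^sub>2).
      separated_triple \<delta> q a b c"
    proof (cases "\<forall>x. \<exists>s\<in>S. 100 * \<delta> < dist (s x) x")
      case True
      then have "\<And>x. \<exists>s\<in>S. 100 * \<delta> < dist (s x) x" by blast
      from ex_triple_of_large_displacement[OF S' triples this]
      show ?thesis using up(1) unfolding N\<^sub>1_def by blast
    next
      case False
      then obtain x where x: "\<And>s. s \<in> S \<Longrightarrow> dist (s x) x \<le> 100 * \<delta>" by (meson not_less)
      obtain h where h: "h \<in> \<Gamma>" "dist x (h p) \<le> D" using cobounded by blast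
      have hi: "isom h" using h \<Gamma>_isom by blast
      define T where "T = (\<lambda>s. finv h \<circ> s \<circ> finv (finv h)) ` S"
      have T: "generates T" unfolding T_def by (rule generates_conj[OF S \<Gamma>_inv[OF h(1)]])
      have "T \<subseteq> F"
      proof
        fix t assume "t \<in> T"
        then obtain s where s: "s \<in> S" "t = finv h \<circ> s \<circ> h"
          unfolding T_def isom_inv_inv[OF hi] by (rule imageE)
        have "dist (t p) p = dist (s (h p)) (h p)" using hi unfolding s(2) by (simp add: isom_dist_inv)
        also have "\<dots> \<le> dist (s (h p)) (s x) + dist (s x) x + dist x (h p)"
          using dist_triangle[of "s (h p)" "h p" "s x"] dist_triangle[of "s x" "h p" x] by linarith
        also have "dist (s (h p)) (s x) = dist x (h p)"
          using \<Gamma>_isom S'(3) s(1) by (simp add: isom_dist dist_commute subset_iff)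
        finally have "dist (t p) p \<le> 100 * \<delta> + 2 * D" using x[OF s(1)] h(2) by linarith
        then show "t \<in> F" using T \<open>t \<in> T\<close> unfolding F_def generates_def by blast
      qed
      then have "\<nu> T \<le> N\<^sub>2" unfolding N\<^sub>2_def using finF by (intro member_le_sum) auto
      then have sub: "word_ball T (\<nu> T) \<subseteq> word_ball T N\<^sub>2" by (rule word_ball_mono)
      have Tback: "(\<lambda>t. h \<circ> t \<circ> finv h) ` T = S"
      proof -
        have "h \<circ> (finv h \<circ> s \<circ> finv (finv h)) \<circ> finv h = s" for s
          using conj_conj[OF isom_inv[OF hi], of s] unfolding isom_inv_inv[OF hi] .
        then show ?thesis unfolding T_def image_image by simp
      qed
      have T_isom: "T \<subseteq> carrier isom_group" using T \<Gamma>_isom unfolding generates_def by blast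
      have conj: "h \<circ> g \<circ> finv h \<in> word_ball S (N\<^sub>1 + N\<^sub>2)" if "g \<in> word_ball T (\<nu> T)" for g
        using word_ball_conj[OF hi T_isom, unfolded Tback, of g N\<^sub>2] sub up(2) that by blast
      show ?thesis
        using separated_triple_conj[OF abc(4) hi abci] conj \<nu>[OF T] by blast
    qed
  qed
qed

end

section \<open>Translations of finitely supported functions\<close>

definition supp :: "('b \<Rightarrow> real) \<Rightarrow> 'b set" where "supp f = {x. f x \<noteq> 0}"

text \<open>Meaningful for finite support, where all estimates take place; for infinite support the
  sum, hence the norm, is 0.\<close>

definition l2norm :: "('b \<Rightarrow> real) \<Rightarrow> real" where "l2norm f = L2_set f (supp f)"

text \<open>The left regular representation, extended to functions of arbitrary self-maps: left
  composition with an isometry is a bijection of these, so norms are preserved.\<close>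

definition translate :: "('a \<Rightarrow> 'a) \<Rightarrow> (('a \<Rightarrow> 'a) \<Rightarrow> real) \<Rightarrow> ('a \<Rightarrow> 'a) \<Rightarrow> real" where
  "translate s f = (\<lambda>x. f (finv s \<circ> x))"

lemma l2norm_superset:
  assumes "finite B" "supp f \<subseteq> B"
  shows "l2norm f = L2_set f B"
  unfolding l2norm_def L2_set_def using assms
  by (intro arg_cong[where f = sqrt] sum.mono_neutral_left) (auto simp: supp_def)

lemma l2norm_nonneg: "0 \<le> l2norm f"
  by (simp add: l2norm_def)

lemma l2norm_triangle:
  assumes "finite (supp f)" "finite (supp g)"
  shows "l2norm (\<lambda>x. f x + g x) \<le> l2norm f + l2norm g"
proof -
  let ?B = "supp f \<union> supp g"
  have "supp (\<lambda>x. f x + g x) \<subseteq> ?B" by (auto simp: supp_def)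
  then show ?thesis
    using assms L2_set_triangle_ineq[of f g ?B] by (simp add: l2norm_superset[of ?B])
qed

lemma supp_diff: "supp (\<lambda>x. f x - g x) \<subseteq> supp f \<union> supp g"
  by (auto simp: supp_def)

lemma abs_le_l2norm:
  assumes "finite (supp f)"
  shows "f x \<le> l2norm f"
proof (cases "x \<in> supp f")
  case True
  then have "f x \<le> L2_set f (supp f)" using assms
    by (intro order_trans[OF _ member_le_L2_set]) auto
  then show ?thesis by (simp add: l2norm_def)
next
  case False
  then show ?thesis using l2norm_nonneg[of f] by (simp add: supp_def)
qed

lemma isom_comp_left_cancel:
  assumes "isom s"
  shows "finv s \<circ> (s \<circ> x) = x" "s \<circ> (finv s \<circ> x) = x"
  using assms by (simp_all only: comp_assoc[symmetric] isom_inv_comp id_comp)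

lemma bij_comp_left: "isom s \<Longrightarrow> bij_betw ((\<circ>) s) A ((\<circ>) s ` A)"
  by (intro bij_betw_imageI inj_on_inverseI[of _ "(\<circ>) (finv s)"] refl) (rule isom_comp_left_cancel)

lemma translate_apply: "isom s \<Longrightarrow> translate s f (s \<circ> x) = f x"
  by (simp only: translate_def isom_comp_left_cancel)

lemma supp_translate:
  assumes s: "isom s"
  shows "supp (translate s f) = (\<circ>) s ` supp f"
proof (intro equalityI subsetI)
  fix x assume "x \<in> supp (translate s f)"
  then have "finv s \<circ> x \<in> supp f" by (simp only: supp_def translate_def mem_Collect_eq not_False_eq_True)
  then have "s \<circ> (finv s \<circ> x) \<in> (\<circ>) s ` supp f" by (rule imageI)
  then show "x \<in> (\<circ>) s ` supp f" by (simp only: isom_comp_left_cancel[OF s])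
next
  fix x assume "x \<in> (\<circ>) s ` supp f"
  then obtain y where "y \<in> supp f" "x = s \<circ> y" by (rule imageE)
  then show "x \<in> supp (translate s f)"
    unfolding supp_def mem_Collect_eq by (simp only: translate_apply[OF s] not_False_eq_True)
qed

lemma finite_supp_translate: "isom s \<Longrightarrow> finite (supp f) \<Longrightarrow> finite (supp (translate s f))"
  by (simp only: supp_translate finite_imageI)

lemma l2norm_translate:
  assumes s: "isom s"
  shows "l2norm (translate s f) = l2norm f"
  unfolding l2norm_def L2_set_def supp_translate[OF s]
  using sum.reindex_bij_betw[OF bij_comp_left[OF s], of "\<lambda>x. (translate s f x)\<^sup>2" "supp f"]
  unfolding translate_apply[OF s] by simp

lemma translate_comp: "isom s \<Longrightarrow> isom t \<Longrightarrow> translate (s \<circ> t) f = translate s (translate t f)"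
  by (simp only: translate_def isom_inv_of_comp comp_assoc)

lemma translate_id: "translate id f = f"
  unfolding translate_def inv_id id_comp ..

definition displacement :: "('a \<Rightarrow> 'a) \<Rightarrow> (('a \<Rightarrow> 'a) \<Rightarrow> real) \<Rightarrow> real" where
  "displacement s f = l2norm (\<lambda>x. translate s f x - f x)"

lemma l2norm_minus: "l2norm (\<lambda>x. f x - g x) = l2norm (\<lambda>x. g x - f x)"
proof -
  have "supp (\<lambda>x. f x - g x) = supp (\<lambda>x. g x - f x)" by (auto simp: supp_def)
  then show ?thesis
    unfolding l2norm_def L2_set_def by (intro arg_cong[where f = sqrt] sum.cong power2_commute)
qed

lemma displacement_comp:
  assumes "isom s" "isom t" "finite (supp f)"
  shows "displacement (s \<circ> t) f \<le> displacement s f + displacement t f"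
proof -
  let ?d = "\<lambda>x. translate t f x - f x"
  have fin: "finite (supp ?d)"
    by (rule finite_subset[OF supp_diff finite_UnI[OF finite_supp_translate[OF assms(2,3)] assms(3)]])
  have fin': "finite (supp (\<lambda>x. translate s f x - f x))"
    by (rule finite_subset[OF supp_diff finite_UnI[OF finite_supp_translate[OF assms(1,3)] assms(3)]])
  have "displacement (s \<circ> t) f = l2norm (\<lambda>x. translate s ?d x + (translate s f x - f x))"
    unfolding displacement_def translate_comp[OF assms(1,2)] translate_def[of s] by (simp only: diff_add_eq_diff_diff_swap diff_diff_eq2 add_diff_eq diff_add_cancel)
  also have "\<dots> \<le> l2norm (translate s ?d) + displacement s f"
    unfolding displacement_def by (rule l2norm_triangle[OF finite_supp_translate[OF assms(1) fin] fin'])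
  also have "l2norm (translate s ?d) = displacement t f"
    unfolding l2norm_translate[OF assms(1)] displacement_def ..
  finally show ?thesis by linarith
qed

lemma displacement_inv:
  assumes s: "isom s"
  shows "displacement (finv s) f = displacement s f"
proof -
  have "translate s (\<lambda>x. translate (finv s) f x - f x) = (\<lambda>x. f x - translate s f x)"
    unfolding translate_def isom_inv_inv[OF s] isom_comp_left_cancel[OF s] ..
  then have "displacement (finv s) f = l2norm (\<lambda>x. f x - translate s f x)"
    using l2norm_translate[OF s, of "\<lambda>x. translate (finv s) f x - f x"] unfolding displacement_def by simp
  then show ?thesis unfolding displacement_def by (simp only: l2norm_minus[of f])
qed

lemma displacement_word_ball:
  assumes S: "S \<subseteq> carrier isom_group" and f: "finite (supp f)"
    and \<eta>: "0 \<le> \<eta>" "\<And>s. s \<in> S \<Longrightarrow> displacement s f \<le> \<eta>"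
  shows "g \<in> word_ball S n \<Longrightarrow> displacement g f \<le> real n * \<eta>"
proof (induction n arbitrary: g)
  case 0
  then have "g = id" by simp
  then show ?case unfolding displacement_def l2norm_def L2_set_def by (simp add: translate_id)
next
  case (Suc n)
  have n: "real (Suc n) * \<eta> = real n * \<eta> + \<eta>" by (simp add: algebra_simps)
  from Suc.prems show ?case
  proof (cases rule: word_ball_SucE)
    case 1
    then show ?thesis using Suc.IH[OF 1] \<eta>(1) unfolding n by linarith
  next
    case (2 s h)
    have "isom s \<and> displacement s f \<le> \<eta>" using 2(1)
    proof
      assume "s \<in> S" then show ?thesis using S \<eta>(2) by blast
    next
      assume "s \<in> finv ` S"
      then obtain t where t: "t \<in> S" "s = finv t" by (rule imageE)
      then have ti: "isom t" using S by blast
      show ?thesis unfolding t(2) displacement_inv[OF ti] using isom_inv[OF ti] \<eta>(2)[OF t(1)] ..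
    qed
    then show ?thesis
      using displacement_comp[OF _ word_ball_isom[OF S 2(2)] f, of s] Suc.IH[OF 2(2)]
      unfolding 2(3) n by linarith
  qed
qed

text \<open>The mass of \<open>f\<close> off V is carried by \<open>s\<close> into U, so it is at
  most the mass of the translate on U. That differs from the mass of \<open>f\<close> on U by a
  difference of squares, at most \<open>2 * l2norm f\<close> times the displacement.\<close>

lemma ping_pong_mass:
  fixes f :: "('a::metric_space \<Rightarrow> 'a) \<Rightarrow> real"
  assumes s: "isom s" and f: "finite (supp f)" and UV: "\<And>x. x \<notin> V \<Longrightarrow> s \<circ> x \<in> U"
  shows "(l2norm f)\<^sup>2 \<le> (\<Sum>x\<in>supp f \<inter> V. (f x)\<^sup>2) + (\<Sum>x\<in>supp f \<inter> U. (f x)\<^sup>2)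
    + 2 * l2norm f * displacement s f"
proof -
  define h where "h = translate s f"
  define B where "B = supp f \<union> supp h"
  have finh: "finite (supp h)" unfolding h_def by (rule finite_supp_translate[OF s f])
  then have B: "finite B" using f by (simp add: B_def)
  have norms: "l2norm f = L2_set f B" "l2norm h = L2_set h B"
    by (rule l2norm_superset[OF B]; simp add: B_def)+
  have hf: "l2norm h = l2norm f" unfolding h_def by (rule l2norm_translate[OF s])
  have disp: "displacement s f = L2_set (\<lambda>x. h x - f x) B"
    unfolding displacement_def h_def[symmetric]
    by (rule l2norm_superset[OF B]) (unfold B_def, use supp_diff[of h f] in blast)
  have sub: "L2_set k (B \<inter> U) \<le> L2_set k B" for k :: "('a \<Rightarrow> 'a) \<Rightarrow> real"
    unfolding L2_set_def using B by (intro real_sqrt_le_mono sum_mono2) auto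
  have "L2_set h (B \<inter> U) = L2_set (\<lambda>x. f x + (h x - f x)) (B \<inter> U)" by simp
  also have "\<dots> \<le> L2_set f (B \<inter> U) + L2_set (\<lambda>x. h x - f x) (B \<inter> U)" by (rule L2_set_triangle_ineq)
  finally have diff: "L2_set h (B \<inter> U) - L2_set f (B \<inter> U) \<le> displacement s f"
    using sub[of "\<lambda>x. h x - f x"] unfolding disp by linarith
  have "(L2_set h (B \<inter> U))\<^sup>2 - (L2_set f (B \<inter> U))\<^sup>2
      = (L2_set h (B \<inter> U) + L2_set f (B \<inter> U)) * (L2_set h (B \<inter> U) - L2_set f (B \<inter> U))"
    by (simp add: power2_eq_square algebra_simps)
  also have "\<dots> \<le> (L2_set h (B \<inter> U) + L2_set f (B \<inter> U)) * displacement s f"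
    by (intro mult_left_mono diff add_nonneg_nonneg L2_set_nonneg)
  also have "\<dots> \<le> (2 * l2norm f) * displacement s f"
    using sub[of h] sub[of f] hf unfolding norms displacement_def
    by (intro mult_right_mono l2norm_nonneg) (simp add: norms)
  finally have U: "(L2_set h (B \<inter> U))\<^sup>2 \<le> (L2_set f (B \<inter> U))\<^sup>2 + 2 * l2norm f * displacement s f" by simp
  have sq: "(L2_set k A)\<^sup>2 = (\<Sum>x\<in>A. (k x)\<^sup>2)" for k :: "('a \<Rightarrow> 'a) \<Rightarrow> real" and A
    unfolding L2_set_def by (simp add: sum_nonneg)
  have "(\<Sum>x\<in>supp f - V. (f x)\<^sup>2) = (\<Sum>x\<in>supp f - V. (h (s \<circ> x))\<^sup>2)"
    unfolding h_def translate_apply[OF s] ..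
  also have "\<dots> = (\<Sum>y\<in>(\<circ>) s ` (supp f - V). (h y)\<^sup>2)"
    by (rule sum.reindex_bij_betw[OF bij_comp_left[OF s]])
  also have "\<dots> \<le> (\<Sum>y\<in>B \<inter> U. (h y)\<^sup>2)"
  proof (rule sum_mono2)
    show "finite (B \<inter> U)" using B by simp
    show "(\<circ>) s ` (supp f - V) \<subseteq> B \<inter> U"
    proof (rule image_subsetI)
      fix x assume x: "x \<in> supp f - V"
      have "s \<circ> x \<in> (\<circ>) s ` supp f" using x by (intro imageI) simp
      then have "s \<circ> x \<in> supp h" unfolding h_def supp_translate[OF s] .
      then show "s \<circ> x \<in> B \<inter> U" using UV x by (simp add: B_def)
    qed
  qed simp
  finally have "(\<Sum>x\<in>supp f - V. (f x)\<^sup>2) \<le> (\<Sum>x\<in>B \<inter> U. (f x)\<^sup>2) + 2 * l2norm f * displacement s f"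
    using U unfolding sq by linarith
  moreover have "(\<Sum>x\<in>B \<inter> U. (f x)\<^sup>2) = (\<Sum>x\<in>supp f \<inter> U. (f x)\<^sup>2)"
    using B by (intro sum.mono_neutral_right) (auto simp: B_def supp_def)
  moreover have "(l2norm f)\<^sup>2 = (\<Sum>x\<in>supp f \<inter> V. (f x)\<^sup>2) + (\<Sum>x\<in>supp f - V. (f x)\<^sup>2)"
    unfolding l2norm_def sq using sum.Int_Diff[OF f] by blast
  ultimately show ?thesis by linarith
qed

section \<open>Displacement bounds from separated triples\<close>

context hyperbolic_metric
begin

text \<open>Every isometry \<open>g\<close> sends the complement of \<open>{x. (x|g\<^sup>-\<^sup>1q)\<^sub>q > \<kappa>(g)/2}\<close> into
  \<open>{x. (x|gq)\<^sub>q \<ge> \<kappa>(g)/2}\<close>; for a separated triple the three sets of either kind are disjoint.\<close>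
lemma separated_triple_displacement:
  fixes f :: "('a \<Rightarrow> 'a) \<Rightarrow> real"
  assumes sep: "separated_triple \<delta> q g\<^sub>1 g\<^sub>2 g\<^sub>3" and iso: "isom g\<^sub>1" "isom g\<^sub>2" "isom g\<^sub>3"
    and f: "finite (supp f)" and d: "displacement g\<^sub>1 f \<le> \<eta>" "displacement g\<^sub>2 f \<le> \<eta>" "displacement g\<^sub>3 f \<le> \<eta>"
  shows "l2norm f \<le> 6 * \<eta>"
proof -
  define U where "U g = {x :: 'a \<Rightarrow> 'a. dist (g q) q / 2 \<le> gp q (x q) (g q)}" for g
  define V where "V g = {x :: 'a \<Rightarrow> 'a. dist (g q) q / 2 < gp q (x q) (finv g q)}" for g
  define m where "m A = (\<Sum>x\<in>supp f \<inter> A. (f x)\<^sup>2)" for A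
  have UV: "g \<circ> x \<in> U g" if g: "isom g" and x: "x \<notin> V g" for g x
  proof -
    have "gp q (g (x q)) (g q) = gp (finv g q) (x q) q"
      using isom_gp[OF g, of "finv g q" "x q" q] g by simp
    also have "\<dots> = dist (g q) q - gp q (x q) (finv g q)"
      using gp_swap[of "finv g q" q "x q"] gp_commute[of "finv g q" "x q" q]
        gp_commute[of q "x q" "finv g q"] isom_dist_inv_base[OF g, of q] dist_commute[of q "finv g q"]
      by linarith
    finally show ?thesis using x unfolding U_def V_def by simp
  qed
  have mass: "(l2norm f)\<^sup>2 \<le> m (V g) + m (U g) + 2 * l2norm f * displacement g f" if "isom g" for g
    unfolding m_def by (rule ping_pong_mass[OF that f UV[OF that]])
  have disj: "U g \<inter> U h = {} \<and> V g \<inter> V h = {}" if "separated \<delta> q g h" "isom g" "isom h" for g h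
  proof (intro conjI equals0I)
    fix x assume "x \<in> U g \<inter> U h"
    then show False
      using that(1) hyp[of q "g q" "x q" "h q"] gp_commute[of q "g q" "x q"]
      unfolding U_def separated_def by (simp add: min_def split: if_splits)
  next
    fix x assume "x \<in> V g \<inter> V h"
    then show False
      using that(1) hyp[of q "finv g q" "x q" "finv h q"] gp_commute[of q "finv g q" "x q"]
      unfolding V_def separated_def by (simp add: min_def split: if_splits)
  qed
  have three: "m A + m B + m C \<le> (l2norm f)\<^sup>2" if "A \<inter> B = {}" "A \<inter> C = {}" "B \<inter> C = {}" for A B C
  proof -
    have "m A + m B + m C = (\<Sum>x\<in>(supp f \<inter> A) \<union> (supp f \<inter> B) \<union> (supp f \<inter> C). (f x)\<^sup>2)"
      unfolding m_def using f that by (subst sum.union_disjoint; (subst sum.union_disjoint)?) auto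
    also have "\<dots> \<le> (\<Sum>x\<in>supp f. (f x)\<^sup>2)" using f by (intro sum_mono2) auto
    also have "\<dots> = (l2norm f)\<^sup>2" unfolding l2norm_def L2_set_def by (simp add: sum_nonneg)
    finally show ?thesis .
  qed
  have s: "separated \<delta> q g\<^sub>1 g\<^sub>2" "separated \<delta> q g\<^sub>1 g\<^sub>3" "separated \<delta> q g\<^sub>2 g\<^sub>3"
    using sep by (simp_all add: separated_triple_def)
  note D = disj[OF s(1) iso(1,2)] disj[OF s(2) iso(1,3)] disj[OF s(3) iso(2,3)]
  have mU: "m (U g\<^sub>1) + m (U g\<^sub>2) + m (U g\<^sub>3) \<le> (l2norm f)\<^sup>2" using D by (intro three) blast+
  have mV: "m (V g\<^sub>1) + m (V g\<^sub>2) + m (V g\<^sub>3) \<le> (l2norm f)\<^sup>2" using D by (intro three) blast+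
  have e: "2 * l2norm f * displacement g f \<le> 2 * l2norm f * \<eta>" if "displacement g f \<le> \<eta>" for g
    using that by (intro mult_left_mono) (simp_all add: l2norm_nonneg)
  \<comment> \<open>Sum of the three mass inequalities: the \<open>U\<close> sets and the
    \<open>V\<close> sets each absorb one squared norm, one of three is left, and the errors add up
    to three times \<open>2 * l2norm f * \<eta>\<close>.\<close>
  have "l2norm f * l2norm f \<le> l2norm f * (6 * \<eta>)"
    using mass[OF iso(1)] mass[OF iso(2)] mass[OF iso(3)] mU mV e[OF d(1)] e[OF d(2)] e[OF d(3)]
    by (simp add: power2_eq_square)
  moreover have "0 \<le> \<eta>" using d(1) l2norm_nonneg order_trans unfolding displacement_def by blast
  ultimately show ?thesis using l2norm_nonneg[of f] by (cases "l2norm f = 0") (auto simp: mult_le_cancel_left)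
qed

end

section \<open>Finite-dimensional expectations of the random walk\<close>

text \<open>Steps beyond \<open>n\<close> are set to the identity.\<close>
primrec path_exp :: "('a \<Rightarrow> 'a) pmf \<Rightarrow> nat \<Rightarrow> ((nat \<Rightarrow> 'a \<Rightarrow> 'a) \<Rightarrow> real) \<Rightarrow> real" where
  "path_exp \<mu> 0 \<phi> = \<phi> (\<lambda>_. id)"
| "path_exp \<mu> (Suc n) \<phi> = (\<Sum>s\<in>set_pmf \<mu>. pmf \<mu> s * path_exp \<mu> n (\<lambda>X. \<phi> (X(Suc n := s))))"

abbreviation walk_exp :: "('a \<Rightarrow> 'a) pmf \<Rightarrow> nat \<Rightarrow> (('a \<Rightarrow> 'a) \<Rightarrow> real) \<Rightarrow> real" where
  "walk_exp \<mu> n \<phi> \<equiv> path_exp \<mu> n (\<lambda>X. \<phi> (walk n X))"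

lemma walk_cong: "(\<And>i. 1 \<le> i \<Longrightarrow> i \<le> n \<Longrightarrow> X i = Y i) \<Longrightarrow> walk n X = walk n Y"
proof (induction n)
  case (Suc n)
  have "walk n X = walk n Y" using Suc by simp
  moreover have "X (Suc n) = Y (Suc n)" using Suc.prems by simp
  ultimately show ?case by (simp only: walk.simps)
qed (simp only: walk.simps)

lemma walk_upd: "k \<le> n \<Longrightarrow> walk k (X(Suc n := s)) = walk k X"
  by (rule walk_cong) simp

lemma walk_exp_0: "walk_exp \<mu> 0 \<phi> = \<phi> id"
  by (simp only: path_exp.simps walk.simps)

lemma walk_exp_Suc:
  "walk_exp \<mu> (Suc n) \<phi> = (\<Sum>s\<in>set_pmf \<mu>. pmf \<mu> s * walk_exp \<mu> n (\<lambda>g. \<phi> (g \<circ> s)))"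
  by (simp only: path_exp.simps walk.simps walk_upd[OF order_refl] fun_upd_same)

lemma path_exp_add: "path_exp \<mu> n (\<lambda>X. \<phi> X + \<psi> X) = path_exp \<mu> n \<phi> + path_exp \<mu> n \<psi>"
  by (induction n arbitrary: \<phi> \<psi>) (simp_all add: sum.distrib distrib_left)

lemma path_exp_cmult: "path_exp \<mu> n (\<lambda>X. c * \<phi> X) = c * path_exp \<mu> n \<phi>"
  by (induction n arbitrary: \<phi>) (simp_all add: sum_distrib_left mult.left_commute)

lemma path_exp_diff: "path_exp \<mu> n (\<lambda>X. \<phi> X - \<psi> X) = path_exp \<mu> n \<phi> - path_exp \<mu> n \<psi>"
  using path_exp_add[of \<mu> n \<phi> "\<lambda>X. -1 * \<psi> X"] unfolding path_exp_cmult by simp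

lemma path_exp_zero: "path_exp \<mu> n (\<lambda>X. 0) = 0"
  using path_exp_cmult[of \<mu> n 0 "\<lambda>_. 0"] by simp

lemma path_exp_sum:
  "finite I \<Longrightarrow> path_exp \<mu> n (\<lambda>X. \<Sum>i\<in>I. \<phi> i X) = (\<Sum>i\<in>I. path_exp \<mu> n (\<phi> i))"
  by (induction I rule: finite_induct) (simp_all add: path_exp_zero path_exp_add)

lemma sum_pmf_set: "finite (set_pmf \<mu>) \<Longrightarrow> (\<Sum>s\<in>set_pmf \<mu>. pmf \<mu> s) = 1"
  by (intro sum_pmf_eq_1) auto

lemma path_exp_const:
  assumes "finite (set_pmf \<mu>)"
  shows "path_exp \<mu> n (\<lambda>X. c) = c"
  by (induction n) (simp_all add: sum_pmf_set[OF assms] flip: sum_distrib_right)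

text \<open>The identity joins the support because untouched coordinates keep it; comparing on such
  paths only allows bounds that need the walk to stay in \<Gamma>.\<close>

lemma path_exp_mono:
  assumes "\<And>X. (\<And>i. X i \<in> insert id (set_pmf \<mu>)) \<Longrightarrow> \<phi> X \<le> \<psi> X"
  shows "path_exp \<mu> n \<phi> \<le> path_exp \<mu> n \<psi>"
  using assms
proof (induction n arbitrary: \<phi> \<psi>)
  case 0
  show ?case unfolding path_exp.simps by (rule 0) (rule insertI1)
next
  case (Suc n)
  have "path_exp \<mu> n (\<lambda>X. \<phi> (X(Suc n := s))) \<le> path_exp \<mu> n (\<lambda>X. \<psi> (X(Suc n := s)))"
    if "s \<in> set_pmf \<mu>" for s
    using that by (intro Suc.IH Suc.prems) auto
  then show ?case unfolding path_exp.simps by (intro sum_mono mult_left_mono pmf_nonneg)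
qed

lemma path_exp_cong:
  assumes "\<And>X. (\<And>i. X i \<in> insert id (set_pmf \<mu>)) \<Longrightarrow> \<phi> X = \<psi> X"
  shows "path_exp \<mu> n \<phi> = path_exp \<mu> n \<psi>"
  by (intro antisym path_exp_mono) (simp_all only: assms order_refl)

lemma path_exp_truncate:
  assumes fin: "finite (set_pmf \<mu>)" and local: "\<And>X s i. k < i \<Longrightarrow> \<phi> (X(i := s)) = \<phi> X"
  shows "k \<le> n \<Longrightarrow> path_exp \<mu> n \<phi> = path_exp \<mu> k \<phi>"
proof (induction n)
  case (Suc n)
  show ?case
  proof (cases "k = Suc n")
    case False
    then have "k < Suc n" "k \<le> n" using Suc.prems by auto
    then show ?thesis
      using Suc.IH sum_pmf_set[OF fin] by (simp add: local flip: sum_distrib_right)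
  qed simp
qed simp

text \<open>The steps after time \<open>m\<close> form an independent copy of the walk; this takes
  the place of conditional expectation.\<close>

lemma walk_exp_comp:
  "walk_exp \<mu> (m + n) \<phi> = walk_exp \<mu> m (\<lambda>g. walk_exp \<mu> n (\<lambda>h. \<phi> (g \<circ> h)))"
proof (induction n arbitrary: \<phi>)
  case 0
  show ?case by (simp only: add_0_right path_exp.simps walk.simps comp_id)
next
  case (Suc n)
  have "walk_exp \<mu> (m + Suc n) \<phi>
      = (\<Sum>s\<in>set_pmf \<mu>. pmf \<mu> s * walk_exp \<mu> m (\<lambda>g. walk_exp \<mu> n (\<lambda>h. \<phi> (g \<circ> h \<circ> s))))"
    unfolding add_Suc_right walk_exp_Suc[of \<mu> "m + n" \<phi>] Suc.IH[of "\<lambda>g. \<phi> (g \<circ> s)" for s] ..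
  also have "\<dots> = walk_exp \<mu> m (\<lambda>g. walk_exp \<mu> (Suc n) (\<lambda>h. \<phi> (g \<circ> h)))"
  proof (cases "finite (set_pmf \<mu>)")
    case True
    show ?thesis
      unfolding walk_exp_Suc[of \<mu> n "\<lambda>h. \<phi> (g \<circ> h)" for g] path_exp_sum[OF True] path_exp_cmult comp_assoc ..
  next
    \<comment> \<open>Sums over an infinite support are 0 by convention, so both sides
      vanish.\<close>
    case False
    then show ?thesis
      unfolding walk_exp_Suc[of \<mu> n "\<lambda>h. \<phi> (g \<circ> h)" for g] by (simp add: path_exp_zero)
  qed
  finally show ?case .
qed

lemma walk_exp_1: "walk_exp \<mu> (Suc 0) \<phi> = (\<Sum>s\<in>set_pmf \<mu>. pmf \<mu> s * \<phi> s)"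
  unfolding walk_exp_Suc[of \<mu> 0 \<phi>] walk_exp_0[of \<mu> "\<lambda>g. \<phi> (g \<circ> s)" for s] id_comp ..

section \<open>Decay of the return probabilities\<close>

definition heat :: "('a \<Rightarrow> 'a) pmf \<Rightarrow> nat \<Rightarrow> ('a \<Rightarrow> 'a) \<Rightarrow> real" where
  "heat \<mu> n g = walk_exp \<mu> n (\<lambda>h. if h = g then 1 else 0)"

definition average :: "('a \<Rightarrow> 'a) pmf \<Rightarrow> (('a \<Rightarrow> 'a) \<Rightarrow> real) \<Rightarrow> ('a \<Rightarrow> 'a) \<Rightarrow> real" where
  "average \<mu> f = (\<lambda>x. \<Sum>s\<in>set_pmf \<mu>. pmf \<mu> s * translate s f x)"

definition lazy :: "('a \<Rightarrow> 'a) pmf \<Rightarrow> (('a \<Rightarrow> 'a) \<Rightarrow> real) \<Rightarrow> ('a \<Rightarrow> 'a) \<Rightarrow> real" where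
  "lazy \<mu> f = (\<lambda>x. (f x + average \<mu> f x) / 2)"

lemma heat_nonneg: "0 \<le> heat \<mu> n g"
  using path_exp_mono[of \<mu> "\<lambda>_. 0" _ n] unfolding heat_def path_exp_zero by simp

lemma heat_0: "heat \<mu> 0 = (\<lambda>g. if g = id then 1 else 0)"
  unfolding heat_def path_exp.simps walk.simps by (rule ext) (simp only: eq_commute[of id])

text \<open>Splitting off the first step instead of the last makes the recursion a combination of
  left translations.\<close>

lemma heat_Suc:
  fixes \<mu> :: "('a::metric_space \<Rightarrow> 'a) pmf"
  assumes "set_pmf \<mu> \<subseteq> carrier isom_group"
  shows "heat \<mu> (Suc n) = average \<mu> (heat \<mu> n)"
proof
  fix g :: "'a \<Rightarrow> 'a"
  have eq: "(s \<circ> h = g) = (h = finv s \<circ> g)" if "s \<in> set_pmf \<mu>" for s h :: "'a \<Rightarrow> 'a"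
  proof -
    have "isom s" using that assms by blast
    then show ?thesis using isom_comp_left_cancel[of s] by metis
  qed
  have "heat \<mu> (Suc n) g = walk_exp \<mu> (Suc 0 + n) (\<lambda>h. if h = g then 1 else 0)"
    unfolding heat_def add_Suc add_0 ..
  also have "\<dots> = (\<Sum>s\<in>set_pmf \<mu>. pmf \<mu> s * walk_exp \<mu> n (\<lambda>h. if s \<circ> h = g then 1 else 0))"
    unfolding walk_exp_comp[of \<mu> "Suc 0" n "\<lambda>h. if h = g then 1 else 0"]
      walk_exp_1[of \<mu> "\<lambda>s. walk_exp \<mu> n (\<lambda>h. if s \<circ> h = g then 1 else 0)"] ..
  also have "\<dots> = average \<mu> (heat \<mu> n) g"
    unfolding average_def translate_def heat_def by (intro sum.cong refl) (simp only: eq)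
  finally show "heat \<mu> (Suc n) g = average \<mu> (heat \<mu> n) g" .
qed

lemma average_mono:
  assumes "\<And>x. f x \<le> g x"
  shows "average \<mu> f x \<le> average \<mu> g x"
  unfolding average_def translate_def by (intro sum_mono mult_left_mono assms pmf_nonneg)

lemma average_cmult: "average \<mu> (\<lambda>x. c * f x) x = c * average \<mu> f x"
  unfolding average_def translate_def by (simp add: sum_distrib_left mult.left_commute)

text \<open>The walk itself need not contract the \<open>\<ell>\<^sup>2\<close> norm, because \<open>S\<^sup>-\<^sup>1S\<close> may generate an amenable
  subgroup; the lazy walk does.\<close>
lemma lazy_ge_heat:
  assumes "set_pmf \<mu> \<subseteq> carrier isom_group"
  shows "real (n choose j) / 2 ^ n * heat \<mu> j x \<le> (lazy \<mu> ^^ n) (heat \<mu> 0) x"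
proof (induction n arbitrary: j x)
  case 0
  show ?case by (cases j) (simp_all add: heat_0)
next
  case (Suc n)
  define F where "F = (lazy \<mu> ^^ n) (heat \<mu> 0)"
  have F: "real (n choose j) / 2 ^ n * heat \<mu> j x \<le> F x" for j x
    using Suc.IH by (simp add: F_def)
  have A: "(case j of 0 \<Rightarrow> 0 | Suc i \<Rightarrow> real (n choose i) / 2 ^ n * heat \<mu> j x) \<le> average \<mu> F x"
  proof (cases j)
    case 0
    have "0 \<le> F y" for y
      by (rule order_trans[OF _ F[of 0 y]]) (simp add: heat_nonneg)
    then have "average \<mu> (\<lambda>_. 0) x \<le> average \<mu> F x" by (rule average_mono)
    then show ?thesis using 0 by (simp add: average_def translate_def)
  next
    case (Suc i)
    have "average \<mu> (\<lambda>y. real (n choose i) / 2 ^ n * heat \<mu> i y) x \<le> average \<mu> F x"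
      by (rule average_mono) (rule F)
    then show ?thesis unfolding average_cmult heat_Suc[OF assms, symmetric] by (simp add: Suc)
  qed
  have lz: "(lazy \<mu> ^^ Suc n) (heat \<mu> 0) x = (F x + average \<mu> F x) / 2"
    by (simp add: F_def lazy_def)
  \<comment> \<open>Powers of \<open>(1 + average) / 2\<close> expand binomially; only the term of
    index \<open>j\<close> is kept, and Pascal's rule carries it from \<open>n\<close> to
    \<open>Suc n\<close>.\<close>
  have pascal: "real (Suc n choose j) / 2 ^ Suc n * heat \<mu> j x
      = (real (n choose j) / 2 ^ n * heat \<mu> j x
         + (case j of 0 \<Rightarrow> 0 | Suc i \<Rightarrow> real (n choose i) / 2 ^ n * heat \<mu> j x)) / 2"
    by (cases j) (simp_all add: field_simps)
  show ?case unfolding lz pascal by (intro divide_right_mono add_mono F A) simp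
qed

lemma square_sum_le:
  fixes w a :: "'b \<Rightarrow> real"
  assumes "finite I" "\<And>i. i \<in> I \<Longrightarrow> 0 \<le> w i" "sum w I = 1"
  shows "(\<Sum>i\<in>I. w i * a i)\<^sup>2 \<le> (\<Sum>i\<in>I. w i * (a i)\<^sup>2)"
proof -
  define m where "m = (\<Sum>i\<in>I. w i * a i)"
  have "0 \<le> (\<Sum>i\<in>I. w i * (a i - m)\<^sup>2)" using assms by (intro sum_nonneg) auto
  also have "\<dots> = (\<Sum>i\<in>I. w i * (a i)\<^sup>2) - 2 * m * (\<Sum>i\<in>I. w i * a i) + m\<^sup>2 * sum w I"
    unfolding sum_distrib_left sum.distrib[symmetric] sum_subtractf[symmetric]
    by (intro sum.cong refl) (simp add: power2_eq_square algebra_simps)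
  finally show ?thesis using assms(3) by (simp add: m_def[symmetric] power2_eq_square)
qed

lemma supp_lazy: "supp (lazy \<mu> f) \<subseteq> supp f \<union> (\<Union>s\<in>set_pmf \<mu>. supp (translate s f))"
proof
  fix x assume x: "x \<in> supp (lazy \<mu> f)"
  show "x \<in> supp f \<union> (\<Union>s\<in>set_pmf \<mu>. supp (translate s f))"
  proof (rule ccontr)
    assume "x \<notin> supp f \<union> (\<Union>s\<in>set_pmf \<mu>. supp (translate s f))"
    then have "f x = 0" "\<And>s. s \<in> set_pmf \<mu> \<Longrightarrow> translate s f x = 0" by (auto simp: supp_def)
    then have "lazy \<mu> f x = 0" by (simp add: lazy_def average_def)
    then show False using x by (simp add: supp_def)
  qed
qed

lemma finite_supp_lazy:
  assumes "finite (set_pmf \<mu>)" "set_pmf \<mu> \<subseteq> carrier isom_group" "finite (supp f)"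
  shows "finite (supp (lazy \<mu> f))"
proof (rule finite_subset[OF supp_lazy])
  have "finite (supp (translate s f))" if "s \<in> set_pmf \<mu>" for s
    using finite_supp_translate[OF _ assms(3)] assms(2) that by blast
  then show "finite (supp f \<union> (\<Union>s\<in>set_pmf \<mu>. supp (translate s f)))" using assms by blast
qed

text \<open>Parallelogram law for each generator: averaging \<open>f\<close> with an isometric copy
  loses a quarter of the squared displacement. Convexity of the square passes to the mean over
  \<mu>.\<close>

lemma l2norm_lazy:
  assumes fin: "finite (set_pmf \<mu>)" and iso: "set_pmf \<mu> \<subseteq> carrier isom_group" and f: "finite (supp f)"
  shows "(l2norm (lazy \<mu> f))\<^sup>2 \<le> (l2norm f)\<^sup>2 - (\<Sum>s\<in>set_pmf \<mu>. pmf \<mu> s * (displacement s f)\<^sup>2) / 4"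
proof -
  let ?S = "set_pmf \<mu>"
  define B where "B = supp f \<union> (\<Union>s\<in>?S. supp (translate s f))"
  have tr: "finite (supp (translate s f))" if "s \<in> ?S" for s
    using finite_supp_translate[OF _ f] iso that by blast
  have B: "finite B" unfolding B_def using fin f tr by blast
  have sq: "(l2norm k)\<^sup>2 = (\<Sum>x\<in>B. (k x)\<^sup>2)" if "supp k \<subseteq> B" for k
    using l2norm_superset[OF B that] by (simp add: L2_set_def sum_nonneg)
  have lz: "lazy \<mu> f x = (\<Sum>s\<in>?S. pmf \<mu> s * ((f x + translate s f x) / 2))" for x
  proof -
    have "(\<Sum>s\<in>?S. pmf \<mu> s * ((f x + translate s f x) / 2))
        = (\<Sum>s\<in>?S. pmf \<mu> s) * (f x / 2) + average \<mu> f x / 2"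
      unfolding average_def sum_distrib_right sum_divide_distrib sum.distrib[symmetric]
      by (intro sum.cong refl) (simp add: field_simps)
    then show ?thesis by (simp add: sum_pmf_set[OF fin] lazy_def add_divide_distrib)
  qed
  have sub: "supp (lazy \<mu> f) \<subseteq> B" "supp f \<subseteq> B" "\<And>s. s \<in> ?S \<Longrightarrow> supp (translate s f) \<subseteq> B"
      "\<And>s. s \<in> ?S \<Longrightarrow> supp (\<lambda>x. translate s f x - f x) \<subseteq> B"
    unfolding B_def by (rule supp_lazy, blast, blast, rule order_trans[OF supp_diff], blast)
  have "(l2norm (lazy \<mu> f))\<^sup>2 = (\<Sum>x\<in>B. (lazy \<mu> f x)\<^sup>2)" by (rule sq[OF sub(1)])
  also have "\<dots> \<le> (\<Sum>x\<in>B. \<Sum>s\<in>?S. pmf \<mu> s * ((f x + translate s f x) / 2)\<^sup>2)"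
    unfolding lz by (intro sum_mono square_sum_le fin pmf_nonneg sum_pmf_set)
  also have "\<dots> = (\<Sum>s\<in>?S. \<Sum>x\<in>B. pmf \<mu> s * ((f x + translate s f x) / 2)\<^sup>2)" by (rule sum.swap)
  also have "\<dots> = (\<Sum>s\<in>?S. pmf \<mu> s * ((l2norm f)\<^sup>2 - (displacement s f)\<^sup>2 / 4))"
  proof (intro sum.cong refl)
    fix s assume s: "s \<in> ?S"
    then have si: "isom s" using iso by blast
    have "(\<Sum>x\<in>B. ((f x + translate s f x) / 2)\<^sup>2)
        = (\<Sum>x\<in>B. (f x)\<^sup>2) / 2 + (\<Sum>x\<in>B. (translate s f x)\<^sup>2) / 2 - (\<Sum>x\<in>B. (translate s f x - f x)\<^sup>2) / 4"
      unfolding sum_divide_distrib sum.distrib[symmetric] sum_subtractf[symmetric]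
      by (intro sum.cong refl) (simp add: power2_eq_square field_simps)
    also have "\<dots> = (l2norm f)\<^sup>2 - (displacement s f)\<^sup>2 / 4"
      unfolding displacement_def sq[OF sub(2), symmetric] sq[OF sub(3)[OF s], symmetric]
        sq[OF sub(4)[OF s], symmetric] l2norm_translate[OF si] by simp
    finally show "(\<Sum>x\<in>B. pmf \<mu> s * ((f x + translate s f x) / 2)\<^sup>2)
      = pmf \<mu> s * ((l2norm f)\<^sup>2 - (displacement s f)\<^sup>2 / 4)"
      unfolding sum_distrib_left[symmetric] by simp
  qed
  also have "\<dots> = (\<Sum>s\<in>?S. pmf \<mu> s) * (l2norm f)\<^sup>2 - (\<Sum>s\<in>?S. pmf \<mu> s * (displacement s f)\<^sup>2) / 4"
    unfolding sum_distrib_right sum_divide_distrib sum_subtractf[symmetric]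
    by (intro sum.cong refl) (simp add: algebra_simps)
  finally show ?thesis by (simp add: sum_pmf_set[OF fin])
qed

context cocompact_action
begin

text \<open>Displacement is subadditive on words, so some generator displaces \<open>f\<close> by at
  least \<open>l2norm f / (6 * N)\<close>. With weight at least m and the quarter from the lazy
  step, a fraction \<open>m / (4 * 36 * N^2)\<close> of the squared norm is lost.\<close>

lemma heat_decay:
  assumes fin: "finite (set_pmf \<mu>)" and S: "set_pmf \<mu> \<subseteq> \<Gamma>" and N: "1 \<le> N"
    and triple: "a \<in> word_ball (set_pmf \<mu>) N" "b \<in> word_ball (set_pmf \<mu>) N" "c \<in> word_ball (set_pmf \<mu>) N"
      "separated_triple \<delta> q a b c"
    and m: "\<And>s. s \<in> set_pmf \<mu> \<Longrightarrow> m \<le> pmf \<mu> s" "0 \<le> m"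
  shows "heat \<mu> k x \<le> real (2 * k + 1) * exp (- (m / (144 * (real N)\<^sup>2)) * real k)"
proof -
  let ?S = "set_pmf \<mu>"
  have iso: "?S \<subseteq> carrier isom_group" using S \<Gamma>_isom by blast
  have abc: "isom a" "isom b" "isom c" using word_ball_isom[OF iso] triple by blast+
  define \<tau> where "\<tau> = m / (144 * (real N)\<^sup>2)"
  have \<tau>0: "0 \<le> \<tau>" using m(2) by (simp add: \<tau>_def)
  have step: "(l2norm (lazy \<mu> f))\<^sup>2 \<le> (1 - \<tau>) * (l2norm f)\<^sup>2" if f: "finite (supp f)" for f
  proof -
    define \<eta> where "\<eta> = Max ((\<lambda>s. displacement s f) ` ?S)"
    have ne: "?S \<noteq> {}" by (rule set_pmf_not_empty)
    have "\<eta> \<in> (\<lambda>s. displacement s f) ` ?S"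
      unfolding \<eta>_def using fin ne by (intro Max_in) auto
    then obtain s where s: "s \<in> ?S" "\<eta> = displacement s f" by blast
    have \<eta>_ge: "displacement t f \<le> \<eta>" if "t \<in> ?S" for t
      unfolding \<eta>_def using fin that by (intro Max_ge) auto
    have \<eta>0: "0 \<le> \<eta>" unfolding s(2) displacement_def by (rule l2norm_nonneg)
    have wb: "displacement g f \<le> real N * \<eta>" if "g \<in> word_ball ?S N" for g
      by (rule displacement_word_ball[OF iso f \<eta>0 _ that]) (rule \<eta>_ge)
    have "l2norm f \<le> 6 * (real N * \<eta>)"
      by (rule separated_triple_displacement[OF triple(4) abc f wb[OF triple(1)] wb[OF triple(2)] wb[OF triple(3)]])
    then have "(l2norm f)\<^sup>2 \<le> (6 * (real N * \<eta>))\<^sup>2"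
      by (intro power_mono l2norm_nonneg)
    then have "\<tau> * (l2norm f)\<^sup>2 \<le> \<tau> * (36 * (real N)\<^sup>2 * \<eta>\<^sup>2)"
      using \<tau>0 by (intro mult_left_mono) (simp_all add: power_mult_distrib)
    also have "\<dots> = m * \<eta>\<^sup>2 / 4" using N by (simp add: \<tau>_def)
    also have "\<dots> \<le> pmf \<mu> s * (displacement s f)\<^sup>2 / 4"
      unfolding s(2) using m(1)[OF s(1)] by (intro divide_right_mono mult_right_mono) auto
    also have "\<dots> \<le> (\<Sum>s\<in>?S. pmf \<mu> s * (displacement s f)\<^sup>2) / 4"
      using s(1) fin by (intro divide_right_mono member_le_sum) auto
    finally show ?thesis using l2norm_lazy[OF fin iso f] by (simp add: algebra_simps)
  qed
  have \<tau>1: "\<tau> \<le> 1"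
  proof -
    obtain s where "s \<in> ?S" using set_pmf_not_empty[of \<mu>] by blast
    then have "m \<le> 1" using m(1) pmf_le_1[of \<mu> s] order_trans by blast
    moreover have "1 \<le> (real N)\<^sup>2" using N by simp
    ultimately show ?thesis unfolding \<tau>_def by (simp add: divide_le_eq)
  qed
  have norms: "finite (supp ((lazy \<mu> ^^ n) (heat \<mu> 0))) \<and> (l2norm ((lazy \<mu> ^^ n) (heat \<mu> 0)))\<^sup>2 \<le> (1 - \<tau>) ^ n" for n
  proof (induction n)
    case 0
    have "supp (heat \<mu> 0) = {id}" unfolding supp_def heat_0 by auto
    then show ?case by (simp add: l2norm_def L2_set_def heat_0)
  next
    case (Suc n)
    let ?f = "(lazy \<mu> ^^ n) (heat \<mu> 0)"
    have "(l2norm (lazy \<mu> ?f))\<^sup>2 \<le> (1 - \<tau>) * (l2norm ?f)\<^sup>2" using Suc step by blast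
    also have "\<dots> \<le> (1 - \<tau>) * (1 - \<tau>) ^ n" using Suc \<tau>1 by (intro mult_left_mono) auto
    finally show ?case using Suc finite_supp_lazy[OF fin iso] by simp
  qed
  have pow: "(1 - \<tau>) ^ k \<le> exp (- \<tau> * real k)"
  proof -
    have "(1 - \<tau>) ^ k \<le> exp (- \<tau>) ^ k" using exp_ge_add_one_self[of "- \<tau>"] \<tau>1 by (intro power_mono) auto
    then show ?thesis by (simp add: exp_of_nat_mult[symmetric] mult.commute)
  qed
  \<comment> \<open>After \<open>2 * k\<close> lazy steps the coefficient of
    \<open>heat \<mu> k\<close> is the central binomial one, at least \<open>1 / (2 * k + 1)\<close>
    once divided by \<open>4 ^ k\<close>, so the comparison costs only a linear factor.\<close>
  let ?F = "(lazy \<mu> ^^ (2 * k)) (heat \<mu> 0)"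
  have "?F x \<le> l2norm ?F" by (rule abs_le_l2norm[OF conjunct1[OF norms]])
  also have "\<dots> \<le> (1 - \<tau>) ^ k"
  proof (rule power2_le_imp_le)
    have "((1 - \<tau>) ^ k)\<^sup>2 = (1 - \<tau>) ^ (2 * k)" by (simp add: power_mult[symmetric] mult.commute)
    then show "(l2norm ?F)\<^sup>2 \<le> ((1 - \<tau>) ^ k)\<^sup>2" using norms[of "2 * k"] by simp
  qed (use \<tau>1 in simp)
  finally have F: "?F x \<le> exp (- \<tau> * real k)" using pow by linarith
  have binom: "1 \<le> real (2 * k + 1) * (real (2 * k choose k) / 2 ^ (2 * k))"
  proof (cases "k = 0")
    case False
    then have "4 ^ k / (2 * real k) \<le> real (2 * k choose k)" by (intro central_binomial_lower_bound) simp
    then have "4 ^ k \<le> (2 * real k) * real (2 * k choose k)" using False by (simp add: field_simps)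
    also have "\<dots> \<le> real (2 * k + 1) * real (2 * k choose k)" by (intro mult_right_mono) auto
    finally show ?thesis by (simp add: power_mult)
  qed simp
  have "heat \<mu> k x \<le> real (2 * k + 1) * (real (2 * k choose k) / 2 ^ (2 * k)) * heat \<mu> k x"
    using mult_right_mono[OF binom heat_nonneg[of \<mu> k x]] by simp
  also have "\<dots> \<le> real (2 * k + 1) * ?F x"
    unfolding mult.assoc using lazy_ge_heat[OF iso, of "2 * k" k x] by (intro mult_left_mono) auto
  also have "\<dots> \<le> real (2 * k + 1) * exp (- \<tau> * real k)"
    using F by (intro mult_left_mono) auto
  finally show ?thesis unfolding \<tau>_def .
qed

end

section \<open>Paths passing near a point\<close>

context hyperbolic_metric
begin

text \<open>Halving the chain loses one \<delta> per level, so \<open>2 ^ j\<close> steps cost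
  \<open>j * \<delta>\<close> instead of one \<delta> each.\<close>

lemma gp_chain_dyadic:
  fixes z :: "nat \<Rightarrow> 'a"
  assumes "1 \<le> l" "l \<le> 2 ^ j" "\<And>k. i \<le> k \<Longrightarrow> k < i + l \<Longrightarrow> B + real j * \<delta> < gp y (z k) (z (Suc k))"
  shows "B < gp y (z i) (z (i + l))"
  using assms
proof (induction j arbitrary: i l B)
  case 0
  then have "l = 1" by simp
  then show ?case using 0(3)[of i] by simp
next
  case (Suc j)
  have \<delta>: "real (Suc j) * \<delta> = real j * \<delta> + \<delta>" by (simp add: algebra_simps)
  show ?case
  proof (cases "l \<le> 2 ^ j")
    case True
    have "B + real j * \<delta> < gp y (z k) (z (Suc k))" if "i \<le> k" "k < i + l" for k
      using Suc.prems(3)[OF that] delta_ge unfolding \<delta> by linarith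
    then show ?thesis by (rule Suc.IH[OF Suc.prems(1) True])
  next
    case False
    define l' where "l' = l - 2 ^ j"
    have l: "l = 2 ^ j + l'" "1 \<le> l'" "l' \<le> 2 ^ j" using False Suc.prems(2) by (auto simp: l'_def)
    have le: "B + \<delta> + real j * \<delta> < gp y (z k) (z (Suc k))" if "i \<le> k" "k < i + l" for k
      using Suc.prems(3)[OF that] unfolding \<delta> by linarith
    have "B + \<delta> < gp y (z i) (z (i + 2 ^ j))"
      by (rule Suc.IH) (use le l in auto)
    moreover have "B + \<delta> < gp y (z (i + 2 ^ j)) (z (i + 2 ^ j + l'))"
      by (rule Suc.IH) (use le l in auto)
    ultimately show ?thesis
      using hyp[of y "z i" "z (i + 2 ^ j)" "z (i + l)"] unfolding l(1) add.assoc by linarith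
  qed
qed

text \<open>Splitting the path at the times \<open>2\<^sup>j - 1\<close> makes the loss at step \<open>k\<close> depend on \<open>k\<close> only, not on
  the total length.\<close>
lemma gp_chain_log:
  fixes z :: "nat \<Rightarrow> 'a"
  assumes "2 ^ j - 1 < n"
    and "\<And>k. 2 ^ j - 1 \<le> k \<Longrightarrow> k < n \<Longrightarrow> B + \<delta> * (2 * log 2 (real k + 1) + 1 - real j) < gp y (z k) (z (Suc k))"
  shows "B < gp y (z (2 ^ j - 1)) (z n)"
  using assms
proof (induction "n - (2 ^ j - 1)" arbitrary: j B rule: less_induct)
  case less
  let ?i = "(2::nat) ^ j - 1"
  have log: "real j \<le> log 2 (real k + 1)" if "?i \<le> k" for k
  proof -
    have "(2::nat) ^ j \<le> k + 1" using that by simp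
    then have "real (2 ^ j) \<le> real (k + 1)" by (rule of_nat_mono)
    then show ?thesis by (simp add: le_log_iff powr_realpow add.commute)
  qed
  \<comment> \<open>One logarithm pays for the binary splitting inside a block; the other offsets
    \<open>- real j\<close>, the number of blocks already split off.\<close>
  have block: "B + \<delta> + real j * \<delta> < gp y (z k) (z (Suc k))" if "?i \<le> k" "k < n" for k
  proof -
    have "\<delta> * (1 + real j) \<le> \<delta> * (2 * log 2 (real k + 1) + 1 - real j)"
      using log[OF that(1)] delta_ge by (intro mult_left_mono) auto
    then show ?thesis using less.prems(2)[OF that] by (simp add: algebra_simps)
  qed
  have two: "(2::nat) ^ Suc j - 1 = ?i + 2 ^ j" by simp
  show ?case
  proof (cases "n \<le> 2 ^ Suc j - 1")
    case True
    have "B + \<delta> < gp y (z ?i) (z (?i + (n - ?i)))"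
      by (rule gp_chain_dyadic[of _ j]) (use True less.prems(1) two block in auto)
    then show ?thesis using less.prems(1) delta_ge by simp
  next
    case False
    have "B + \<delta> < gp y (z ?i) (z (?i + 2 ^ j))"
      by (rule gp_chain_dyadic[of _ j]) (use False two block in auto)
    moreover have "B + \<delta> < gp y (z (2 ^ Suc j - 1)) (z n)"
    proof (rule less.hyps)
      show "n - (2 ^ Suc j - 1) < n - (2 ^ j - 1)" using False two less.prems(1) by simp
      show "2 ^ Suc j - 1 < n" using False by simp
      fix k assume k: "2 ^ Suc j - 1 \<le> k" "k < n"
      have "?i \<le> k" using k two by simp
      \<comment> \<open>Passing to \<open>Suc j\<close> raises B by \<delta> and lowers the bracket
        by 1, so the hypothesis on the steps is unchanged.\<close>
      have "B + \<delta> + \<delta> * (2 * log 2 (real k + 1) + 1 - real (Suc j))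
        = B + \<delta> * (2 * log 2 (real k + 1) + 1 - real j)" by (simp add: algebra_simps)
      then show "B + \<delta> + \<delta> * (2 * log 2 (real k + 1) + 1 - real (Suc j)) < gp y (z k) (z (Suc k))"
        using less.prems(2)[OF \<open>?i \<le> k\<close> k(2)] by linarith
    qed
    ultimately show ?thesis using hyp[of y "z ?i" "z (?i + 2 ^ j)" "z n"] unfolding two by linarith
  qed
qed

text \<open>The bound in \<open>gp_chain_log\<close> for \<open>j = 0\<close> and
  \<open>B = \<delta>\<close>.\<close>

definition chain_radius :: "nat \<Rightarrow> real" where
  "chain_radius k = \<delta> * (2 * log 2 (real k + 1) + 2)"

lemma chain_radius_nonneg: "0 \<le> chain_radius k"
  unfolding chain_radius_def using delta_ge by (intro mult_nonneg_nonneg add_nonneg_nonneg) auto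

lemma chain_radius_le: "chain_radius k \<le> 2 * \<delta> * (real k + 1)"
proof -
  have "log 2 (real k + 1) \<le> real k"
  proof -
    have "k + 1 \<le> 2 ^ k" unfolding Suc_eq_plus1[symmetric] by (rule Suc_leI[OF less_exp])
    then have "real (k + 1) \<le> real (2 ^ k)" by (rule of_nat_mono)
    then show ?thesis by (simp add: log_le_iff powr_realpow add.commute)
  qed
  then have "\<delta> * (2 * log 2 (real k + 1) + 2) \<le> \<delta> * (2 * real k + 2)"
    using delta_ge by (intro mult_left_mono) auto
  then show ?thesis by (simp add: chain_radius_def algebra_simps)
qed

text \<open>Seen from \<open>y\<close>, on the way from \<open>p\<close> to \<open>x\<close>, the
  path ends in a direction away from its start, which is impossible if all its steps have large
  products at \<open>y\<close>. The last inequality holds because steps of length K need that long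
  to come near \<open>y\<close>.\<close>

lemma path_near_point:
  fixes z :: "nat \<Rightarrow> 'a"
  assumes z0: "z 0 = p" and steps: "\<And>k. k < n \<Longrightarrow> dist (z k) (z (Suc k)) \<le> K"
    and \<rho>: "0 < \<rho>" "\<rho> \<le> gp p x (z n)" and y: "dist p y = \<rho>" "dist y x = dist p x - \<rho>"
  shows "\<exists>k<n. gp y (z k) (z (Suc k)) \<le> chain_radius k \<and> \<rho> \<le> (real k + 1) * (K + 2 * \<delta>)"
proof -
  have n: "0 < n"
  proof (rule ccontr)
    assume "\<not> 0 < n"
    then show False using z0 \<rho> by simp
  qed
  have "gp p y x = \<rho>" using y by (simp add: gromov_product_def dist_commute)
  then have "\<rho> - \<delta> \<le> gp p y (z n)" using hyp[of p y x "z n"] \<rho>(2) by linarith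
  moreover have "gp y p (z n) = \<rho> - gp p y (z n)" using gp_swap[of y p "z n"] y(1) by simp
  ultimately have small: "gp y (z 0) (z n) \<le> \<delta>" unfolding z0 by linarith
  have "\<exists>k<n. gp y (z k) (z (Suc k)) \<le> chain_radius k"
  proof (rule ccontr)
    assume "\<not> ?thesis"
    then have far: "chain_radius k < gp y (z k) (z (Suc k))" if "k < n" for k using that not_le by blast
    have "\<delta> < gp y (z (2 ^ 0 - 1)) (z n)"
    proof (rule gp_chain_log)
      fix k assume "k < n"
      have "\<delta> + \<delta> * (2 * log 2 (real k + 1) + 1 - real 0) = chain_radius k"
        by (simp add: chain_radius_def algebra_simps)
      then show "\<delta> + \<delta> * (2 * log 2 (real k + 1) + 1 - real 0) < gp y (z k) (z (Suc k))"
        using far[OF \<open>k < n\<close>] by linarith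
    qed (use n in simp)
    then show False using small by simp
  qed
  then obtain k where k: "k < n" "gp y (z k) (z (Suc k)) \<le> chain_radius k" by blast
  have zk: "dist p (z k) \<le> real k * K" if "k \<le> n" for k
    using that
  proof (induction k)
    case (Suc k)
    then show ?case using dist_triangle[of p "z (Suc k)" "z k"] steps[of k] by (simp add: algebra_simps)
  qed (simp add: z0)
  have "\<rho> \<le> dist p (z k) + dist (z k) y" using dist_triangle[of p y "z k"] y(1) by simp
  also have "dist (z k) y \<le> chain_radius k + K"
    using gp_ge[of "z k" y "z (Suc k)"] k(2) steps[OF k(1)] by linarith
  also have "dist p (z k) + (chain_radius k + K) \<le> (real k + 1) * (K + 2 * \<delta>)"
    using zk[of k] k(1) chain_radius_le[of k] by (simp add: algebra_simps)
  finally show ?thesis using k by (intro exI[of _ k]) auto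
qed

end

section \<open>Orbit growth and the number of crossings\<close>

context cocompact_action
begin

lemma D_nonneg: "0 \<le> D"
  using cobounded[of p] zero_le_dist order_trans by blast

lemma vol_mono: "r \<le> r' \<Longrightarrow> vol r \<le> vol r'"
  unfolding vol_def by (intro card_mono finite_displacement) auto

text \<open>Go back by \<open>D + 1\<close> on a geodesic towards \<open>p\<close> and correct to
  the orbit by D: this reaches displacement at most \<open>r\<close>, at distance at most
  \<open>2 * D + 1\<close> from the old orbit point.\<close>

lemma vol_step: "vol (r + 1) \<le> vol r * vol (2 * D + 1)" if r: "D \<le> r"
proof -
  let ?F = "{g \<in> \<Gamma>. dist (g p) p \<le> 2 * D + 1}" and ?A = "{g \<in> \<Gamma>. dist (g p) p \<le> r}"
  have "{g \<in> \<Gamma>. dist (g p) p \<le> r + 1} \<subseteq> (\<lambda>(a, b). a \<circ> b) ` (?A \<times> ?F)"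
  proof
    fix g assume "g \<in> {g \<in> \<Gamma>. dist (g p) p \<le> r + 1}"
    then have g: "g \<in> \<Gamma>" "dist (g p) p \<le> r + 1" by auto
    have "\<exists>a\<in>?A. dist (a p) (g p) \<le> 2 * D + 1"
    proof (cases "dist (g p) p \<le> D + 1")
      case True
      have "id \<in> ?A" using \<Gamma>_id r D_nonneg by simp
      then show ?thesis using True D_nonneg by (intro bexI[of _ id]) (auto simp: dist_commute)
    next
      case False
      then obtain y where y: "dist (g p) y = D + 1" "dist y p = dist (g p) p - (D + 1)"
        using geodesic_point[OF geodesic, of "D + 1" "g p" p] D_nonneg by auto
      obtain a where a: "a \<in> \<Gamma>" "dist y (a p) \<le> D" using cobounded by blast
      have "dist (a p) p \<le> r"
        using dist_triangle[of "a p" p y] a y g by (simp add: dist_commute)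
      moreover have "dist (a p) (g p) \<le> 2 * D + 1"
        using dist_triangle[of "a p" "g p" y] a y by (simp add: dist_commute)
      ultimately show ?thesis using a by blast
    qed
    then obtain a where a: "a \<in> ?A" "dist (a p) (g p) \<le> 2 * D + 1" by blast
    have ai: "isom a" using a \<Gamma>_isom by blast
    have "dist ((finv a \<circ> g) p) p \<le> 2 * D + 1"
      unfolding comp_apply isom_dist_inv[OF ai] dist_commute[of "g p"] by (rule a(2))
    moreover have "finv a \<circ> g \<in> \<Gamma>" using a g by (intro \<Gamma>_comp \<Gamma>_inv) auto
    ultimately have "finv a \<circ> g \<in> ?F" by (simp only: mem_Collect_eq)
    moreover have "g = a \<circ> (finv a \<circ> g)" by (simp only: isom_comp_left_cancel[OF ai])
    ultimately show "g \<in> (\<lambda>(a, b). a \<circ> b) ` (?A \<times> ?F)"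
      using a(1) by (intro rev_image_eqI[of "(a, finv a \<circ> g)"]) (simp_all only: mem_Sigma_iff prod.case)
  qed
  then have "vol (r + 1) \<le> card ((\<lambda>(a, b). a \<circ> b) ` (?A \<times> ?F))"
    unfolding vol_def by (intro card_mono finite_imageI finite_cartesian_product finite_displacement)
  also have "\<dots> \<le> card (?A \<times> ?F)"
    by (intro card_image_le finite_cartesian_product finite_displacement)
  finally show ?thesis by (simp add: vol_def card_cartesian_product)
qed

lemma vol_le_exp: "\<exists>v\<ge>0. \<forall>r\<ge>0. real (vol r) \<le> exp (v * (r + 2))"
proof -
  define M where "M = vol (2 * D + 1)"
  have "id \<in> {g \<in> \<Gamma>. dist (g p) p \<le> 2 * D + 1}" using \<Gamma>_id D_nonneg by simp
  then have M: "1 \<le> M"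
    unfolding M_def vol_def One_nat_def Suc_le_eq card_gt_0_iff using finite_displacement by blast
  have le: "vol (D + real k) \<le> M ^ (k + 1)" for k
  proof (induction k)
    case 0
    then show ?case unfolding M_def using D_nonneg by (simp add: vol_mono)
  next
    case (Suc k)
    have "vol (D + real k + 1) \<le> vol (D + real k) * M" unfolding M_def by (rule vol_step) simp
    also have "\<dots> \<le> M ^ (k + 1) * M" using Suc by (rule mult_right_mono) simp
    finally show ?case by (simp add: algebra_simps)
  qed
  have "real (vol r) \<le> exp (ln (real M) * (r + 2))" if r: "0 \<le> r" for r
  proof -
    define k where "k = nat \<lceil>r\<rceil>"
    have k: "r \<le> real k" "real k \<le> r + 1" using r unfolding k_def by linarith+
    have "vol r \<le> vol (D + real k)" using k D_nonneg by (intro vol_mono) simp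
    then have "real (vol r) \<le> real (M ^ (k + 1))" using le[of k] by (intro of_nat_mono) simp
    also have "\<dots> = exp (ln (real M) * (real k + 1))"
    proof -
      have "exp (ln (real M) * (real k + 1)) = exp (real (k + 1) * ln (real M))"
        by (simp add: mult.commute add.commute)
      then show ?thesis using M unfolding exp_of_nat_mult by simp
    qed
    also have "\<dots> \<le> exp (ln (real M) * (r + 2))"
      using M k by (simp add: mult_left_mono)
    finally show ?thesis .
  qed
  then show ?thesis using M by (intro exI[of _ "ln (real M)"]) auto
qed

text \<open>At most \<open>K + e + 1\<close> unit shells around \<open>y\<close>; in each, the
  elements are counted by \<open>card_displaced\<close> at the radius that
  \<open>dist_le_of_between\<close> gives for tolerance 1.\<close>

abbreviation crossings :: "real \<Rightarrow> real \<Rightarrow> real" where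
  "crossings K e \<equiv> (K + e + 1) * real (vol (1 + 2 * e + 2 * \<delta> + 2 * D))"

text \<open>Elements are sorted by the integer part of \<open>dist (g p) y\<close>. Within a shell
  the points \<open>finv g y\<close> lie near a geodesic from \<open>p\<close> to
  \<open>s p\<close>, at nearly the same distance from \<open>p\<close>, hence near each other; so
  \<open>h \<circ> finv g\<close> displaces \<open>y\<close> little. Only the number of shells
  involves K, which keeps the count linear in it.\<close>

lemma card_crossing:
  fixes y :: 'a
  assumes s: "dist (s p) p \<le> K" and e: "0 \<le> e"
  defines "A \<equiv> {g \<in> \<Gamma>. gp y (g p) (g (s p)) \<le> e}"
  shows "finite A" "real (card A) \<le> crossings K e"
proof -
  define r where "r = 1 + 2 * e + 2 * \<delta>"
  define n where "n = nat \<lfloor>K + e\<rfloor>"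
  define A' where "A' i = {g \<in> A. real i \<le> dist (g p) y \<and> dist (g p) y < real i + 1}" for i
  have K0: "0 \<le> K" using s zero_le_dist order_trans by blast
  have "A \<subseteq> (\<Union>i\<in>{..n}. A' i)"
  proof
    fix g assume g: "g \<in> A"
    then have gi: "isom g" unfolding A_def using \<Gamma>_isom by blast
    have "dist (g p) (g (s p)) \<le> K" using s gi by (simp add: isom_dist dist_commute)
    then have d: "dist (g p) y \<le> K + e"
      using g gp_ge[of "g p" y "g (s p)"] unfolding A_def by auto
    have "nat \<lfloor>dist (g p) y\<rfloor> \<le> n" unfolding n_def using d by (intro nat_mono floor_mono)
    moreover have "g \<in> A' (nat \<lfloor>dist (g p) y\<rfloor>)" unfolding A'_def using g by simp
    ultimately show "g \<in> (\<Union>i\<in>{..n}. A' i)" by blast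
  qed
  moreover have fibre: "finite (A' i) \<and> card (A' i) \<le> vol (r + 2 * D)" for i
  proof (cases "A' i = {}")
    case False
    then obtain h where h: "h \<in> A' i" by blast
    have h\<Gamma>: "h \<in> \<Gamma>" and hi: "isom h" using h \<Gamma>_isom unfolding A'_def A_def by auto
    let ?\<phi> = "\<lambda>g. h \<circ> finv g"
    have sub: "?\<phi> ` A' i \<subseteq> {f \<in> \<Gamma>. dist (f y) y \<le> r}"
    proof (rule image_subsetI)
      fix g assume g: "g \<in> A' i"
      have g\<Gamma>: "g \<in> \<Gamma>" and gi: "isom g" using g \<Gamma>_isom unfolding A'_def A_def by auto
      have "dist p (finv g y) = dist (g p) y" "dist p (finv h y) = dist (h p) y"
        using isom_dist_inv[OF gi, of y p] isom_dist_inv[OF hi, of y p] by (simp_all add: dist_commute)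
      then have "\<bar>dist p (finv g y) - dist p (finv h y)\<bar> \<le> 1"
        using g h unfolding A'_def by auto
      moreover have "gp (finv g y) p (s p) \<le> e" "gp (finv h y) p (s p) \<le> e"
        using g h unfolding isom_gp_inv[OF gi] isom_gp_inv[OF hi] A'_def A_def by auto
      ultimately have "dist (finv g y) (finv h y) \<le> r"
        using dist_le_of_between[of "finv g y" p "s p" e "finv h y" 1] by (simp add: r_def)
      then have "dist (h (finv g y)) y \<le> r"
        using isom_dist[OF hi, of "finv g y" "finv h y"] hi by simp
      moreover have "h \<circ> finv g \<in> \<Gamma>" by (intro \<Gamma>_comp \<Gamma>_inv h\<Gamma> g\<Gamma>)
      ultimately show "h \<circ> finv g \<in> {f \<in> \<Gamma>. dist (f y) y \<le> r}"
        by (simp only: mem_Collect_eq comp_apply)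
    qed
    have inj: "inj_on ?\<phi> (A' i)"
    proof (rule inj_onI)
      fix a b assume ab: "a \<in> A' i" "b \<in> A' i" "?\<phi> a = ?\<phi> b"
      have abi: "isom a" "isom b" using ab \<Gamma>_isom unfolding A'_def A_def by auto
      have "finv h \<circ> (h \<circ> finv a) = finv h \<circ> (h \<circ> finv b)" by (rule arg_cong[OF ab(3)])
      then have "finv a = finv b" by (simp only: isom_comp_left_cancel[OF hi])
      then have "finv (finv a) = finv (finv b)" by (rule arg_cong)
      then show "a = b" unfolding isom_inv_inv[OF abi(1)] isom_inv_inv[OF abi(2)] .
    qed
    have "finite (A' i)"
      by (rule finite_imageD[OF finite_subset[OF sub card_displaced(1)] inj])
    moreover have "card (A' i) \<le> card {f \<in> \<Gamma>. dist (f y) y \<le> r}"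
      by (rule card_inj_on_le[OF inj sub card_displaced(1)])
    ultimately show ?thesis using card_displaced(2)[of y r] by linarith
  qed simp
  ultimately show finA: "finite A" by (meson finite_UN_I finite_atMost finite_subset)
  have "card A \<le> card (\<Union>i\<in>{..n}. A' i)"
    using \<open>A \<subseteq> _\<close> fibre by (intro card_mono finite_UN_I) auto
  also have "\<dots> \<le> (\<Sum>i\<in>{..n}. card (A' i))" by (rule card_UN_le) simp
  also have "\<dots> \<le> (\<Sum>i\<in>{..n}. vol (r + 2 * D))" using fibre by (intro sum_mono) auto
  also have "\<dots> = (n + 1) * vol (r + 2 * D)" by simp
  finally have "real (card A) \<le> real ((n + 1) * vol (r + 2 * D))" by (rule of_nat_mono)
  also have "\<dots> = (real n + 1) * real (vol (r + 2 * D))" by (simp add: algebra_simps)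
  also have "\<dots> \<le> (K + e + 1) * real (vol (r + 2 * D))"
    using K0 e unfolding n_def by (intro mult_right_mono) auto
  finally show "real (card A) \<le> crossings K e"
    by (simp add: r_def)
qed

end

section \<open>The expected Gromov product with a fixed point\<close>

lemma power_le_fact_exp:
  fixes x :: real
  assumes "0 \<le> x"
  shows "x ^ d \<le> fact d * exp x"
proof -
  have "x ^ d / fact d \<le> (\<Sum>n. x ^ n / fact n)"
    using summable_exp[of x] assms
    by (intro order_trans[OF _ sum_le_suminf[of _ "{d}"]]) (auto simp: divide_inverse mult.commute)
  also have "\<dots> = exp x" by (simp add: exp_def divide_inverse mult.commute scaleR_conv_of_real)
  finally show ?thesis by (simp add: field_simps)
qed

lemma sum_power_tail_le:
  fixes \<rho> :: real
  assumes "0 \<le> \<rho>" "\<rho> < 1"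
  shows "(\<Sum>k\<in>{m..<n}. \<rho> ^ k) \<le> \<rho> ^ m / (1 - \<rho>)"
proof (cases "m \<le> n")
  case True
  then have "(1 - \<rho>) * (\<Sum>k\<in>{m..<n}. \<rho> ^ k) = \<rho> ^ m - \<rho> ^ n"
  proof (induction n rule: dec_induct)
    case (step n)
    have "(1 - \<rho>) * (\<Sum>k\<in>{m..<Suc n}. \<rho> ^ k) = (1 - \<rho>) * (\<Sum>k\<in>{m..<n}. \<rho> ^ k) + (1 - \<rho>) * \<rho> ^ n"
      using step(1) by (simp add: distrib_left)
    then show ?case unfolding step.IH by (simp add: algebra_simps)
  qed simp
  then show ?thesis using assms by (simp add: pos_le_divide_eq mult.commute)
next
  case False
  then show ?thesis using assms by simp
qed

lemma exp_minus_le: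
  fixes x :: real
  assumes "0 \<le> x" "x \<le> 1"
  shows "exp (- x) \<le> 1 - x / 2"
proof -
  have "exp (- x) \<le> 1 / (1 + x)"
    using exp_ge_add_one_self[of x] assms by (simp add: exp_minus field_simps)
  also have "\<dots> \<le> 1 - x / 2"
  proof -
    have "x * x \<le> x * 1" using assms by (intro mult_left_mono) auto
    then have "1 \<le> (1 - x / 2) * (1 + x)" by (simp add: algebra_simps)
    then show ?thesis using assms by (simp add: pos_divide_le_eq)
  qed
  finally show ?thesis .
qed

context cocompact_action
begin

lemma walk_\<Gamma>:
  assumes "S \<subseteq> \<Gamma>" "\<And>i. X i \<in> insert id S"
  shows "walk n X \<in> \<Gamma>"
proof (induction n)
  case 0
  show ?case unfolding walk.simps by (rule \<Gamma>_id)
next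
  case (Suc n)
  have "insert id S \<subseteq> \<Gamma>" unfolding insert_subset using \<Gamma>_id assms(1) by (rule conjI)
  then have "X (Suc n) \<in> \<Gamma>" using assms(2)[of "Suc n"] by (rule subsetD)
  then show ?case unfolding walk.simps by (rule \<Gamma>_comp[OF Suc])
qed

text \<open>The crossing positions depend on the step taken, so a union bound over them is made for
  each value of that step and then averaged.\<close>

lemma crossing_probability:
  fixes y :: 'a
  assumes fin: "finite (set_pmf \<mu>)" and S: "set_pmf \<mu> \<subseteq> \<Gamma>"
    and K: "\<And>s. s \<in> set_pmf \<mu> \<Longrightarrow> dist (s p) p \<le> K" and e: "0 \<le> e"
    and heat: "\<And>g. heat \<mu> k g \<le> h"
  shows "path_exp \<mu> (Suc k) (\<lambda>X. if gp y (walk k X p) (walk (Suc k) X p) \<le> e then 1 else 0)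
    \<le> crossings K e * h"
proof -
  let ?S = "set_pmf \<mu>" and ?b = "crossings K e * h"
  define A where "A s = {g \<in> \<Gamma>. gp y (g p) (g (s p)) \<le> e}" for s
  have h0: "0 \<le> h" using heat heat_nonneg order_trans by blast
  have step: "path_exp \<mu> k (\<lambda>X. if gp y (walk k X p) (walk k X (s p)) \<le> e then 1 else 0) \<le> ?b"
    if s: "s \<in> ?S" for s
  proof -
    note A = card_crossing[where s = s and K = K and y = y, OF K[OF s] e, folded A_def]
    have "path_exp \<mu> k (\<lambda>X. if gp y (walk k X p) (walk k X (s p)) \<le> e then 1 else 0)
        \<le> path_exp \<mu> k (\<lambda>X. \<Sum>g\<in>A s. if walk k X = g then 1 else 0)"
    proof (rule path_exp_mono)
      fix X :: "nat \<Rightarrow> 'a \<Rightarrow> 'a" assume X: "\<And>i. X i \<in> insert id ?S"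
      have nn: "(0::real) \<le> (\<Sum>g\<in>A s. if walk k X = g then 1 else 0)" by (intro sum_nonneg) simp
      show "(if gp y (walk k X p) (walk k X (s p)) \<le> e then 1 else 0)
          \<le> (\<Sum>g\<in>A s. if walk k X = g then 1 else (0::real))"
      proof (cases "gp y (walk k X p) (walk k X (s p)) \<le> e")
        case True
        then have w: "walk k X \<in> A s" unfolding A_def using walk_\<Gamma>[of "set_pmf \<mu>" X, OF S X] by blast
        have "(\<Sum>g\<in>A s. if walk k X = g then 1 else (0::real)) = 1"
          unfolding sum.delta'[OF A(1)] using w by (rule if_P)
        then show ?thesis using True by (simp only: if_True order_refl)
      next
        case False
        then show ?thesis using nn by (simp only: if_False)
      qed
    qed
    also have "\<dots> = (\<Sum>g\<in>A s. heat \<mu> k g)" unfolding path_exp_sum[OF A(1)] heat_def ..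
    also have "\<dots> \<le> (\<Sum>g\<in>A s. h)" by (intro sum_mono heat)
    also have "\<dots> = real (card (A s)) * h" by simp
    also have "\<dots> \<le> ?b" using A(2) h0 by (intro mult_right_mono)
    finally show ?thesis .
  qed
  have "path_exp \<mu> (Suc k) (\<lambda>X. if gp y (walk k X p) (walk (Suc k) X p) \<le> e then 1 else 0)
      = (\<Sum>s\<in>?S. pmf \<mu> s * path_exp \<mu> k (\<lambda>X. if gp y (walk k X p) (walk k X (s p)) \<le> e then 1 else 0))"
    by (simp only: path_exp.simps walk.simps walk_upd[OF order_refl] fun_upd_same comp_apply)
  also have "\<dots> \<le> (\<Sum>s\<in>?S. pmf \<mu> s * ?b)" by (intro sum_mono mult_left_mono step pmf_nonneg)
  also have "\<dots> = ?b" unfolding sum_distrib_right[symmetric] sum_pmf_set[OF fin] by simp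
  finally show ?thesis .
qed

text \<open>Marks \<open>Y i\<close> are placed every \<open>w = K + 2 * \<delta>\<close> on the way
  from \<open>p\<close> to \<open>x\<close>, and the product is at most \<open>w\<close> times one
  plus the number of marks reached. The first T marks are counted outright, later ones by expected
  crossings. With this spacing the time bound of \<open>path_near_point\<close> reads
  \<open>i \<le> k\<close>.\<close>

lemma walk_exp_gp_le_sum:
  fixes x :: 'a
  assumes fin: "finite (set_pmf \<mu>)" and S: "set_pmf \<mu> \<subseteq> \<Gamma>"
    and K: "0 \<le> K" "\<And>s. s \<in> set_pmf \<mu> \<Longrightarrow> dist (s p) p \<le> K"
    and heat: "\<And>k g. heat \<mu> k g \<le> h k"
  shows "walk_exp \<mu> n (\<lambda>g. gp p x (g p)) \<le> (K + 2 * \<delta>) * (real T + 1 + (\<Sum>i\<in>{T..<n}. \<Sum>k\<in>{i..<n}.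
    crossings K (chain_radius k) * h k))"
proof -
  define w where "w = K + 2 * \<delta>"
  have w: "0 < w" using K(1) delta_ge by (simp add: w_def)
  \<comment> \<open>The implication allows one choice function for all \<open>i\<close>, including
    marks that would lie beyond \<open>x\<close>.\<close>
  have "\<exists>y. real (Suc i) * w \<le> dist p x \<longrightarrow> dist p y = real (Suc i) * w \<and> dist y x = dist p x - real (Suc i) * w" for i
  proof (cases "real (Suc i) * w \<le> dist p x")
    case True
    then show ?thesis using geodesic_point[OF geodesic, of "real (Suc i) * w" p x] w by (metis mult_nonneg_nonneg of_nat_0_le_iff order_less_imp_le)
  next
    case False
    then show ?thesis by (intro exI) (rule impI, erule notE)
  qed
  then obtain Y where Y: "\<And>i. real (Suc i) * w \<le> dist p x \<Longrightarrow>
      dist p (Y i) = real (Suc i) * w \<and> dist (Y i) x = dist p x - real (Suc i) * w" by metis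
  define \<psi> where "\<psi> i k X = (if gp (Y i) (walk k X p) (walk (Suc k) X p) \<le> chain_radius k then 1 else (0::real))"
    for i k and X :: "nat \<Rightarrow> 'a \<Rightarrow> 'a"
  have \<psi>0: "0 \<le> \<psi> i k X" for i k X by (simp add: \<psi>_def)
  have ptw: "gp p x (walk n X p) \<le> w * (real T + 1 + (\<Sum>i\<in>{T..<n}. \<Sum>k\<in>{i..<n}. \<psi> i k X))"
    if X: "\<And>i. X i \<in> insert id (set_pmf \<mu>)" for X
  proof -
    define Q where "Q = gp p x (walk n X p)"
    have Xp: "dist (X i p) p \<le> K" for i
      using X[of i] K by auto
    have step: "dist (walk k X p) (walk (Suc k) X p) \<le> K" for k
      using isom_dist[OF \<Gamma>_isom[OF walk_\<Gamma>[of "set_pmf \<mu>" X, OF S X]], of k p "X (Suc k) p"] Xp[of "Suc k"]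
      by (simp add: dist_commute)
    have zn: "dist (walk k X p) p \<le> real k * K" for k
    proof (induction k)
      case (Suc k)
      then show ?case
        using dist_triangle[of "walk (Suc k) X p" p "walk k X p"] step[of k]
        by (simp add: algebra_simps dist_commute)
    qed simp
    have inner: "1 \<le> (\<Sum>k\<in>{i..<n}. \<psi> i k X)" if i: "real (Suc i) * w \<le> Q" for i
    proof -
      have "real (Suc i) * w \<le> dist p x"
        using i gp_le_dist[of p x "walk n X p"] by (simp add: Q_def dist_commute)
      note y = Y[OF this]
      have "0 < real (Suc i) * w" using w by simp
      then obtain k where k: "k < n" "gp (Y i) (walk k X p) (walk (Suc k) X p) \<le> chain_radius k"
          "real (Suc i) * w \<le> (real k + 1) * (K + 2 * \<delta>)"
        using path_near_point[of "\<lambda>k. walk k X p" n K "real (Suc i) * w" x "Y i"] step i y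
        unfolding Q_def by auto
      have "real (Suc i) \<le> real k + 1" using k(3) w unfolding w_def[symmetric] by simp
      then have ki: "k \<in> {i..<n}" using k(1) by simp
      have "1 = \<psi> i k X" using k(2) by (simp add: \<psi>_def)
      also have "\<dots> \<le> (\<Sum>k\<in>{i..<n}. \<psi> i k X)" using ki \<psi>0 by (intro member_le_sum) auto
      finally show ?thesis .
    qed
    define I where "I = nat \<lfloor>Q / w\<rfloor>"
    have Q0: "0 \<le> Q" unfolding Q_def by (rule gp_nonneg)
    have I: "real I * w \<le> Q" "Q < w * (real I + 1)"
    proof -
      have "0 \<le> Q / w" using Q0 w by simp
      then have "real I \<le> Q / w" "Q / w < real I + 1" unfolding I_def by linarith+
      then show "real I * w \<le> Q" "Q < w * (real I + 1)" using w by (simp_all add: field_simps)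
    qed
    have In: "I \<le> n"
    proof -
      have "Q \<le> real n * w"
        using gp_le_dist'[of p x "walk n X p"] zn[of n] delta_ge
        unfolding Q_def w_def by (smt (verit) mult_left_mono of_nat_0_le_iff)
      then have "real I * w \<le> real n * w" using I(1) by linarith
      then show ?thesis using w by simp
    qed
    have "real I \<le> real T + (\<Sum>i\<in>{T..<n}. \<Sum>k\<in>{i..<n}. \<psi> i k X)"
    proof (cases "I \<le> T")
      case True
      have "0 \<le> (\<Sum>i\<in>{T..<n}. \<Sum>k\<in>{i..<n}. \<psi> i k X)" by (intro sum_nonneg \<psi>0)
      then show ?thesis using True by simp
    next
      case False
      have "real I - real T = (\<Sum>i\<in>{T..<I}. 1)" using False by simp
      also have "\<dots> \<le> (\<Sum>i\<in>{T..<I}. \<Sum>k\<in>{i..<n}. \<psi> i k X)"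
      proof (rule sum_mono)
        fix i assume "i \<in> {T..<I}"
        then have "real (Suc i) * w \<le> real I * w" using w by (intro mult_right_mono of_nat_mono) auto
        then show "1 \<le> (\<Sum>k\<in>{i..<n}. \<psi> i k X)" using I(1) by (intro inner) linarith
      qed
      also have "\<dots> \<le> (\<Sum>i\<in>{T..<n}. \<Sum>k\<in>{i..<n}. \<psi> i k X)"
        using In by (intro sum_mono2 sum_nonneg \<psi>0) auto
      finally show ?thesis by simp
    qed
    then have "w * (real I + 1) \<le> w * (real T + 1 + (\<Sum>i\<in>{T..<n}. \<Sum>k\<in>{i..<n}. \<psi> i k X))"
      using w by (intro mult_left_mono) auto
    then show ?thesis using I(2) unfolding Q_def by linarith
  qed
  have each: "path_exp \<mu> n (\<psi> i k)
      \<le> crossings K (chain_radius k) * h k"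
    if "k < n" for i k
  proof -
    have local: "\<psi> i k (X(j := s)) = \<psi> i k X" if "Suc k < j" for X s j
    proof -
      have "walk k (X(j := s)) = walk k X" "walk (Suc k) (X(j := s)) = walk (Suc k) X"
        using that by (intro walk_cong; simp)+
      then show ?thesis unfolding \<psi>_def by (simp only:)
    qed
    have "path_exp \<mu> n (\<psi> i k) = path_exp \<mu> (Suc k) (\<psi> i k)"
      by (rule path_exp_truncate[OF fin local]) (use that in auto)
    also have "\<dots> \<le> crossings K (chain_radius k) * h k"
      unfolding \<psi>_def by (rule crossing_probability[where K = K and h = "h k", OF fin S _ chain_radius_nonneg]) (rule K(2) heat, assumption?)+
    finally show ?thesis .
  qed
  have "walk_exp \<mu> n (\<lambda>g. gp p x (g p)) \<le> path_exp \<mu> n (\<lambda>X. w * (real T + 1 + (\<Sum>i\<in>{T..<n}. \<Sum>k\<in>{i..<n}. \<psi> i k X)))"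
    by (rule path_exp_mono) (rule ptw)
  also have "\<dots> = w * (real T + 1 + (\<Sum>i\<in>{T..<n}. \<Sum>k\<in>{i..<n}. path_exp \<mu> n (\<psi> i k)))"
    unfolding path_exp_cmult path_exp_add path_exp_const[OF fin] path_exp_sum[OF finite_atLeastLessThan] ..
  also have "\<dots> \<le> w * (real T + 1 + (\<Sum>i\<in>{T..<n}. \<Sum>k\<in>{i..<n}.
      crossings K (chain_radius k) * h k))"
    using w by (intro mult_left_mono add_left_mono sum_mono each) auto
  finally show ?thesis unfolding w_def .
qed

text \<open>The volume is exponential in the radius and the radius logarithmic in \<open>k\<close>,
  which gives a power of \<open>k + 1\<close>. Its degree depends only on the growth rate of the
  orbit and \<delta>; the linear factor of the heat bound is included.\<close>

lemma crossing_count_polynomial: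
  "\<exists>C\<ge>0. \<exists>d::nat. \<forall>K\<ge>0. \<forall>k. crossings K (chain_radius k) * real (2 * k + 1) \<le> C * (K + 1) * (real k + 1) ^ d"
proof -
  obtain v where v: "0 \<le> v" "\<And>r. 0 \<le> r \<Longrightarrow> real (vol r) \<le> exp (v * (r + 2))"
    using vol_le_exp by blast
  define c where "c = v * (3 + 2 * \<delta> + 2 * D) + (2 * v + 1) * (2 * \<delta>)"
  define a where "a = (2 * v + 1) * (2 * \<delta>) / ln 2"
  have a0: "0 \<le> a" using v delta_ge by (simp add: a_def)
  have "crossings K (chain_radius k) * real (2 * k + 1)
      \<le> (2 * exp c) * (K + 1) * (real k + 1) ^ (nat \<lceil>a\<rceil> + 1)" if K: "0 \<le> K" for K k
  proof -
    define e where "e = chain_radius k"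
    have e: "0 \<le> e" unfolding e_def by (rule chain_radius_nonneg)
    have "K + e + 1 \<le> (K + 1) * (1 + e)" using K e by (simp add: algebra_simps)
    also have "\<dots> \<le> (K + 1) * exp e" using K exp_ge_add_one_self[of e] by (intro mult_left_mono) auto
    finally have 1: "K + e + 1 \<le> (K + 1) * exp e" .
    have 2: "real (vol (1 + 2 * e + 2 * \<delta> + 2 * D)) \<le> exp (v * (3 + 2 * \<delta> + 2 * D) + 2 * v * e)"
      using v(2)[of "1 + 2 * e + 2 * \<delta> + 2 * D"] e delta_ge D_nonneg by (simp add: algebra_simps)
    have "exp e * exp (v * (3 + 2 * \<delta> + 2 * D) + 2 * v * e) = exp c * exp (a * ln (real k + 1))"
      unfolding exp_add[symmetric] e_def chain_radius_def c_def a_def log_def by (simp add: field_simps)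
    also have "exp (a * ln (real k + 1)) = (real k + 1) powr a" by (simp add: powr_def)
    also have "\<dots> \<le> (real k + 1) powr real (nat \<lceil>a\<rceil>)"
      using a0 by (intro powr_mono) (auto simp: real_nat_ceiling_ge)
    also have "\<dots> = (real k + 1) ^ nat \<lceil>a\<rceil>" by (subst powr_realpow) auto
    finally have 3: "exp e * exp (v * (3 + 2 * \<delta> + 2 * D) + 2 * v * e) \<le> exp c * (real k + 1) ^ nat \<lceil>a\<rceil>" by simp
    have "crossings K e * real (2 * k + 1)
        \<le> ((K + 1) * exp e) * exp (v * (3 + 2 * \<delta> + 2 * D) + 2 * v * e) * (2 * (real k + 1))"
      using 1 2 K e by (intro mult_mono) auto
    also have "\<dots> = 2 * (K + 1) * (real k + 1) * (exp e * exp (v * (3 + 2 * \<delta> + 2 * D) + 2 * v * e))"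
      by (simp only: ac_simps)
    also have "\<dots> \<le> 2 * (K + 1) * (real k + 1) * (exp c * (real k + 1) ^ nat \<lceil>a\<rceil>)"
      using K by (intro mult_left_mono 3) auto
    also have "\<dots> = (2 * exp c) * (K + 1) * (real k + 1) ^ (nat \<lceil>a\<rceil> + 1)" by (simp add: ac_simps)
    finally show ?thesis unfolding e_def .
  qed
  then show ?thesis by (intro exI[of _ "2 * exp c"] conjI exI[of _ "nat \<lceil>a\<rceil> + 1"] allI impI) auto
qed

text \<open>C and d come before every quantifier over \<mu>, which enters only through \<tau> and K.
  The exponent is the degree of the crossing count plus one for each of the two geometric
  sums.\<close>

theorem walk_exp_gp_bound:
  "\<exists>C\<ge>0. \<exists>d::nat. \<forall>\<mu> \<tau> K n x. finite (set_pmf \<mu>) \<and> set_pmf \<mu> \<subseteq> \<Gamma> \<and> 0 < \<tau> \<and> \<tau> \<le> 1 \<and> 0 \<le> K \<and>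
      (\<forall>s\<in>set_pmf \<mu>. dist (s p) p \<le> K) \<and> (\<forall>k g. heat \<mu> k g \<le> real (2 * k + 1) * exp (- \<tau> * real k)) \<longrightarrow>
      walk_exp \<mu> n (\<lambda>g. gp p x (g p)) \<le> C * (K + 2 * \<delta>) * (1 + ln (K + 1)) / \<tau> ^ d"
proof -
  obtain C d where C: "0 \<le> C" and count: "\<And>K k. 0 \<le> K \<Longrightarrow> crossings K (chain_radius k) * real (2 * k + 1) \<le> C * (K + 1) * (real k + 1) ^ d"
    using crossing_count_polynomial by blast
  define C' where "C' = C * fact d * 2 ^ d * 32"
  have C'0: "0 \<le> C'" using C by (simp add: C'_def)
  have "walk_exp \<mu> n (\<lambda>g. gp p x (g p)) \<le> (C' + 3) * (K + 2 * \<delta>) * (1 + ln (K + 1)) / \<tau> ^ (d + 2)"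
    if fin: "finite (set_pmf \<mu>)" and S: "set_pmf \<mu> \<subseteq> \<Gamma>" and \<tau>: "0 < \<tau>" "\<tau> \<le> 1" and K0: "0 \<le> K"
      and K: "\<And>s. s \<in> set_pmf \<mu> \<Longrightarrow> dist (s p) p \<le> K"
      and heat: "\<And>k g. heat \<mu> k g \<le> real (2 * k + 1) * exp (- \<tau> * real k)" for \<mu> \<tau> K n x
  proof -
    define \<rho> where "\<rho> = exp (- (\<tau> / 2))"
    have \<rho>: "0 \<le> \<rho>" "\<rho> \<le> 1 - \<tau> / 4"
      using exp_minus_le[of "\<tau> / 2"] \<tau> by (simp_all add: \<rho>_def)
    define A where "A = C * (K + 1) * (fact d * (2 / \<tau>) ^ d * 2)"
    have A0: "0 \<le> A" using C K0 \<tau> by (simp add: A_def)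
    have term_le: "crossings K (chain_radius k) *
        (real (2 * k + 1) * exp (- \<tau> * real k)) \<le> A * \<rho> ^ k" for k
    proof -
      \<comment> \<open>Half of the exponential decay absorbs the polynomial, at the cost of
        \<open>(2 / \<tau>) ^ d\<close>; the other half leaves the ratio \<rho>.\<close>
      have "(\<tau> / 2 * (real k + 1)) ^ d \<le> fact d * exp (\<tau> / 2 * (real k + 1))"
        using \<tau> by (intro power_le_fact_exp) auto
      then have "(2 / \<tau>) ^ d * (\<tau> / 2 * (real k + 1)) ^ d \<le> (2 / \<tau>) ^ d * (fact d * exp (\<tau> / 2 * (real k + 1)))"
        using \<tau> by (intro mult_left_mono) auto
      moreover have "(2 / \<tau>) ^ d * (\<tau> / 2 * (real k + 1)) ^ d = (real k + 1) ^ d"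
      proof -
        have "2 / \<tau> * (\<tau> / 2 * (real k + 1)) = real k + 1" using \<tau> by (simp add: field_simps)
        then show ?thesis by (simp only: power_mult_distrib[symmetric])
      qed
      ultimately have "(real k + 1) ^ d \<le> fact d * (2 / \<tau>) ^ d * exp (\<tau> / 2 * (real k + 1))"
        by (simp only: ac_simps)
      then have "(real k + 1) ^ d * exp (- \<tau> * real k)
          \<le> fact d * (2 / \<tau>) ^ d * exp (\<tau> / 2 * (real k + 1)) * exp (- \<tau> * real k)"
        by (intro mult_right_mono) auto
      also have "\<dots> = fact d * (2 / \<tau>) ^ d * (exp (\<tau> / 2) * \<rho> ^ k)"
        unfolding \<rho>_def exp_of_nat_mult[symmetric] mult.assoc exp_add[symmetric] by (simp add: field_simps)
      also have "\<dots> \<le> fact d * (2 / \<tau>) ^ d * (2 * \<rho> ^ k)"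
      proof -
        have "exp (\<tau> / 2) \<le> exp (1 / 2 :: real)" using \<tau> by simp
        also have "\<dots> \<le> 2" using exp_minus_le[of "1/2"] exp_bound_half[of "1/2 :: real"] by simp
        finally show ?thesis using \<rho>(1) \<tau> by (intro mult_left_mono mult_right_mono) auto
      qed
      finally have *: "(real k + 1) ^ d * exp (- \<tau> * real k) \<le> fact d * (2 / \<tau>) ^ d * 2 * \<rho> ^ k" by simp
      have "crossings K (chain_radius k) *
          (real (2 * k + 1) * exp (- \<tau> * real k)) \<le> C * (K + 1) * (real k + 1) ^ d * exp (- \<tau> * real k)"
        unfolding mult.assoc[symmetric] by (intro mult_right_mono count[OF K0]) auto
      also have "\<dots> \<le> C * (K + 1) * (fact d * (2 / \<tau>) ^ d * 2 * \<rho> ^ k)"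
        unfolding mult.assoc[of "C * (K + 1)"] using C K0 * by (intro mult_left_mono) auto
      also have "\<dots> = A * \<rho> ^ k" by (simp add: A_def ac_simps)
      finally show ?thesis .
    qed
    \<comment> \<open>With this many marks counted outright, \<open>\<rho> ^ T\<close> cancels the
      factor \<open>K + 1\<close> of the crossing count; the price is the logarithm of K.\<close>
    define T where "T = nat \<lceil>2 / \<tau> * ln (K + 1)\<rceil>"
    have ln0: "0 \<le> ln (K + 1)" using K0 by simp
    have T: "2 / \<tau> * ln (K + 1) \<le> real T" "real T \<le> 2 / \<tau> * ln (K + 1) + 1"
    proof -
      have "0 \<le> 2 / \<tau> * ln (K + 1)" using ln0 \<tau> by simp
      then show "2 / \<tau> * ln (K + 1) \<le> real T" "real T \<le> 2 / \<tau> * ln (K + 1) + 1"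
        unfolding T_def by linarith+
    qed
    have \<rho>T: "(K + 1) * \<rho> ^ T \<le> 1"
    proof -
      have "\<rho> ^ T = exp (- (\<tau> / 2 * real T))" by (simp add: \<rho>_def exp_of_nat_mult[symmetric] mult.commute)
      also have "\<dots> \<le> exp (- ln (K + 1))" using T(1) \<tau> by (simp add: field_simps)
      also have "\<dots> = 1 / (K + 1)" using K0 by (simp add: exp_minus inverse_eq_divide)
      finally show ?thesis using K0 by (simp add: field_simps)
    qed
    have r1: "\<tau> / 4 \<le> 1 - \<rho>" "\<rho> < 1" "0 < 1 - \<rho>" using \<rho> \<tau> by linarith+
    have "(\<Sum>i\<in>{T..<n}. \<Sum>k\<in>{i..<n}. crossings K (chain_radius k) * (real (2 * k + 1) * exp (- \<tau> * real k)))
        \<le> (\<Sum>i\<in>{T..<n}. \<Sum>k\<in>{i..<n}. A * \<rho> ^ k)" by (intro sum_mono term_le)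
    also have "\<dots> = A * (\<Sum>i\<in>{T..<n}. \<Sum>k\<in>{i..<n}. \<rho> ^ k)" by (simp only: sum_distrib_left)
    also have "\<dots> \<le> A * (\<Sum>i\<in>{T..<n}. \<rho> ^ i / (1 - \<rho>))"
      by (intro mult_left_mono A0 sum_mono sum_power_tail_le \<rho>(1) r1(2))
    also have "\<dots> = A * ((\<Sum>i\<in>{T..<n}. \<rho> ^ i) / (1 - \<rho>))" by (simp only: sum_divide_distrib)
    also have "\<dots> \<le> A * (\<rho> ^ T / (1 - \<rho>) / (1 - \<rho>))"
      using r1 by (intro mult_left_mono A0 divide_right_mono sum_power_tail_le \<rho>(1)) auto
    also have "\<dots> \<le> A * (\<rho> ^ T / (\<tau> / 4) / (\<tau> / 4))"
    proof -
      have "\<rho> ^ T / (1 - \<rho>) \<le> \<rho> ^ T / (\<tau> / 4)" using r1 \<tau> \<rho>(1) by (intro divide_left_mono) auto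
      then have "\<rho> ^ T / (1 - \<rho>) / (1 - \<rho>) \<le> \<rho> ^ T / (\<tau> / 4) / (1 - \<rho>)"
        using r1 by (intro divide_right_mono) auto
      also have "\<dots> \<le> \<rho> ^ T / (\<tau> / 4) / (\<tau> / 4)" using r1 \<tau> \<rho>(1) by (intro divide_left_mono) auto
      finally show ?thesis by (intro mult_left_mono A0)
    qed
    also have "\<dots> = ((K + 1) * \<rho> ^ T) * (C' / \<tau> ^ (d + 2))"
      using \<tau> by (simp add: A_def C'_def power_divide power_add power2_eq_square field_simps)
    also have "\<dots> \<le> 1 * (C' / \<tau> ^ (d + 2))" using \<rho>T C'0 \<tau> by (intro mult_right_mono) auto
    finally have tail: "(\<Sum>i\<in>{T..<n}. \<Sum>k\<in>{i..<n}. crossings K (chain_radius k) * (real (2 * k + 1) * exp (- \<tau> * real k)))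
        \<le> C' / \<tau> ^ (d + 2)" by simp
    have \<tau>d: "\<tau> ^ (d + 2) \<le> \<tau>" "\<tau> ^ (d + 2) \<le> 1"
    proof -
      show "\<tau> ^ (d + 2) \<le> \<tau>" using \<tau> power_decreasing[of 1 "d + 2" \<tau>] by simp
      then show "\<tau> ^ (d + 2) \<le> 1" using \<tau> by linarith
    qed
    have "real T + 1 \<le> 2 * ln (K + 1) / \<tau> + 2" using T(2) by simp
    also have "\<dots> \<le> 2 * ln (K + 1) / \<tau> ^ (d + 2) + 2 / \<tau> ^ (d + 2)"
      using \<tau>d \<tau> ln0 by (intro add_mono divide_left_mono) (auto simp: le_divide_eq)
    finally have T': "real T + 1 \<le> (2 * ln (K + 1) + 2) / \<tau> ^ (d + 2)" by (simp add: add_divide_distrib)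
    have "walk_exp \<mu> n (\<lambda>g. gp p x (g p)) \<le> (K + 2 * \<delta>) * (real T + 1 + C' / \<tau> ^ (d + 2))"
      using K0 delta_ge
      by (intro order_trans[OF walk_exp_gp_le_sum[where K = K and n = n and x = x and T = T
            and h = "\<lambda>k. real (2 * k + 1) * exp (- \<tau> * real k)", OF fin S K0]]
          mult_left_mono add_left_mono tail K heat) auto
    also have "\<dots> \<le> (K + 2 * \<delta>) * ((C' + 3) * (1 + ln (K + 1)) / \<tau> ^ (d + 2))"
    proof (intro mult_left_mono)
      have "real T + 1 + C' / \<tau> ^ (d + 2) \<le> (2 * ln (K + 1) + 2 + C') / \<tau> ^ (d + 2)"
        using T' by (simp add: add_divide_distrib)
      also have "\<dots> \<le> ((C' + 3) * (1 + ln (K + 1))) / \<tau> ^ (d + 2)"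
        using \<tau> C'0 ln0 by (intro divide_right_mono) (auto simp: algebra_simps)
      finally show "real T + 1 + C' / \<tau> ^ (d + 2) \<le> (C' + 3) * (1 + ln (K + 1)) / \<tau> ^ (d + 2)" .
    qed (use K0 delta_ge in auto)
    finally show ?thesis by (simp add: ac_simps)
  qed
  then show ?thesis using C'0 by (intro exI[of _ "C' + 3"] conjI exI[of _ "d + 2"] allI impI) auto
qed

end

section \<open>The law of the walk\<close>

text \<open>Turns a point of the product space, whose coordinates start at 1, into a path of the
  form that \<open>path_exp\<close> passes to its argument.\<close>

definition truncate_path :: "nat \<Rightarrow> (nat \<Rightarrow> 'b \<Rightarrow> 'b) \<Rightarrow> nat \<Rightarrow> 'b \<Rightarrow> 'b" where
  "truncate_path n X = (\<lambda>i. if 1 \<le> i \<and> i \<le> n then X i else id)"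

lemma truncate_path_Suc: "truncate_path (Suc n) X = (truncate_path n X)(Suc n := X (Suc n))"
  by (rule ext) (auto simp: truncate_path_def le_Suc_eq)

lemma walk_truncate_path: "walk n (truncate_path n X) = walk n X"
  by (rule walk_cong) (simp add: truncate_path_def)

lemma space_step_space_mem: "X \<in> space (step_space \<mu>) \<Longrightarrow> 1 \<le> i \<Longrightarrow> X i \<in> set_pmf \<mu>"
  by (auto simp: step_space_def space_PiM PiE_iff space_restrict_space)

lemma prob_space_restrict_pmf: "prob_space (restrict_space (measure_pmf \<mu>) (set_pmf \<mu>))"
  by (rule prob_spaceI)
    (simp add: space_restrict_space emeasure_restrict_space measure_pmf.emeasure_eq_measure
      measure_measure_pmf_finite measure_pmf.prob_eq_1 AE_measure_pmf)

lemma measure_step_cylinder: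
  assumes J: "J \<subseteq> {1..}" "finite J" and Y: "\<And>j. j \<in> J \<Longrightarrow> Y j \<in> set_pmf \<mu>"
  shows "{X \<in> space (step_space \<mu>). \<forall>j\<in>J. X j = Y j} \<in> sets (step_space \<mu>)"
    "measure (step_space \<mu>) {X \<in> space (step_space \<mu>). \<forall>j\<in>J. X j = Y j} = (\<Prod>j\<in>J. pmf \<mu> (Y j))"
proof -
  let ?M = "restrict_space (measure_pmf \<mu>) (set_pmf \<mu>)"
  interpret P: product_prob_space "\<lambda>_::nat. ?M" "{1..}"
    by (intro product_prob_space.intro product_sigma_finite.intro product_prob_space_axioms.intro
        prob_space_imp_sigma_finite prob_space_restrict_pmf)
  have emb: "{X \<in> space (step_space \<mu>). \<forall>j\<in>J. X j = Y j}
      = prod_emb {1..} (\<lambda>_. ?M) J (Pi\<^sub>E J (\<lambda>j. {Y j}))"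
    unfolding step_space_def using J(1)
    by (auto simp: prod_emb_def space_PiM PiE_iff extensional_def restrict_def)
  have S: "{Y j} \<in> sets ?M" if "j \<in> J" for j
    using Y[OF that] by (auto simp: sets_restrict_space)
  show "{X \<in> space (step_space \<mu>). \<forall>j\<in>J. X j = Y j} \<in> sets (step_space \<mu>)"
    unfolding emb unfolding step_space_def by (intro sets_PiM_I J ballI S)
  have "measure (step_space \<mu>) {X \<in> space (step_space \<mu>). \<forall>j\<in>J. X j = Y j} = (\<Prod>j\<in>J. measure ?M {Y j})"
    unfolding emb unfolding step_space_def by (rule P.measure_PiM_emb[OF J S])
  also have "\<dots> = (\<Prod>j\<in>J. pmf \<mu> (Y j))"
    using Y by (intro prod.cong refl) (simp add: measure_restrict_space measure_pmf_single)
  finally show "measure (step_space \<mu>) {X \<in> space (step_space \<mu>). \<forall>j\<in>J. X j = Y j} = (\<Prod>j\<in>J. pmf \<mu> (Y j))" .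
qed

text \<open>The constraint on finitely many later coordinates makes the induction on \<open>n\<close> go through.\<close>
lemma measure_path_event_cylinder:
  assumes fin: "finite (set_pmf \<mu>)"
  shows "J \<subseteq> {Suc n..} \<Longrightarrow> finite J \<Longrightarrow> (\<And>j. j \<in> J \<Longrightarrow> Y j \<in> set_pmf \<mu>) \<Longrightarrow>
    {X \<in> space (step_space \<mu>). Q (truncate_path n X) \<and> (\<forall>j\<in>J. X j = Y j)} \<in> sets (step_space \<mu>) \<and>
    measure (step_space \<mu>) {X \<in> space (step_space \<mu>). Q (truncate_path n X) \<and> (\<forall>j\<in>J. X j = Y j)}
      = path_exp \<mu> n (\<lambda>X. if Q X then 1 else 0) * (\<Prod>j\<in>J. pmf \<mu> (Y j))"
proof (induction n arbitrary: Q J Y)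
  case 0
  have t: "truncate_path 0 X = (\<lambda>_. id)" for X :: "nat \<Rightarrow> 'a \<Rightarrow> 'a"
    unfolding truncate_path_def by (rule ext) auto
  have J: "J \<subseteq> {1..}" using 0 by simp
  note cyl = measure_step_cylinder[OF J 0(2,3)]
  show ?case
  proof (cases "Q (\<lambda>_. id)")
    case True
    then have "{X \<in> space (step_space \<mu>). Q (truncate_path 0 X) \<and> (\<forall>j\<in>J. X j = Y j)}
        = {X \<in> space (step_space \<mu>). \<forall>j\<in>J. X j = Y j}" unfolding t by blast
    then show ?thesis using cyl True unfolding path_exp.simps by (simp only: if_True mult_1)
  next
    case False
    then have "{X \<in> space (step_space \<mu>). Q (truncate_path 0 X) \<and> (\<forall>j\<in>J. X j = Y j)} = {}"
      unfolding t by blast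
    then show ?thesis using False unfolding path_exp.simps
      by (simp only: if_False mult_zero_left measure_empty sets.empty_sets)
  qed
next
  case (Suc n)
  let ?P = "step_space \<mu>"
  interpret P: prob_space ?P by (rule prob_space_step_space)
  \<comment> \<open>The event is split by the value of coordinate \<open>Suc n\<close>, which then
    joins the constraints on later coordinates.\<close>
  define E where "E s = {X \<in> space ?P. Q ((truncate_path n X)(Suc n := s)) \<and>
      (\<forall>j\<in>insert (Suc n) J. X j = (Y(Suc n := s)) j)}" for s
  have notin: "Suc n \<notin> J" using Suc.prems(1) by auto
  have J': "insert (Suc n) J \<subseteq> {Suc n..}" "finite (insert (Suc n) J)" using Suc.prems by auto
  have E: "E s \<in> sets ?P \<and> measure ?P (E s)
      = path_exp \<mu> n (\<lambda>X. if Q (X(Suc n := s)) then 1 else 0) * (\<Prod>j\<in>insert (Suc n) J. pmf \<mu> ((Y(Suc n := s)) j))"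
    if "s \<in> set_pmf \<mu>" for s
    unfolding E_def using Suc.prems(3) that
    by (intro Suc.IH[OF J', where Q = "\<lambda>X. Q (X(Suc n := s))"]) auto
  have prodE: "(\<Prod>j\<in>insert (Suc n) J. pmf \<mu> ((Y(Suc n := s)) j)) = pmf \<mu> s * (\<Prod>j\<in>J. pmf \<mu> (Y j))" for s
  proof -
    have "(\<Prod>j\<in>J. pmf \<mu> ((Y(Suc n := s)) j)) = (\<Prod>j\<in>J. pmf \<mu> (Y j))"
      using notin by (intro prod.cong refl) auto
    then show ?thesis using Suc.prems(2) notin by simp
  qed
  have union: "{X \<in> space ?P. Q (truncate_path (Suc n) X) \<and> (\<forall>j\<in>J. X j = Y j)} = (\<Union>s\<in>set_pmf \<mu>. E s)"
  proof (intro equalityI subsetI)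
    fix X assume X: "X \<in> {X \<in> space ?P. Q (truncate_path (Suc n) X) \<and> (\<forall>j\<in>J. X j = Y j)}"
    then have "X (Suc n) \<in> set_pmf \<mu>" using space_step_space_mem[of X \<mu> "Suc n"] by simp
    moreover have "X \<in> E (X (Suc n))"
      using X notin unfolding E_def truncate_path_Suc by auto
    ultimately show "X \<in> (\<Union>s\<in>set_pmf \<mu>. E s)" by blast
  next
    fix X assume "X \<in> (\<Union>s\<in>set_pmf \<mu>. E s)"
    then obtain s where "X \<in> E s" by blast
    then have X: "X \<in> space ?P" "Q ((truncate_path n X)(Suc n := s))" "X (Suc n) = s"
        "\<And>j. j \<in> J \<Longrightarrow> X j = (Y(Suc n := s)) j"
      unfolding E_def by auto
    have "X j = Y j" if "j \<in> J" for j
      using X(4)[OF that] that notin by auto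
    moreover have "Q (truncate_path (Suc n) X)" unfolding truncate_path_Suc X(3) by (rule X(2))
    ultimately show "X \<in> {X \<in> space ?P. Q (truncate_path (Suc n) X) \<and> (\<forall>j\<in>J. X j = Y j)}"
      using X(1) by blast
  qed
  have disj: "disjoint_family_on E (set_pmf \<mu>)"
    unfolding disjoint_family_on_def E_def by auto
  have "measure ?P (\<Union>s\<in>set_pmf \<mu>. E s) = (\<Sum>s\<in>set_pmf \<mu>. measure ?P (E s))"
    using E by (intro P.finite_measure_finite_Union fin disj) blast
  also have "\<dots> = (\<Sum>s\<in>set_pmf \<mu>. path_exp \<mu> n (\<lambda>X. if Q (X(Suc n := s)) then 1 else 0) * (pmf \<mu> s * (\<Prod>j\<in>J. pmf \<mu> (Y j))))"
    using E by (intro sum.cong refl) (simp only: prodE)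
  also have "\<dots> = path_exp \<mu> (Suc n) (\<lambda>X. if Q X then 1 else 0) * (\<Prod>j\<in>J. pmf \<mu> (Y j))"
    unfolding path_exp.simps sum_distrib_right by (intro sum.cong refl) (simp only: ac_simps)
  finally show ?case
    unfolding union using E fin by (intro conjI sets.finite_UN) auto
qed

lemma measure_walk_event:
  assumes fin: "finite (set_pmf \<mu>)"
  shows "{X \<in> space (step_space \<mu>). Q (walk n X)} \<in> sets (step_space \<mu>)"
    "measure (step_space \<mu>) {X \<in> space (step_space \<mu>). Q (walk n X)} = walk_exp \<mu> n (\<lambda>g. if Q g then 1 else 0)"
  using measure_path_event_cylinder[OF fin, of "{}" n undefined "\<lambda>X. Q (walk n X)"]
  unfolding walk_truncate_path by auto

section \<open>Concentration\<close>

lemma hoeffding_pmf_pos: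
  fixes b :: "'b \<Rightarrow> real"
  assumes fin: "finite (set_pmf \<mu>)" and c: "\<And>s t. s \<in> set_pmf \<mu> \<Longrightarrow> t \<in> set_pmf \<mu> \<Longrightarrow> b s - b t \<le> c"
    and \<theta>: "0 < \<theta>"
  shows "(\<Sum>s\<in>set_pmf \<mu>. pmf \<mu> s * exp (\<theta> * b s)) \<le> exp (\<theta>\<^sup>2 * c\<^sup>2 / 8) * exp (\<theta> * (\<Sum>s\<in>set_pmf \<mu>. pmf \<mu> s * b s))"
proof -
  let ?S = "set_pmf \<mu>"
  \<comment> \<open>Only differences of values are bounded by hypothesis, so the interval for
    Hoeffding's lemma is placed at the minimum.\<close>
  define lo where "lo = Min (b ` ?S)"
  have "lo \<in> b ` ?S" unfolding lo_def using fin set_pmf_not_empty by (intro Min_in) auto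
  then obtain t where t: "t \<in> ?S" "lo = b t" by blast
  have lo: "lo \<le> b s" if "s \<in> ?S" for s unfolding lo_def using fin that by (intro Min_le) auto
  have hi: "b s \<le> lo + c" if "s \<in> ?S" for s using c[OF that t(1)] t(2) by simp
  interpret I: interval_bounded_random_variable "measure_pmf \<mu>" b lo "lo + c"
    by unfold_locales (auto simp: AE_measure_pmf_iff lo hi)
  define m where "m = measure_pmf.expectation \<mu> b"
  have m: "m = (\<Sum>s\<in>?S. pmf \<mu> s * b s)"
    unfolding m_def by (subst integral_measure_pmf[OF fin]) (auto intro: fin)
  have "(\<Sum>s\<in>?S. ennreal (exp (\<theta> * (b s - m))) * ennreal (pmf \<mu> s))
      \<le> ennreal (exp (\<theta>\<^sup>2 * (lo + c - lo)\<^sup>2 / 8))"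
    using I.Hoeffdings_lemma_nn_integral[OF \<theta>]
    unfolding m_def[symmetric] by (subst (asm) nn_integral_measure_pmf_finite[OF fin]) auto
  also have "(\<Sum>s\<in>?S. ennreal (exp (\<theta> * (b s - m))) * ennreal (pmf \<mu> s))
      = ennreal (\<Sum>s\<in>?S. exp (\<theta> * (b s - m)) * pmf \<mu> s)"
    by (simp add: ennreal_mult[symmetric] sum_ennreal)
  finally have "(\<Sum>s\<in>?S. exp (\<theta> * (b s - m)) * pmf \<mu> s) \<le> exp (\<theta>\<^sup>2 * c\<^sup>2 / 8)"
    by (subst (asm) ennreal_le_iff) auto
  then have "(\<Sum>s\<in>?S. exp (\<theta> * (b s - m)) * pmf \<mu> s) * exp (\<theta> * m) \<le> exp (\<theta>\<^sup>2 * c\<^sup>2 / 8) * exp (\<theta> * m)"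
    by (intro mult_right_mono) auto
  moreover have "(\<Sum>s\<in>?S. exp (\<theta> * (b s - m)) * pmf \<mu> s) * exp (\<theta> * m) = (\<Sum>s\<in>?S. pmf \<mu> s * exp (\<theta> * b s))"
    unfolding sum_distrib_right by (intro sum.cong refl) (simp add: exp_add[symmetric] algebra_simps)
  ultimately show ?thesis unfolding m by simp
qed

lemma hoeffding_pmf:
  fixes b :: "'b \<Rightarrow> real"
  assumes fin: "finite (set_pmf \<mu>)" and c: "\<And>s t. s \<in> set_pmf \<mu> \<Longrightarrow> t \<in> set_pmf \<mu> \<Longrightarrow> b s - b t \<le> c"
  shows "(\<Sum>s\<in>set_pmf \<mu>. pmf \<mu> s * exp (\<theta> * b s)) \<le> exp (\<theta>\<^sup>2 * c\<^sup>2 / 8) * exp (\<theta> * (\<Sum>s\<in>set_pmf \<mu>. pmf \<mu> s * b s))"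
proof -
  consider "\<theta> = 0" | "0 < \<theta>" | "0 < - \<theta>" by linarith
  then show ?thesis
  proof cases
    case 1
    then show ?thesis by (simp add: sum_pmf_set[OF fin])
  next
    case 2
    then show ?thesis by (intro hoeffding_pmf_pos fin c)
  next
    case 3
    have "- b s - (- b t) \<le> c" if "s \<in> set_pmf \<mu>" "t \<in> set_pmf \<mu>" for s t
      using c[OF that(2,1)] by simp
    from hoeffding_pmf_pos[OF fin, of "\<lambda>s. - b s", OF this 3]
    show ?thesis by (simp add: sum_negf)
  qed
qed

section \<open>Walks with uniformly bounded expected Gromov products\<close>

locale bounded_walk = cocompact_action \<delta> p \<Gamma> D
  for \<delta> :: real and p :: "'a::metric_space" and \<Gamma> D +
  fixes \<mu> :: "('a \<Rightarrow> 'a) pmf" and K G :: real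
  assumes fin: "finite (set_pmf \<mu>)" and support: "set_pmf \<mu> \<subseteq> \<Gamma>"
    and K_pos: "0 < K" and K: "\<And>s. s \<in> set_pmf \<mu> \<Longrightarrow> dist (s p) p \<le> K"
    and G: "\<And>n x. walk_exp \<mu> n (\<lambda>g. gp p x (g p)) \<le> G"
begin

definition mean :: "nat \<Rightarrow> real" where
  "mean n = walk_exp \<mu> n (\<lambda>g. dist (g p) p)"

definition potential :: "nat \<Rightarrow> ('a \<Rightarrow> 'a) \<Rightarrow> real" where
  "potential k g = walk_exp \<mu> k (\<lambda>h. dist (g (h p)) p)"

lemma walk_exp_gp_nonneg: "0 \<le> walk_exp \<mu> n (\<lambda>g. gp p x (g p))"
proof -
  have "path_exp \<mu> n (\<lambda>_. 0) \<le> walk_exp \<mu> n (\<lambda>g. gp p x (g p))"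
    by (rule path_exp_mono) (rule gp_nonneg)
  then show ?thesis unfolding path_exp_zero .
qed

lemma G_nonneg: "0 \<le> G"
  using walk_exp_gp_nonneg[of 0 p] G[of 0 p] by linarith

lemma walk_support:
  "(\<And>i. X i \<in> insert id (set_pmf \<mu>)) \<Longrightarrow> walk n X \<in> \<Gamma>"
  by (rule walk_\<Gamma>[OF support])

lemma potential_eq:
  assumes g: "isom g"
  shows "potential k g = dist (g p) p + mean k - 2 * walk_exp \<mu> k (\<lambda>h. gp p (finv g p) (h p))"
proof -
  have "potential k g = path_exp \<mu> k (\<lambda>X. (dist (g p) p + dist (walk k X p) p) - 2 * gp p (finv g p) (walk k X p))"
    unfolding potential_def by (intro path_exp_cong dist_comp_gp[OF g])
  also have "\<dots> = dist (g p) p + mean k - 2 * walk_exp \<mu> k (\<lambda>h. gp p (finv g p) (h p))"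
    unfolding path_exp_diff path_exp_add path_exp_const[OF fin] path_exp_cmult mean_def ..
  finally show ?thesis .
qed

lemma potential_id: "potential k id = mean k"
  unfolding potential_def mean_def id_apply ..

lemma potential_0: "potential 0 g = dist (g p) p"
  unfolding potential_def path_exp.simps walk.simps id_apply ..

lemma potential_Suc: "potential (Suc k) g = (\<Sum>s\<in>set_pmf \<mu>. pmf \<mu> s * potential k (g \<circ> s))"
  using walk_exp_comp[of \<mu> "Suc 0" k "\<lambda>h. dist (g (h p)) p"]
    walk_exp_1[of \<mu> "\<lambda>s. walk_exp \<mu> k (\<lambda>h. dist (g ((s \<circ> h) p)) p)"]
  unfolding potential_def by (simp only: add_Suc add_0 comp_apply)

text \<open>In \<open>potential_eq\<close> the term \<open>mean k\<close> cancels, the displacements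
  differ by at most \<open>2 * K\<close>, and both expected products lie between 0 and G.\<close>

lemma potential_increment:
  assumes g: "isom g" and st: "s \<in> set_pmf \<mu>" "t \<in> set_pmf \<mu>"
  shows "potential k (g \<circ> s) - potential k (g \<circ> t) \<le> 2 * K + 2 * G"
proof -
  have si: "isom s" "isom t" using st support \<Gamma>_isom by blast+
  have "dist ((g \<circ> s) p) p \<le> dist ((g \<circ> t) p) p + 2 * K"
    using dist_triangle[of "g (s p)" p "g (t p)"] isom_dist[OF g, of "s p" "t p"]
      dist_triangle[of "s p" "t p" p] K[OF st(1)] K[OF st(2)] by (simp add: dist_commute)
  then show ?thesis
    using potential_eq[OF isom_comp[OF g si(1)], of k] potential_eq[OF isom_comp[OF g si(2)], of k]
      walk_exp_gp_nonneg[of k "finv (g \<circ> s) p"] G[of k "finv (g \<circ> t) p"] by linarith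
qed

text \<open>\<open>potential k (R\<^sub>n\<^sub>-\<^sub>k)\<close> is the Doob martingale of \<open>\<kappa>(R\<^sub>n)\<close>, with increments bounded by
  \<open>potential_increment\<close>.\<close>
lemma moment_generating_bound:
  "walk_exp \<mu> j (\<lambda>g. exp (\<theta> * potential k g))
    \<le> exp (real j * (\<theta>\<^sup>2 * (2 * K + 2 * G)\<^sup>2 / 8)) * exp (\<theta> * mean (k + j))"
proof (induction j arbitrary: k)
  case 0
  show ?case unfolding path_exp.simps walk.simps potential_id by simp
next
  case (Suc j)
  let ?h = "\<theta>\<^sup>2 * (2 * K + 2 * G)\<^sup>2 / 8"
  have "walk_exp \<mu> (Suc j) (\<lambda>g. exp (\<theta> * potential k g))
      = walk_exp \<mu> j (\<lambda>g. \<Sum>s\<in>set_pmf \<mu>. pmf \<mu> s * exp (\<theta> * potential k (g \<circ> s)))"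
    unfolding walk_exp_Suc[of \<mu> j "\<lambda>g. exp (\<theta> * potential k g)"] path_exp_sum[OF fin] path_exp_cmult ..
  also have "\<dots> \<le> path_exp \<mu> j (\<lambda>X. exp ?h * exp (\<theta> * potential (Suc k) (walk j X)))"
  proof (rule path_exp_mono)
    fix X :: "nat \<Rightarrow> 'a \<Rightarrow> 'a" assume X: "\<And>i. X i \<in> insert id (set_pmf \<mu>)"
    have "isom (walk j X)" by (rule \<Gamma>_isom[OF walk_support[OF X]])
    then show "(\<Sum>s\<in>set_pmf \<mu>. pmf \<mu> s * exp (\<theta> * potential k (walk j X \<circ> s)))
        \<le> exp ?h * exp (\<theta> * potential (Suc k) (walk j X))"
      unfolding potential_Suc by (intro hoeffding_pmf[OF fin] potential_increment)
  qed
  also have "\<dots> = exp ?h * walk_exp \<mu> j (\<lambda>g. exp (\<theta> * potential (Suc k) g))"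
    by (rule path_exp_cmult)
  also have "\<dots> \<le> exp ?h * (exp (real j * ?h) * exp (\<theta> * mean (Suc k + j)))"
    by (intro mult_left_mono Suc.IH) simp
  also have "\<dots> = exp (real (Suc j) * ?h) * exp (\<theta> * mean (k + Suc j))"
    by (simp add: exp_add[symmetric] algebra_simps)
  finally show ?case .
qed

lemma deviation_from_mean:
  assumes n: "0 < n" and r: "0 < r"
  shows "walk_exp \<mu> n (\<lambda>g. if real n * r \<le> \<bar>dist (g p) p - mean n\<bar> then 1 else 0)
    \<le> 2 * exp (- (2 * real n * r\<^sup>2 / (2 * K + 2 * G)\<^sup>2))"
proof -
  define c where "c = 2 * K + 2 * G"
  have c: "0 < c" using K_pos G_nonneg by (simp add: c_def)
  \<comment> \<open>The minimiser of \<open>\<theta>^2 * c^2 / 8 - \<theta> * r\<close>.\<close>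
  define \<theta> where "\<theta> = 4 * r / c\<^sup>2"
  have \<theta>: "0 < \<theta>" using r c by (simp add: \<theta>_def)
  have mgf: "walk_exp \<mu> n (\<lambda>g. exp (\<eta> * dist (g p) p)) \<le> exp (real n * (\<theta>\<^sup>2 * c\<^sup>2 / 8)) * exp (\<eta> * mean n)"
    if "\<eta>\<^sup>2 = \<theta>\<^sup>2" for \<eta>
    using moment_generating_bound[of n \<eta> 0] that unfolding potential_0 c_def[symmetric] by simp
  have side: "walk_exp \<mu> n (\<lambda>g. exp (\<eta> * (dist (g p) p - mean n) - \<theta> * real n * r))
      \<le> exp (- (2 * real n * r\<^sup>2 / c\<^sup>2))" if \<eta>: "\<eta>\<^sup>2 = \<theta>\<^sup>2" for \<eta>
  proof -
    have "walk_exp \<mu> n (\<lambda>g. exp (\<eta> * (dist (g p) p - mean n) - \<theta> * real n * r))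
        = walk_exp \<mu> n (\<lambda>g. exp (- \<eta> * mean n - \<theta> * real n * r) * exp (\<eta> * dist (g p) p))"
      unfolding exp_add[symmetric] by (intro path_exp_cong) (simp add: algebra_simps)
    also have "\<dots> = exp (- \<eta> * mean n - \<theta> * real n * r) * walk_exp \<mu> n (\<lambda>g. exp (\<eta> * dist (g p) p))"
      by (rule path_exp_cmult)
    also have "\<dots> \<le> exp (- \<eta> * mean n - \<theta> * real n * r) * (exp (real n * (\<theta>\<^sup>2 * c\<^sup>2 / 8)) * exp (\<eta> * mean n))"
      by (intro mult_left_mono mgf \<eta>) simp
    also have "\<dots> = exp (real n * (\<theta>\<^sup>2 * c\<^sup>2 / 8) - \<theta> * real n * r)"
      unfolding exp_add[symmetric] by (simp add: algebra_simps)
    also have "real n * (\<theta>\<^sup>2 * c\<^sup>2 / 8) - \<theta> * real n * r = - (2 * real n * r\<^sup>2 / c\<^sup>2)"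
      using c unfolding \<theta>_def by (simp add: field_simps power2_eq_square)
    finally show ?thesis .
  qed
  have "walk_exp \<mu> n (\<lambda>g. if real n * r \<le> \<bar>dist (g p) p - mean n\<bar> then 1 else 0)
      \<le> path_exp \<mu> n (\<lambda>X. exp (\<theta> * (dist (walk n X p) p - mean n) - \<theta> * real n * r)
          + exp (- \<theta> * (dist (walk n X p) p - mean n) - \<theta> * real n * r))"
  proof (rule path_exp_mono)
    fix X :: "nat \<Rightarrow> 'a \<Rightarrow> 'a"
    let ?y = "dist (walk n X p) p - mean n"
    show "(if real n * r \<le> \<bar>?y\<bar> then 1 else 0)
        \<le> exp (\<theta> * ?y - \<theta> * real n * r) + exp (- \<theta> * ?y - \<theta> * real n * r)"
    proof (cases "real n * r \<le> \<bar>?y\<bar>")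
      case True
      then have "real n * r \<le> ?y \<or> real n * r \<le> - ?y" by linarith
      then have "0 \<le> \<theta> * (?y - real n * r) \<or> 0 \<le> \<theta> * (- ?y - real n * r)"
        using \<theta> by (elim disjE) (simp_all add: mult_nonneg_nonneg)
      then have "0 \<le> \<theta> * ?y - \<theta> * real n * r \<or> 0 \<le> - \<theta> * ?y - \<theta> * real n * r"
        by (simp add: right_diff_distrib mult.assoc)
      then have "1 \<le> exp (\<theta> * ?y - \<theta> * real n * r) \<or> 1 \<le> exp (- \<theta> * ?y - \<theta> * real n * r)"
        unfolding one_le_exp_iff .
      then have "1 \<le> exp (\<theta> * ?y - \<theta> * real n * r) + exp (- \<theta> * ?y - \<theta> * real n * r)"
        by (elim disjE) (simp_all add: add_increasing add_increasing2)
      then show ?thesis using True by (simp only: if_True)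
    qed (simp add: add_nonneg_nonneg)
  qed
  also have "\<dots> \<le> exp (- (2 * real n * r\<^sup>2 / c\<^sup>2)) + exp (- (2 * real n * r\<^sup>2 / c\<^sup>2))"
    unfolding path_exp_add by (intro add_mono side) simp_all
  finally show ?thesis unfolding c_def by simp
qed

text \<open>The defect of additivity is twice an expected Gromov product of two independent pieces
  of the walk, so it lies between 0 and \<open>2 * G\<close>.\<close>

lemma mean_add: "mean (m + n) \<le> mean m + mean n" "mean m + mean n - 2 * G \<le> mean (m + n)"
proof -
  define E where "E = path_exp \<mu> m (\<lambda>X. walk_exp \<mu> n (\<lambda>h. gp p (finv (walk m X) p) (h p)))"
  have "mean (m + n) = path_exp \<mu> m (\<lambda>X. potential n (walk m X))"
    unfolding mean_def potential_def walk_exp_comp[of \<mu> m n "\<lambda>g. dist (g p) p"] comp_apply ..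
  also have "\<dots> = path_exp \<mu> m (\<lambda>X. (dist (walk m X p) p + mean n)
      - 2 * walk_exp \<mu> n (\<lambda>h. gp p (finv (walk m X) p) (h p)))"
    by (intro path_exp_cong potential_eq \<Gamma>_isom walk_support)
  also have "\<dots> = mean m + mean n - 2 * E"
    unfolding path_exp_diff path_exp_add path_exp_const[OF fin] path_exp_cmult E_def
    unfolding mean_def ..
  finally have eq: "mean (m + n) = mean m + mean n - 2 * E" .
  have "path_exp \<mu> m (\<lambda>_. 0) \<le> E" "E \<le> path_exp \<mu> m (\<lambda>_. G)"
    unfolding E_def by (intro path_exp_mono walk_exp_gp_nonneg G)+
  then have "0 \<le> E" "E \<le> G" unfolding path_exp_const[OF fin] .
  then show "mean (m + n) \<le> mean m + mean n" "mean m + mean n - 2 * G \<le> mean (m + n)"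
    using eq by linarith+
qed

lemma mean_0: "mean 0 = 0"
  unfolding mean_def path_exp.simps walk.simps by simp

lemma mean_nonneg: "0 \<le> mean n"
proof -
  have "path_exp \<mu> n (\<lambda>_. 0) \<le> mean n"
    unfolding mean_def by (rule path_exp_mono) (rule zero_le_dist)
  then show ?thesis unfolding path_exp_zero .
qed

lemma mean_mult: "mean (k * n) \<le> real k * mean n" "real k * (mean n - 2 * G) \<le> mean (k * n)"
proof (induction k)
  case (Suc k)
  { case 1 show ?case using Suc(1) mean_add(1)[of n "k * n"] by (simp add: algebra_simps) }
  { case 2 show ?case using Suc(2) mean_add(2)[of n "k * n"] by (simp add: algebra_simps) }
qed (simp_all add: mean_0)

definition speed :: real where
  "speed = Inf ((\<lambda>n. mean n / real n) ` {1..})"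

text \<open>Fekete's argument with a rate: \<open>mean\<close> is subadditive and
  \<open>mean - 2 * G\<close> superadditive, so estimating \<open>mean (m * n)\<close> both ways
  compares the averages at any two times.\<close>

lemma mean_speed: "\<bar>mean n - real n * speed\<bar> \<le> 2 * G"
proof (cases "n = 0")
  case True
  then show ?thesis using G_nonneg by (simp add: mean_0)
next
  case False
  then have n: "0 < real n" by simp
  have "bdd_below ((\<lambda>n. mean n / real n) ` {1..})"
    by (rule bdd_belowI[of _ 0]) (auto simp: mean_nonneg)
  then have "speed \<le> mean n / real n"
    unfolding speed_def using False by (intro cInf_lower) auto
  then have upper: "real n * speed \<le> mean n" using n by (simp add: pos_le_divide_eq mult.commute)
  have "(mean n - 2 * G) / real n \<le> speed"
    unfolding speed_def
  proof (rule cInf_greatest)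
    fix y assume "y \<in> (\<lambda>n. mean n / real n) ` {1..}"
    then obtain m where m: "1 \<le> m" "y = mean m / real m" by auto
    have "real m * (mean n - 2 * G) \<le> mean (m * n)" by (rule mean_mult)
    also have "\<dots> \<le> real n * mean m" using mean_mult(1)[of n m] by (simp add: mult.commute)
    finally show "(mean n - 2 * G) / real n \<le> y"
    proof -
      assume le: "real m * (mean n - 2 * G) \<le> real n * mean m"
      then have le': "(mean n - 2 * G) * real m \<le> mean m * real n" by (simp only: mult.commute)
      have "0 < real m" using m by simp
      then show ?thesis using n le' unfolding m(2)
        by (simp only: pos_divide_le_eq times_divide_eq_left pos_le_divide_eq)
    qed
  qed simp
  then have "mean n - 2 * G \<le> real n * speed" using n by (simp add: pos_divide_le_eq mult.commute)
  then show ?thesis using upper G_nonneg by linarith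
qed

text \<open>If \<open>n * r\<close> is below \<open>2 * c\<close>, the fraction in the exponent is
  at most 1/2 and the bound is at least 1; the constant 8 is chosen for this. Otherwise the error
  \<open>2 * G\<close> is at most half of \<open>n * r\<close>, and the deviation from the mean
  applies with \<open>r / 2\<close>.\<close>

lemma deviation_from_speed:
  assumes r: "0 < r"
  shows "measure (step_space \<mu>)
      {X \<in> space (step_space \<mu>). real n * r \<le> \<bar>kappa p (walk n X) - real n * speed\<bar>}
    \<le> 2 * exp (- (real n * r\<^sup>2 / (8 * (2 * K + 2 * G)\<^sup>2)))"
proof -
  define c where "c = 2 * K + 2 * G"
  have c: "0 < c" "2 * G \<le> c" using K_pos G_nonneg by (simp_all add: c_def)
  interpret P: prob_space "step_space \<mu>" by (rule prob_space_step_space)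
  have event: "measure (step_space \<mu>)
      {X \<in> space (step_space \<mu>). real n * r \<le> \<bar>kappa p (walk n X) - real n * speed\<bar>}
    = walk_exp \<mu> n (\<lambda>g. if real n * r \<le> \<bar>dist (g p) p - real n * speed\<bar> then 1 else 0)"
    unfolding kappa_def by (rule measure_walk_event[OF fin])
  show ?thesis
  proof (cases "n = 0 \<or> real n * r < 2 * c")
    case True
    have "real n * r\<^sup>2 / (8 * c\<^sup>2) \<le> 1 / 2"
    proof (cases "n = 0")
      case False
      then have "real n * r < 2 * c" "1 \<le> real n" using True by auto
      then have "(real n * r)\<^sup>2 \<le> (2 * c)\<^sup>2" using r by (intro power_mono) auto
      have "real n * r\<^sup>2 \<le> real n * (real n * r\<^sup>2)"
        using mult_right_mono[OF \<open>1 \<le> real n\<close>, of "real n * r\<^sup>2"] by simp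
      also have "\<dots> = (real n * r)\<^sup>2" by (simp add: power2_eq_square ac_simps)
      also have "\<dots> \<le> 4 * c\<^sup>2" using \<open>(real n * r)\<^sup>2 \<le> (2 * c)\<^sup>2\<close> by (simp add: power_mult_distrib)
      finally show ?thesis using c by (simp add: pos_divide_le_eq)
    qed simp
    then have "1 - 1 / 2 \<le> exp (- (real n * r\<^sup>2 / (8 * c\<^sup>2)))"
      using exp_ge_add_one_self[of "- (real n * r\<^sup>2 / (8 * c\<^sup>2))"] by linarith
    then have "1 \<le> 2 * exp (- (real n * r\<^sup>2 / (8 * c\<^sup>2)))" by simp
    then show ?thesis unfolding c_def[symmetric] using P.prob_le_1 order_trans by blast
  next
    case False
    then have n: "0 < n" "2 * c \<le> real n * r" by auto
    have "walk_exp \<mu> n (\<lambda>g. if real n * r \<le> \<bar>dist (g p) p - real n * speed\<bar> then 1 else 0)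
        \<le> walk_exp \<mu> n (\<lambda>g. if real n * (r / 2) \<le> \<bar>dist (g p) p - mean n\<bar> then 1 else 0)"
    proof (rule path_exp_mono)
      fix X :: "nat \<Rightarrow> 'a \<Rightarrow> 'a"
      have "real n * (r / 2) \<le> \<bar>dist (walk n X p) p - mean n\<bar>"
        if "real n * r \<le> \<bar>dist (walk n X p) p - real n * speed\<bar>"
      proof -
        have half: "real n * (r / 2) = real n * r / 2" by simp
        show ?thesis unfolding half using that mean_speed[of n] n(2) c(2) by linarith
      qed
      then show "(if real n * r \<le> \<bar>dist (walk n X p) p - real n * speed\<bar> then 1 else 0)
          \<le> (if real n * (r / 2) \<le> \<bar>dist (walk n X p) p - mean n\<bar> then 1 else (0::real))" by simp
    qed
    also have "\<dots> \<le> 2 * exp (- (2 * real n * (r / 2)\<^sup>2 / c\<^sup>2))"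
      unfolding c_def using r by (intro deviation_from_mean n) simp
    also have "\<dots> \<le> 2 * exp (- (real n * r\<^sup>2 / (8 * c\<^sup>2)))"
      using c by (simp add: power_divide divide_simps)
    finally show ?thesis unfolding event c_def .
  qed
qed

text \<open>Exponential tails at the thresholds \<open>1 / (j + 1)\<close> and Borel-Cantelli: the
  law of large numbers follows from the concentration bound itself.\<close>

lemma AE_speed: "AE X in step_space \<mu>. (\<lambda>n. kappa p (walk n X) / real n) \<longlonglongrightarrow> speed"
proof -
  interpret P: prob_space "step_space \<mu>" by (rule prob_space_step_space)
  define A where "A j n = {X \<in> space (step_space \<mu>).
      real n * (1 / real (Suc j)) \<le> \<bar>kappa p (walk n X) - real n * speed\<bar>}" for j n
  have "AE X in step_space \<mu>. \<forall>\<^sub>F n in sequentially. X \<in> space (step_space \<mu>) - A j n" for j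
  proof (rule borel_cantelli_AE1)
    show "A j n \<in> sets (step_space \<mu>)" for n
      unfolding A_def by (rule measure_walk_event[OF fin])
    show "emeasure (step_space \<mu>) (A j n) < \<infinity>" for n
      by (simp add: P.emeasure_eq_measure)
    define b where "b = (1 / real (Suc j))\<^sup>2 / (8 * (2 * K + 2 * G)\<^sup>2)"
    have b: "0 < b" using K_pos G_nonneg by (simp add: b_def)
    have tail: "norm (measure (step_space \<mu>) (A j n)) \<le> 2 * exp (- b) ^ n" for n
      using deviation_from_speed[of "1 / real (Suc j)" n]
      by (simp add: A_def b_def exp_of_nat_mult[symmetric])
    have "summable (\<lambda>n. 2 * exp (- b) ^ n)"
      using b by (intro summable_mult summable_geometric) simp
    then show "summable (\<lambda>n. measure (step_space \<mu>) (A j n))"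
      by (rule summable_comparison_test'[where N = 0]) (rule tail)
  qed
  then have "AE X in step_space \<mu>. \<forall>j. \<forall>\<^sub>F n in sequentially. X \<in> space (step_space \<mu>) - A j n"
    unfolding AE_all_countable by (rule allI)
  then show ?thesis
  proof (rule AE_mp, intro AE_I2 impI)
    fix X assume X: "\<forall>j. \<forall>\<^sub>F n in sequentially. X \<in> space (step_space \<mu>) - A j n"
    show "(\<lambda>n. kappa p (walk n X) / real n) \<longlonglongrightarrow> speed"
    proof (rule tendstoI)
      fix e :: real assume "0 < e"
      then obtain j where j: "1 / real (Suc j) < e" by (rule nat_approx_posE)
      have "\<forall>\<^sub>F n in sequentially. 0 < n" by (rule eventually_gt_at_top)
      with X[rule_format, of j] show "\<forall>\<^sub>F n in sequentially. dist (kappa p (walk n X) / real n) speed < e"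
      proof eventually_elim
        case (elim n)
        then have "\<bar>kappa p (walk n X) - real n * speed\<bar> < real n * (1 / real (Suc j))"
          unfolding A_def Diff_iff mem_Collect_eq not_le[symmetric] by blast
        moreover have "\<bar>kappa p (walk n X) / real n - speed\<bar> = \<bar>kappa p (walk n X) - real n * speed\<bar> / real n"
        proof -
          have "kappa p (walk n X) / real n - speed = (kappa p (walk n X) - real n * speed) / real n"
            using elim(2) by (simp add: diff_divide_distrib)
          then show ?thesis by (simp add: abs_divide)
        qed
        ultimately have "\<bar>kappa p (walk n X) / real n - speed\<bar> < 1 / real (Suc j)"
          using elim(2) by (simp only: pos_divide_less_eq of_nat_0_less_iff mult.commute)
        then show ?case using j unfolding dist_real_def by linarith
      qed
    qed
  qed
qed

lemma drift_eq_speed: "drift p \<mu> = speed"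
  unfolding drift_def
proof (rule the_equality)
  show "AE X in step_space \<mu>. (\<lambda>n. kappa p (walk n X) / real n) \<longlonglongrightarrow> speed" by (rule AE_speed)
  interpret P: prob_space "step_space \<mu>" by (rule prob_space_step_space)
  fix l assume "AE X in step_space \<mu>. (\<lambda>n. kappa p (walk n X) / real n) \<longlonglongrightarrow> l"
  with AE_speed have "AE X in step_space \<mu>. l = speed"
    by eventually_elim (rule LIMSEQ_unique)
  then show "l = speed" unfolding P.AE_const .
qed

end

section \<open>The concentration inequality\<close>

lemma ln_plus_bound:
  assumes "0 < K"
  shows "1 + ln (K + 1) \<le> 2 * (ln_plus K + 1)"
proof -
  have "ln (K + 1) \<le> ln_plus K + 1"
  proof (cases "K \<le> 1")
    case True
    then have "ln (K + 1) \<le> K" using assms ln_add_one_self_le_self[of K] by (simp add: add.commute)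
    then show ?thesis using True by (simp add: ln_plus_def)
  next
    case False
    then have "ln (K + 1) \<le> ln (2 * K)" using assms by simp
    also have "\<dots> = ln 2 + ln K" using assms by (simp add: ln_mult)
    also have "\<dots> \<le> 1 + ln K" using ln_le_minus_one[of 2] by simp
    finally show ?thesis by (simp add: ln_plus_def)
  qed
  moreover have "ln_plus K + 2 \<le> 2 * (ln_plus K + 1)" by (simp add: ln_plus_def)
  ultimately show ?thesis by simp
qed

lemma semigroup_generated_subset:
  assumes "g \<in> semigroup_generated S"
  shows "g \<in> generate isom_group S"
  using assms
proof induction
  case (base g)
  then show ?case by (rule generate.incl)
next
  case (comp g h)
  then show ?case using generate.eng[of g isom_group S h] unfolding isom_group_mult by blast
qed

context cocompact_action
begin

text \<open>Serves to bound \<open>K + 2 * \<delta>\<close> by a multiple of K that depends only on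
  \<Gamma> and \<delta>.\<close>

lemma ex_min_displacement: "\<exists>\<kappa>\<^sub>0>0. \<forall>g\<in>\<Gamma>. dist (g p) p = 0 \<or> \<kappa>\<^sub>0 \<le> dist (g p) p"
proof -
  define E where "E = insert 1 ((\<lambda>g. dist (g p) p) ` {g \<in> \<Gamma>. dist (g p) p \<le> 1} - {0})"
  have E: "finite E" "E \<noteq> {}" unfolding E_def using finite_displacement[of 1] by auto
  have "x > 0" if "x \<in> E" for x using that unfolding E_def by auto
  then have "0 < Min E" using E by simp
  moreover have "dist (g p) p = 0 \<or> Min E \<le> dist (g p) p" if g: "g \<in> \<Gamma>" for g
  proof (cases "dist (g p) p \<le> 1 \<and> dist (g p) p \<noteq> 0")
    case True
    then have "dist (g p) p \<in> E" using g unfolding E_def by blast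
    then show ?thesis using E by (intro disjI2 Min_le)
  next
    case False
    have "Min E \<le> 1" using E by (intro Min_le) (auto simp: E_def)
    then show ?thesis using False by linarith
  qed
  ultimately show ?thesis by blast
qed

text \<open>Otherwise all of \<Gamma> would fix \<open>p\<close>. This makes
  \<open>kappa_sup\<close>, by which the final exponent is divided, positive.\<close>

lemma loxodromic_moves_generator:
  assumes a: "loxodromic a" "a \<in> \<Gamma>" and S: "generates S"
  shows "\<exists>s\<in>S. dist (s p) p \<noteq> 0"
proof (rule ccontr)
  assume "\<not> ?thesis"
  then have S_fix: "s p = p" if "s \<in> S" for s using that by auto
  have S_inv_fix: "s p = p" if "s \<in> S \<union> finv ` S" for s
    using that
  proof
    assume "s \<in> finv ` S"
    then obtain t where t: "t \<in> S" "s = finv t" by (rule imageE)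
    then have "isom t" using S \<Gamma>_isom unfolding generates_def by blast
    then show ?thesis using S_fix[OF t(1)] isom_inv_apply(1)[of t p] unfolding t(2) by metis
  qed (rule S_fix)
  have all: "g p = p" if "g \<in> word_ball S n" for g n
    using that
  proof (induction n arbitrary: g)
    case 0
    then show ?case unfolding word_ball.simps by auto
  next
    case (Suc n)
    from Suc.prems show ?case
    proof (cases rule: word_ball_SucE)
      case (2 s h)
      show ?thesis unfolding 2(3) comp_apply Suc.IH[OF 2(2)] by (rule S_inv_fix[OF 2(1)])
    qed (rule Suc.IH)
  qed
  obtain n where "a \<in> word_ball S n" using S a(2) unfolding generates_def by blast
  then have ap: "a p = p" by (rule all)
  have apn: "(a ^^ n) p = p" for n by (induction n) (simp_all add: ap)
  obtain L C where LC: "L \<ge> 1" "C \<ge> 0" and grow: "\<And>n. real n / L - C \<le> dist ((a ^^ n) p) p"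
    using loxodromic_growth[OF a(1)] by blast
  obtain n where "L * C < real n" using reals_Archimedean2 by blast
  then have "C < real n / L" using LC by (simp add: pos_less_divide_eq mult.commute)
  then show False using grow[of n] unfolding apn by simp
qed

text \<open>The loxodromic pair is attached to \<Gamma> and not to a measure, so all constants are
  fixed before \<mu>.\<close>

theorem concentration:
  assumes lox: "a \<in> \<Gamma>" "b \<in> \<Gamma>" "independent_loxodromics p a b"
  shows "\<exists>\<alpha>>0. \<exists>N::nat. \<forall>\<mu> :: ('a \<Rightarrow> 'a) pmf. generates (set_pmf \<mu>) \<longrightarrow>
      (\<forall>t>0. \<forall>n::nat.
        measure (step_space \<mu>)
          {X \<in> space (step_space \<mu>).
             \<bar>kappa p (walk n X) - real n * drift p \<mu>\<bar> \<ge> real n * t}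
        \<le> 2 * exp (- (real n * t\<^sup>2 * (Min (pmf \<mu> ` set_pmf \<mu>)) ^ N) /
             (\<alpha> * (kappa_sup p (set_pmf \<mu>))\<^sup>2 * (ln_plus (kappa_sup p (set_pmf \<mu>)) + 1)\<^sup>2)))"
proof -
  obtain N\<^sub>0 where triple: "\<And>S. generates S \<Longrightarrow> \<exists>q. \<exists>a\<in>word_ball S N\<^sub>0. \<exists>b\<in>word_ball S N\<^sub>0.
      \<exists>c\<in>word_ball S N\<^sub>0. separated_triple \<delta> q a b c"
    using uniform_separated_triple independent_loxodromics_triples[OF lox] by metis
  \<comment> \<open>At least 1, since its square is a divisor in the rate \<tau>.\<close>
  define N where "N = Suc N\<^sub>0"
  obtain C d where C: "0 \<le> C" and bound: "\<forall>\<mu> \<tau> K n x. finite (set_pmf \<mu>) \<and> set_pmf \<mu> \<subseteq> \<Gamma> \<and>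
      0 < \<tau> \<and> \<tau> \<le> 1 \<and> 0 \<le> K \<and> (\<forall>s\<in>set_pmf \<mu>. dist (s p) p \<le> K) \<and>
      (\<forall>k g. heat \<mu> k g \<le> real (2 * k + 1) * exp (- \<tau> * real k)) \<longrightarrow>
      walk_exp \<mu> n (\<lambda>g. gp p x (g p)) \<le> C * (K + 2 * \<delta>) * (1 + ln (K + 1)) / \<tau> ^ d"
    using walk_exp_gp_bound by (elim exE conjE)
  obtain \<kappa>\<^sub>0 where \<kappa>\<^sub>0: "0 < \<kappa>\<^sub>0" "\<And>g. g \<in> \<Gamma> \<Longrightarrow> dist (g p) p = 0 \<or> \<kappa>\<^sub>0 \<le> dist (g p) p"
    using ex_min_displacement by blast
  \<comment> \<open>The 2 accounts for \<open>2 * K\<close> and the rest for \<open>2 * G\<close>: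
    the 4 joins this 2 with the one of \<open>ln_plus_bound\<close>, and the power comes from
    writing \<tau> in terms of the least weight.\<close>
  define \<beta> where "\<beta> = 2 + 4 * C * (1 + 2 * \<delta> / \<kappa>\<^sub>0) * (144 * (real N)\<^sup>2) ^ d"
  have \<beta>: "0 < \<beta>" using C \<kappa>\<^sub>0(1) delta_ge by (simp add: \<beta>_def add_pos_nonneg)
  have "measure (step_space \<mu>) {X \<in> space (step_space \<mu>). \<bar>kappa p (walk n X) - real n * drift p \<mu>\<bar> \<ge> real n * t}
        \<le> 2 * exp (- (real n * t\<^sup>2 * (Min (pmf \<mu> ` set_pmf \<mu>)) ^ (2 * d)) /
             (8 * \<beta>\<^sup>2 * (kappa_sup p (set_pmf \<mu>))\<^sup>2 * (ln_plus (kappa_sup p (set_pmf \<mu>)) + 1)\<^sup>2))"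
    if gen: "generates (set_pmf \<mu>)" and t: "0 < t" for \<mu> :: "('a \<Rightarrow> 'a) pmf" and t n
  proof -
    let ?S = "set_pmf \<mu>"
    have fin: "finite ?S" and S: "?S \<subseteq> \<Gamma>" using gen by (auto simp: generates_def)
    have ne: "?S \<noteq> {}" by (rule set_pmf_not_empty)
    define m where "m = Min (pmf \<mu> ` ?S)"
    have m_le: "m \<le> pmf \<mu> s" if "s \<in> ?S" for s unfolding m_def using fin that by (intro Min_le) auto
    have "m \<in> pmf \<mu> ` ?S" unfolding m_def using fin ne by (intro Min_in) auto
    then have m: "0 < m" "m \<le> 1" by (auto simp: pmf_positive pmf_le_1)
    define K where "K = kappa_sup p ?S"
    have K: "dist (s p) p \<le> K" if "s \<in> ?S" for s
      unfolding K_def kappa_sup_def kappa_def using fin that by (intro cSUP_upper) auto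
    have "\<kappa>\<^sub>0 \<le> K"
    proof -
      have "loxodromic a" using lox(3) by (simp add: independent_loxodromics_def)
      then obtain s where s: "s \<in> ?S" "dist (s p) p \<noteq> 0"
        using loxodromic_moves_generator[OF _ lox(1) gen] by blast
      then have "\<kappa>\<^sub>0 \<le> dist (s p) p" using \<kappa>\<^sub>0(2) S by blast
      then show ?thesis using K[OF s(1)] by linarith
    qed
    then have K0: "0 < K" using \<kappa>\<^sub>0(1) by linarith
    define \<tau> where "\<tau> = m / (144 * (real N)\<^sup>2)"
    have N1: "1 \<le> (real N)\<^sup>2" by (simp add: N_def)
    have \<tau>: "0 < \<tau>" "\<tau> \<le> 1"
    proof -
      show "0 < \<tau>" using m N1 by (simp add: \<tau>_def N_def)
      have "m \<le> 144 * (real N)\<^sup>2" "0 < 144 * (real N)\<^sup>2" using m N1 by linarith+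
      then show "\<tau> \<le> 1" unfolding \<tau>_def by (simp only: divide_le_eq_1_pos)
    qed
    obtain q f g h where fgh: "f \<in> word_ball ?S N\<^sub>0" "g \<in> word_ball ?S N\<^sub>0" "h \<in> word_ball ?S N\<^sub>0"
      "separated_triple \<delta> q f g h" using triple[OF gen] by blast
    have heat: "heat \<mu> k x \<le> real (2 * k + 1) * exp (- \<tau> * real k)" for k x
      unfolding \<tau>_def
      by (rule heat_decay[OF fin S _ word_ball_Suc_mono[OF fgh(1), folded N_def]
            word_ball_Suc_mono[OF fgh(2), folded N_def] word_ball_Suc_mono[OF fgh(3), folded N_def] fgh(4) m_le])
        (use m in \<open>simp_all add: N_def\<close>)
    define G where "G = C * (K + 2 * \<delta>) * (1 + ln (K + 1)) / \<tau> ^ d"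
    have G: "walk_exp \<mu> n (\<lambda>g. gp p x (g p)) \<le> G" for n x
      unfolding G_def using K0
      by (intro bound[rule_format] conjI ballI allI fin S \<tau> heat K) simp_all
    interpret W: bounded_walk \<delta> p \<Gamma> D \<mu> K G
      by (intro bounded_walk.intro bounded_walk_axioms.intro cocompact_action_axioms fin S K0 K G)
    define l where "l = ln_plus K + 1"
    have l: "1 \<le> l" by (simp add: l_def ln_plus_def)
    have md: "0 < m ^ d" "m ^ d \<le> 1" using m by (auto simp: power_le_one)
    have c_le: "2 * K + 2 * G \<le> \<beta> * (K * l) / m ^ d"
    proof -
      have "K + 2 * \<delta> \<le> K * (1 + 2 * \<delta> / \<kappa>\<^sub>0)"
      proof -
        have "2 * \<delta> = \<kappa>\<^sub>0 * (2 * \<delta> / \<kappa>\<^sub>0)" using \<kappa>\<^sub>0(1) by simp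
        also have "\<dots> \<le> K * (2 * \<delta> / \<kappa>\<^sub>0)" using \<open>\<kappa>\<^sub>0 \<le> K\<close> \<kappa>\<^sub>0(1) delta_ge by (intro mult_right_mono) auto
        finally show ?thesis by (simp add: distrib_left)
      qed
      then have "C * (K + 2 * \<delta>) * (1 + ln (K + 1)) \<le> C * (K * (1 + 2 * \<delta> / \<kappa>\<^sub>0)) * (2 * l)"
        using C K0 \<kappa>\<^sub>0(1) delta_ge ln_plus_bound[OF K0] unfolding l_def
        by (intro mult_mono mult_left_mono mult_nonneg_nonneg) auto
      then have "G \<le> C * (K * (1 + 2 * \<delta> / \<kappa>\<^sub>0)) * (2 * l) / \<tau> ^ d"
        unfolding G_def using \<tau> by (intro divide_right_mono) auto
      also have "\<dots> = (2 * C * (1 + 2 * \<delta> / \<kappa>\<^sub>0) * (144 * (real N)\<^sup>2) ^ d) * (K * l) / m ^ d"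
        unfolding \<tau>_def power_divide by (simp add: ac_simps)
      finally have G_le: "G \<le> (2 * C * (1 + 2 * \<delta> / \<kappa>\<^sub>0) * (144 * (real N)\<^sup>2) ^ d) * (K * l) / m ^ d" .
      have "K * m ^ d \<le> K * l * 1" unfolding mult.assoc using K0 l md by (intro mult_left_mono) auto
      then have "K \<le> K * l / m ^ d" using md by (simp add: pos_le_divide_eq)
      then have "2 * K + 2 * G \<le> 2 * (K * l / m ^ d)
          + 2 * ((2 * C * (1 + 2 * \<delta> / \<kappa>\<^sub>0) * (144 * (real N)\<^sup>2) ^ d) * (K * l) / m ^ d)"
        using G_le by linarith
      also have "\<dots> = \<beta> * (K * l) / m ^ d"
        unfolding \<beta>_def by (simp add: add_divide_distrib distrib_right)
      finally show ?thesis .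
    qed
    have c0: "0 < 2 * K + 2 * G" using K0 W.G_nonneg by linarith
    \<comment> \<open>Squaring doubles the exponent of the least weight, hence
      \<open>2 * d\<close>.\<close>
    have "(2 * K + 2 * G)\<^sup>2 \<le> (\<beta> * (K * l) / m ^ d)\<^sup>2" using c_le c0 by (intro power_mono) auto
    also have "\<dots> = \<beta>\<^sup>2 * K\<^sup>2 * l\<^sup>2 / m ^ (2 * d)"
      by (simp add: power_mult_distrib power_divide power_mult mult.commute)
    finally have c2: "8 * (2 * K + 2 * G)\<^sup>2 \<le> 8 * \<beta>\<^sup>2 * K\<^sup>2 * l\<^sup>2 / m ^ (2 * d)" by simp
    have "real n * t\<^sup>2 * m ^ (2 * d) / (8 * \<beta>\<^sup>2 * K\<^sup>2 * l\<^sup>2)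
        = real n * t\<^sup>2 / (8 * \<beta>\<^sup>2 * K\<^sup>2 * l\<^sup>2 / m ^ (2 * d))" by simp
    also have "\<dots> \<le> real n * t\<^sup>2 / (8 * (2 * K + 2 * G)\<^sup>2)"
      using c2 c0 \<beta> K0 l m by (intro divide_left_mono) auto
    finally have "2 * exp (- (real n * t\<^sup>2 / (8 * (2 * K + 2 * G)\<^sup>2)))
        \<le> 2 * exp (- (real n * t\<^sup>2 * m ^ (2 * d)) / (8 * \<beta>\<^sup>2 * K\<^sup>2 * l\<^sup>2))" by simp
    then show ?thesis
      using W.deviation_from_speed[OF t, of n] unfolding W.drift_eq_speed m_def K_def l_def by linarith
  qed
  then show ?thesis using \<beta> by (intro exI[of _ "8 * \<beta>\<^sup>2"] conjI exI[of _ "2 * d"]) auto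
qed

end

theorem corollary1p4:
  fixes p :: "'a::metric_space"
  assumes "proper_space TYPE('a)"
    and "geodesic_space TYPE('a)"
    and "hyperbolic_space TYPE('a)"
  shows "\<exists>A>0. \<forall>\<Gamma> :: ('a \<Rightarrow> 'a) set.
    subgroup \<Gamma> isom_group \<and> acts_properly \<Gamma> \<and> acts_cocompactly \<Gamma> \<longrightarrow>
    (\<exists>\<alpha>>0. \<exists>N::nat. \<forall>\<mu> :: ('a \<Rightarrow> 'a) pmf.
      non_elementary p \<mu> \<and> finite (set_pmf \<mu>) \<and> generate isom_group (set_pmf \<mu>) = \<Gamma> \<longrightarrow>
      (\<forall>t>0. \<forall>n::nat.
        measure (step_space \<mu>)
          {X \<in> space (step_space \<mu>).
             \<bar>kappa p (walk n X) - real n * drift p \<mu>\<bar> \<ge> real n * t}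
        \<le> 2 * exp (- (real n * t\<^sup>2 * (Min (pmf \<mu> ` set_pmf \<mu>)) ^ N) /
             (\<alpha> * (kappa_sup p (set_pmf \<mu>))\<^sup>2 * (ln_plus (kappa_sup p (set_pmf \<mu>)) + A)\<^sup>2))))"
proof (rule exI[of _ 1], intro conjI allI impI)
  \<comment> \<open>The constant 1 serves every space, since the scale of \<delta> goes into
    \<alpha>, which may depend on \<Gamma>.\<close>
  fix \<Gamma> :: "('a \<Rightarrow> 'a) set"
  assume \<Gamma>: "subgroup \<Gamma> isom_group \<and> acts_properly \<Gamma> \<and> acts_cocompactly \<Gamma>"
  obtain \<delta>\<^sub>0 where \<delta>\<^sub>0: "\<And>x y z q :: 'a.
      min (gromov_product q x z) (gromov_product q z y) - \<delta>\<^sub>0 \<le> gromov_product q x y"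
    using assms(3) unfolding hyperbolic_space_def by blast
  obtain B where B: "compact B" "(\<Union>g\<in>\<Gamma>. g ` B) = UNIV"
    using \<Gamma> unfolding acts_cocompactly_def by blast
  obtain D where D: "\<And>x. x \<in> B \<Longrightarrow> dist p x \<le> D"
    using compact_imp_bounded[OF B(1)] bounded_any_center[of B p] by blast
  define \<delta> where "\<delta> = max 1 \<delta>\<^sub>0"
  have iso: "isom g" if "g \<in> \<Gamma>" for g using \<Gamma> subgroup.subset that by blast
  interpret cocompact_action \<delta> p \<Gamma> D
  proof (intro cocompact_action.intro cocompact_action_axioms.intro hyperbolic_metric.intro)
    show "1 \<le> \<delta>" by (simp add: \<delta>_def)
    show "min (gp q x z) (gp q z y) - \<delta> \<le> gp q x y" for q x z y :: 'a
      using \<delta>\<^sub>0[of q x z y] by (simp add: \<delta>_def)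
    show "subgroup \<Gamma> isom_group" using \<Gamma> by blast
    show "geodesic_space TYPE('a)" by fact
    show "finite {g \<in> \<Gamma>. dist (g p) p \<le> r}" for r
    proof (rule finite_subset)
      show "{g \<in> \<Gamma>. dist (g p) p \<le> r} \<subseteq> {g \<in> \<Gamma>. g ` cball p r \<inter> cball p r \<noteq> {}}"
      proof clarify
        fix g assume g: "dist (g p) p \<le> r" and empty: "g ` cball p r \<inter> cball p r = {}"
        have "0 \<le> r" by (rule order_trans[OF zero_le_dist g])
        then have "p \<in> cball p r" "g p \<in> cball p r"
          using g by (simp_all add: dist_commute)
        then show False using empty by blast
      qed
      have "compact (cball p r)" using assms(1) unfolding proper_space_def by blast
      then show "finite {g \<in> \<Gamma>. g ` cball p r \<inter> cball p r \<noteq> {}}"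
        using \<Gamma> unfolding acts_properly_def by blast
    qed
    show "\<exists>g\<in>\<Gamma>. dist x (g p) \<le> D" for x
    proof -
      have "x \<in> (\<Union>g\<in>\<Gamma>. g ` B)" unfolding B(2) by (rule UNIV_I)
      then obtain g y where "g \<in> \<Gamma>" "y \<in> B" "x = g y" by blast
      then show ?thesis
        using D[of y] isom_dist[OF iso, of g y p] by (intro bexI[of _ g]) (simp_all add: dist_commute)
    qed
  qed
  have gen: "generates (set_pmf \<mu>)"
    if "finite (set_pmf \<mu>)" "generate isom_group (set_pmf \<mu>) = \<Gamma>" for \<mu> :: "('a \<Rightarrow> 'a) pmf"
  proof -
    have S: "set_pmf \<mu> \<subseteq> \<Gamma>" using generate.incl[of _ "set_pmf \<mu>" isom_group] that(2) by blast
    then have "set_pmf \<mu> \<subseteq> carrier isom_group" using iso by blast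
    then have "\<forall>g\<in>\<Gamma>. \<exists>n. g \<in> word_ball (set_pmf \<mu>) n"
      using generate_word_ball that(2) by blast
    then show ?thesis using S that(1) set_pmf_not_empty[of \<mu>] unfolding generates_def by blast
  qed
  show "\<exists>\<alpha>>0. \<exists>N::nat. \<forall>\<mu> :: ('a \<Rightarrow> 'a) pmf.
      non_elementary p \<mu> \<and> finite (set_pmf \<mu>) \<and> generate isom_group (set_pmf \<mu>) = \<Gamma> \<longrightarrow>
      (\<forall>t>0. \<forall>n::nat.
        measure (step_space \<mu>)
          {X \<in> space (step_space \<mu>).
             \<bar>kappa p (walk n X) - real n * drift p \<mu>\<bar> \<ge> real n * t}
        \<le> 2 * exp (- (real n * t\<^sup>2 * (Min (pmf \<mu> ` set_pmf \<mu>)) ^ N) /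
             (\<alpha> * (kappa_sup p (set_pmf \<mu>))\<^sup>2 * (ln_plus (kappa_sup p (set_pmf \<mu>)) + 1)\<^sup>2)))"
  proof (cases "\<exists>a\<in>\<Gamma>. \<exists>b\<in>\<Gamma>. independent_loxodromics p a b")
    \<comment> \<open>Deciding this for \<Gamma> keeps the constants independent of \<mu>; without
      such a pair no measure generating \<Gamma> is non-elementary.\<close>
    case True
    then obtain a b where "a \<in> \<Gamma>" "b \<in> \<Gamma>" "independent_loxodromics p a b" by blast
    from concentration[OF this] show ?thesis using gen by meson
  next
    case False
    have "\<not> non_elementary p \<mu>" if "generate isom_group (set_pmf \<mu>) = \<Gamma>" for \<mu> :: "('a \<Rightarrow> 'a) pmf"
      using False semigroup_generated_subset[of _ "set_pmf \<mu>"] that unfolding non_elementary_def by blast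
    then show ?thesis by (intro exI[of _ 1]) auto
  qed
qed simp

end
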